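(* Let $(M,g,J)$ be an almost Hermitian $4$-manifold such that the open set $M_+=\{x\in M: W_+(x)\neq 0\}$ is dense in $M$. Then $(M,g,J)$ is Kähler if and only if the equation $$|W_+|^2=\frac38\Big(S_\star-\frac S3\Big)^2$$ holds on $M$ and, moreover, the equation $$|\nabla W_+|^2=\big|\nabla |W_+|\big|^2$$ holds on $M_+$.
   Context: Almost Hermitian $4$-manifold: a smooth Riemannian manifold $(M,g)$ of real dimension $4$ with an endomorphism field $J$ of $TM$ satisfying $J^2=-1$, $J^*=-J$. Its fundamental form is $\Omega(X,Y)=g(JX,Y)$ and it is oriented by the volume form $\omega=\frac12\Omega\wedge\Omega$. It is Kähler if $\nabla J=0$, where $\nabla$ is the Levi-Civita connection. $(X_k)$ denotes a local orthonormal frame; repeated indices are summed. $R(X,Y)Z=\nabla^2_{X,Y}Z-\nabla^2_{Y,X}Z$ with $\nabla^2_{X,Y}=\nabla_X\circ\nabla_Y-\nabla_{\nabla_XY}$; $\mathrm{Ric}(X)=R(X,X_k)X_k$; $S=\mathrm{tr}(\mathrm{Ric})$; star Ricci tensor $\mathrm{Ric}_\star(X)=R(JX,JX_k)X_k$; star scalar curvature $S_\star=\mathrm{tr}(\mathrm{Ric}_\star)$. Skew-symmetric endomorphisms $A$ of $TM$ are identified with $2$-forms via $\Omega_A(X,Y)=g(AX,Y)$, with scalar product $\langle A,B\rangle=\frac14\mathrm{tr}(A^*\circ B)$. The Weyl tensor $W$ (the totally trace-free part of $R$) acts on them by $W(A)=W(AX_k,X_k)$; it preserves the bundle $\Lambda^2_+$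 of self-dual $2$-forms, and $W_+:\Lambda^2_+\to\Lambda^2_+$ is its restriction. $|W_+|^2=\mathrm{tr}(W_+\circ W_+)$, $|\nabla W_+|^2=\mathrm{tr}(\nabla_{X_k}W_+\circ\nabla_{X_k}W_+)$, and $|\nabla f|^2=g(\nabla f,\nabla f)$ for a function $f$. *)

theory Defs
  imports "HOL-Analysis.Analysis"
begin

section \<open>Smooth maps on open sets\<close>

primrec Ck_on :: "nat \<Rightarrow> ('a::real_normed_vector \<Rightarrow> 'b::real_normed_vector) \<Rightarrow> 'a set \<Rightarrow> bool" where
  "Ck_on 0 f S \<longleftrightarrow> continuous_on S f"
| "Ck_on (Suc n) f S \<longleftrightarrow> (\<forall>x\<in>S. f differentiable (at x)) \<and>
     (\<forall>v. Ck_on n (\<lambda>x. frechet_derivative f (at x) v) S)"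

definition smooth_on :: "'a set \<Rightarrow> ('a::real_normed_vector \<Rightarrow> 'b::real_normed_vector) \<Rightarrow> bool" where
  "smooth_on S f \<longleftrightarrow> (\<forall>n. Ck_on n f S)"


section \<open>Almost Hermitian 4-manifolds\<close>

text \<open>The manifold is the whole type \<open>'m\<close> (Hausdorff and second countable by its sort) with a
  smooth atlas, not required to be maximal. A chart is a pair (domain, coordinate map).\<close>

type_synonym 'm chart = "'m set \<times> ('m \<Rightarrow> real^4)"

definition is_chart :: "'m::topological_space chart \<Rightarrow> bool" where
  "is_chart c \<longleftrightarrow> open (fst c) \<and> open (snd c ` fst c) \<and>
     (\<exists>\<psi>. homeomorphism (fst c) (snd c ` fst c) (snd c) \<psi>)"

definition transition :: "'m chart \<Rightarrow> 'm chart \<Rightarrow> real^4 \<Rightarrow> real^4" where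
  "transition c c' = snd c' \<circ> inv_into (fst c) (snd c)"

definition smooth_atlas :: "'m::topological_space chart set \<Rightarrow> bool" where
  "smooth_atlas \<A> \<longleftrightarrow> (\<forall>c\<in>\<A>. is_chart c) \<and> (\<Union>c\<in>\<A>. fst c) = UNIV \<and>
     (\<forall>c\<in>\<A>. \<forall>c'\<in>\<A>. smooth_on (snd c ` (fst c \<inter> fst c')) (transition c c'))"

text \<open>The bilinear form with Gram matrix \<open>m\<close>.\<close>

definition gip :: "real^4^4 \<Rightarrow> real^4 \<Rightarrow> real^4 \<Rightarrow> real" where
  "gip m u v = u \<bullet> (m *v v)"

text \<open>Tensor fields are given by their component matrices in every chart, as smooth functions of
  the coordinates which obey the tensor transformation law under a change of charts.\<close>

definition riemannian_metric :: "'m::topological_space chart set \<Rightarrow> ('m chart \<Rightarrow> real^4 \<Rightarrow> real^4^4) \<Rightarrow> bool" where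
  "riemannian_metric \<A> g \<longleftrightarrow>
     (\<forall>c\<in>\<A>. smooth_on (snd c ` fst c) (g c) \<and>
        (\<forall>x\<in>snd c ` fst c. (\<forall>u v. gip (g c x) u v = gip (g c x) v u) \<and>
           (\<forall>u. u \<noteq> 0 \<longrightarrow> gip (g c x) u u > 0))) \<and>
     (\<forall>c\<in>\<A>. \<forall>c'\<in>\<A>. \<forall>x\<in>snd c ` (fst c \<inter> fst c').
        let \<tau> = transition c c'; D = frechet_derivative \<tau> (at x) in
        \<forall>u v. gip (g c' (\<tau> x)) (D u) (D v) = gip (g c x) u v)"

definition endomorphism_field :: "'m::topological_space chart set \<Rightarrow> ('m chart \<Rightarrow> real^4 \<Rightarrow> real^4^4) \<Rightarrow> bool" where
  "endomorphism_field \<A> J \<longleftrightarrow>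
     (\<forall>c\<in>\<A>. smooth_on (snd c ` fst c) (J c)) \<and>
     (\<forall>c\<in>\<A>. \<forall>c'\<in>\<A>. \<forall>x\<in>snd c ` (fst c \<inter> fst c').
        let \<tau> = transition c c'; D = frechet_derivative \<tau> (at x) in
        \<forall>u. J c' (\<tau> x) *v D u = D (J c x *v u))"

definition almost_hermitian_4_manifold ::
  "'m::topological_space chart set \<Rightarrow> ('m chart \<Rightarrow> real^4 \<Rightarrow> real^4^4) \<Rightarrow> ('m chart \<Rightarrow> real^4 \<Rightarrow> real^4^4) \<Rightarrow> bool" where
  "almost_hermitian_4_manifold \<A> g J \<longleftrightarrow>
     smooth_atlas \<A> \<and> riemannian_metric \<A> g \<and> endomorphism_field \<A> J \<and>
     (\<forall>c\<in>\<A>. \<forall>x\<in>snd c ` fst c.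
        J c x ** J c x = - mat 1 \<and>
        (\<forall>u v. gip (g c x) (J c x *v u) v = - gip (g c x) u (J c x *v v)))"


section \<open>Riemannian geometry in a coordinate patch\<close>

text \<open>From here on \<open>G\<close> is the Gram matrix of the metric as a function of the coordinates of one chart,
  and vector fields are functions \<open>real^4 \<Rightarrow> real^4\<close> of these coordinates.\<close>

text \<open>\<open>contract m B\<close> is the sum of \<open>B X\<^sub>k X\<^sub>k\<close> over an orthonormal frame of \<open>m\<close>
  (lemma \<open>contract_frame\<close>).\<close>

definition contract :: "real^4^4 \<Rightarrow> (real^4 \<Rightarrow> real^4 \<Rightarrow> 'b::real_vector) \<Rightarrow> 'b" where
  "contract m B = (\<Sum>i\<in>UNIV. \<Sum>j\<in>UNIV. (matrix_inv m $ i $ j) *\<^sub>R B (axis i 1) (axis j 1))"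

text \<open>The Christoffel symbols of the Levi-Civita connection; see \<open>christoffel_iff\<close>, which says that
  this is the unique torsion-free metric connection.\<close>

definition christoffel :: "(real^4 \<Rightarrow> real^4^4) \<Rightarrow> real^4 \<Rightarrow> real^4 \<Rightarrow> real^4 \<Rightarrow> real^4" where
  "christoffel G x u v = (let dG = frechet_derivative G (at x) in
     matrix_inv (G x) *v (\<chi> k. (gip (dG u) v (axis k 1) + gip (dG v) u (axis k 1)
        - gip (dG (axis k 1)) u v) / 2))"

definition nabla :: "(real^4 \<Rightarrow> real^4^4) \<Rightarrow> (real^4 \<Rightarrow> real^4) \<Rightarrow> (real^4 \<Rightarrow> real^4) \<Rightarrow> real^4 \<Rightarrow> real^4" where
  "nabla G X Y x = frechet_derivative Y (at x) (X x) + christoffel G x (X x) (Y x)"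

definition nabla2 :: "(real^4 \<Rightarrow> real^4^4) \<Rightarrow> (real^4 \<Rightarrow> real^4) \<Rightarrow> (real^4 \<Rightarrow> real^4) \<Rightarrow>
    (real^4 \<Rightarrow> real^4) \<Rightarrow> real^4 \<Rightarrow> real^4" where
  "nabla2 G X Y Z x = nabla G X (nabla G Y Z) x - nabla G (nabla G X Y) Z x"

text \<open>Tensors built from derivatives are evaluated on tangent vectors by extending these to vector
  fields with constant coordinates (the value does not depend on the extension).\<close>

definition curvature :: "(real^4 \<Rightarrow> real^4^4) \<Rightarrow> real^4 \<Rightarrow> real^4 \<Rightarrow> real^4 \<Rightarrow> real^4 \<Rightarrow> real^4" where
  "curvature G x u v w = nabla2 G (\<lambda>_. u) (\<lambda>_. v) (\<lambda>_. w) x - nabla2 G (\<lambda>_. v) (\<lambda>_. u) (\<lambda>_. w) x"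

definition Ric :: "(real^4 \<Rightarrow> real^4^4) \<Rightarrow> real^4 \<Rightarrow> real^4 \<Rightarrow> real^4" where
  "Ric G x u = contract (G x) (\<lambda>v v'. curvature G x u v v')"

definition scal :: "(real^4 \<Rightarrow> real^4^4) \<Rightarrow> real^4 \<Rightarrow> real" where
  "scal G x = trace (matrix (Ric G x))"

definition Ric_star :: "(real^4 \<Rightarrow> real^4^4) \<Rightarrow> (real^4 \<Rightarrow> real^4^4) \<Rightarrow> real^4 \<Rightarrow> real^4 \<Rightarrow> real^4" where
  "Ric_star G J x u = contract (G x) (\<lambda>v v'. curvature G x (J x *v u) (J x *v v) v')"

definition scal_star :: "(real^4 \<Rightarrow> real^4^4) \<Rightarrow> (real^4 \<Rightarrow> real^4^4) \<Rightarrow> real^4 \<Rightarrow> real" where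
  "scal_star G J x = trace (matrix (Ric_star G J x))"

text \<open>In dimension 4 the curvature tensor is the sum of its totally trace-free part and the
  Kulkarni-Nomizu product of the metric with the Schouten tensor (cf. \<open>weyl_trace_free\<close>).\<close>

definition schouten :: "(real^4 \<Rightarrow> real^4^4) \<Rightarrow> real^4 \<Rightarrow> real^4 \<Rightarrow> real^4" where
  "schouten G x u = (1/2) *\<^sub>R (Ric G x u - (scal G x / 6) *\<^sub>R u)"

definition weyl :: "(real^4 \<Rightarrow> real^4^4) \<Rightarrow> real^4 \<Rightarrow> real^4 \<Rightarrow> real^4 \<Rightarrow> real^4 \<Rightarrow> real^4" where
  "weyl G x u v w = curvature G x u v w
     - (gip (G x) (schouten G x v) w *\<^sub>R u - gip (G x) (schouten G x u) w *\<^sub>R v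
        + gip (G x) v w *\<^sub>R schouten G x u - gip (G x) u w *\<^sub>R schouten G x v)"

text \<open>The Weyl tensor as operator on endomorphisms, \<open>W(A) = W(A X\<^sub>k, X\<^sub>k)\<close>.\<close>

definition weyl_op :: "(real^4 \<Rightarrow> real^4^4) \<Rightarrow> real^4 \<Rightarrow> real^4^4 \<Rightarrow> real^4^4" where
  "weyl_op G x A = matrix (\<lambda>w. contract (G x) (\<lambda>u v. weyl G x (A *v u) v w))"

definition nabla_end :: "(real^4 \<Rightarrow> real^4^4) \<Rightarrow> (real^4 \<Rightarrow> real^4) \<Rightarrow> (real^4 \<Rightarrow> real^4^4) \<Rightarrow> real^4 \<Rightarrow> real^4^4" where
  "nabla_end G X A x =
     matrix (\<lambda>v. nabla G X (\<lambda>y. A y *v v) x - A x *v nabla G X (\<lambda>_. v) x)"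

text \<open>The covariant derivative of the Weyl operator in direction \<open>u\<close>. Since the Levi-Civita connection
  preserves the bundle of self-dual forms, its restriction to self-dual forms is the covariant
  derivative of the restriction of the Weyl operator.\<close>

definition nabla_weyl_op :: "(real^4 \<Rightarrow> real^4^4) \<Rightarrow> real^4 \<Rightarrow> real^4 \<Rightarrow> real^4^4 \<Rightarrow> real^4^4" where
  "nabla_weyl_op G x u A = nabla_end G (\<lambda>_. u) (\<lambda>y. weyl_op G y A) x
     - weyl_op G x (nabla_end G (\<lambda>_. u) (\<lambda>_. A) x)"

definition grad :: "(real^4 \<Rightarrow> real^4^4) \<Rightarrow> (real^4 \<Rightarrow> real) \<Rightarrow> real^4 \<Rightarrow> real^4" where
  "grad G f x = contract (G x) (\<lambda>u v. frechet_derivative f (at x) u *\<^sub>R v)"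


section \<open>Self-dual 2-forms\<close>

text \<open>\<open>form2 m A\<close> is the 2-form of the skew-symmetric endomorphism \<open>A\<close>.\<close>

definition form2 :: "real^4^4 \<Rightarrow> real^4^4 \<Rightarrow> real^4 \<Rightarrow> real^4 \<Rightarrow> real" where
  "form2 m A u v = gip m (A *v u) v"

definition wedge22 :: "(real^4 \<Rightarrow> real^4 \<Rightarrow> real) \<Rightarrow> (real^4 \<Rightarrow> real^4 \<Rightarrow> real) \<Rightarrow>
    real^4 \<Rightarrow> real^4 \<Rightarrow> real^4 \<Rightarrow> real^4 \<Rightarrow> real" where
  "wedge22 \<alpha> \<beta> a b c d = \<alpha> a b * \<beta> c d - \<alpha> a c * \<beta> b d + \<alpha> a d * \<beta> b c
     + \<alpha> b c * \<beta> a d - \<alpha> b d * \<beta> a c + \<alpha> c d * \<beta> a b"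

definition vol_form :: "real^4^4 \<Rightarrow> real^4^4 \<Rightarrow> real^4 \<Rightarrow> real^4 \<Rightarrow> real^4 \<Rightarrow> real^4 \<Rightarrow> real" where
  "vol_form m j a b c d = wedge22 (form2 m j) (form2 m j) a b c d / 2"

text \<open>\<open>(*\<alpha>)(a,b)\<close> is half the sum of \<open>\<alpha>(X\<^sub>k,X\<^sub>l) \<omega>(X\<^sub>k,X\<^sub>l,a,b)\<close> over all \<open>k\<close>, \<open>l\<close>.\<close>

definition hodge2 :: "real^4^4 \<Rightarrow> real^4^4 \<Rightarrow> (real^4 \<Rightarrow> real^4 \<Rightarrow> real) \<Rightarrow> real^4 \<Rightarrow> real^4 \<Rightarrow> real" where
  "hodge2 m j \<alpha> a b =
     contract m (\<lambda>u u'. contract m (\<lambda>v v'. \<alpha> u v * vol_form m j u' v' a b)) / 2"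

definition self_dual :: "real^4^4 \<Rightarrow> real^4^4 \<Rightarrow> (real^4^4) set" where
  "self_dual m j = {A. (\<forall>u v. gip m (A *v u) v = - gip m u (A *v v)) \<and>
                       hodge2 m j (form2 m A) = form2 m A}"

text \<open>The trace of an endomorphism \<open>F\<close> of a finite-dimensional subspace \<open>V\<close>, by means of an arbitrary
  basis of \<open>V\<close> (lemma \<open>trace_on_eq\<close>).\<close>

definition trace_on :: "'a::euclidean_space set \<Rightarrow> ('a \<Rightarrow> 'a) \<Rightarrow> real" where
  "trace_on V F = (let B = (SOME B. independent B \<and> span B = V) in
     \<Sum>b\<in>B. representation B (F b) b)"

definition Wplus_norm2 :: "(real^4 \<Rightarrow> real^4^4) \<Rightarrow> (real^4 \<Rightarrow> real^4^4) \<Rightarrow> real^4 \<Rightarrow> real" where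
  "Wplus_norm2 G J x = trace_on (self_dual (G x) (J x)) (\<lambda>A. weyl_op G x (weyl_op G x A))"

definition nabla_Wplus_norm2 :: "(real^4 \<Rightarrow> real^4^4) \<Rightarrow> (real^4 \<Rightarrow> real^4^4) \<Rightarrow> real^4 \<Rightarrow> real" where
  "nabla_Wplus_norm2 G J x = contract (G x) (\<lambda>u v.
     trace_on (self_dual (G x) (J x)) (\<lambda>A. nabla_weyl_op G x u (nabla_weyl_op G x v A)))"

definition grad_norm2 :: "(real^4 \<Rightarrow> real^4^4) \<Rightarrow> (real^4 \<Rightarrow> real) \<Rightarrow> real^4 \<Rightarrow> real" where
  "grad_norm2 G f x = gip (G x) (grad G f x) (grad G f x)"


section \<open>The Kaehler condition and the set where the self-dual Weyl tensor does not vanish\<close>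

definition kaehler :: "'m chart set \<Rightarrow> ('m chart \<Rightarrow> real^4 \<Rightarrow> real^4^4) \<Rightarrow> ('m chart \<Rightarrow> real^4 \<Rightarrow> real^4^4) \<Rightarrow> bool" where
  "kaehler \<A> g J \<longleftrightarrow> (\<forall>c\<in>\<A>. \<forall>p\<in>fst c. \<forall>u. nabla_end (g c) (\<lambda>_. u) (J c) (snd c p) = 0)"

definition M_plus :: "'m chart set \<Rightarrow> ('m chart \<Rightarrow> real^4 \<Rightarrow> real^4^4) \<Rightarrow> ('m chart \<Rightarrow> real^4 \<Rightarrow> real^4^4) \<Rightarrow> 'm set" where
  "M_plus \<A> g J = {p. \<exists>c\<in>\<A>. p \<in> fst c \<and>
     (\<exists>A\<in>self_dual (g c (snd c p)) (J c (snd c p)). weyl_op (g c) (snd c p) A \<noteq> 0)}"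


section \<open>Adequacy of the definitions\<close>

lemma gip_left_linear: "linear (\<lambda>u. gip m u v)"
  unfolding gip_def by (simp add: linear_iff inner_add_left)

lemma gip_right_linear: "linear (\<lambda>v. gip m u v)"
  unfolding gip_def
  by (simp add: linear_iff inner_add_right matrix_vector_right_distrib scaleR_matrix_vector_assoc[symmetric] matrix_vector_mult_scaleR)

lemma gip_axis: "gip m (axis i 1) (axis j 1) = m $ i $ j"
  by (simp add: gip_def inner_axis matrix_vector_mul_component inner_axis' matrix_vector_mult_basis column_def)

lemma posdef_invertible:
  assumes "\<And>u. u \<noteq> 0 \<Longrightarrow> gip m u u > 0"
  shows "invertible m"
proof -
  have "u = 0" if "m *v u = 0" for u
    using assms[of u] that by (force simp: gip_def)
  then show ?thesis
    using matrix_left_invertible_ker invertible_left_inverse by blast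
qed

lemma matrix_inv_inverse:
  fixes m :: "real^4^4"
  assumes "invertible m"
  shows "m ** matrix_inv m = mat 1" "matrix_inv m ** m = mat 1"
proof -
  have "m ** matrix_inv m = mat 1 \<and> matrix_inv m ** m = mat 1"
    using assms unfolding invertible_def matrix_inv_def by (rule someI_ex)
  then show "m ** matrix_inv m = mat 1" "matrix_inv m ** m = mat 1"
    by blast+
qed

lemma contract_frame:
  fixes E :: "4 \<Rightarrow> real^4" and B :: "real^4 \<Rightarrow> real^4 \<Rightarrow> 'b::real_vector"
  assumes on: "\<And>i j. gip m (E i) (E j) = (if i = j then 1 else 0)"
    and B1: "\<And>v. linear (\<lambda>u. B u v)" and B2: "\<And>u. linear (B u)"
  shows "contract m B = (\<Sum>k\<in>UNIV. B (E k) (E k))"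
proof -
  define e where "e = (\<chi> i k. E k $ i)"
  have col: "e *v axis k 1 = E k" for k
    by (simp add: matrix_vector_mult_basis column_def e_def vec_eq_iff)
  have "(transpose e ** (m ** e)) $ i $ j = gip m (E i) (E j)" for i j
    unfolding gip_def matrix_matrix_mult_def transpose_def matrix_vector_mult_def inner_vec_def e_def
    by simp
  then have id: "transpose e ** (m ** e) = mat 1"
    by (simp add: vec_eq_iff on mat_def)
  then have "(m ** e) ** transpose e = mat 1"
    using matrix_left_right_inverse by blast
  then have mi: "m ** (e ** transpose e) = mat 1"
    by (simp add: matrix_mul_assoc)
  then have mi2: "(e ** transpose e) ** m = mat 1"
    using matrix_left_right_inverse by blast
  have "matrix_inv m = matrix_inv m ** (m ** (e ** transpose e))"
    by (simp add: mi)
  also have "\<dots> = e ** transpose e"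
    using mi mi2 matrix_inv_inverse(2)[of m]
    by (metis invertible_def matrix_mul_assoc matrix_mul_lid)
  finally have "matrix_inv m = e ** transpose e" .
  then have inv: "matrix_inv m $ i $ j = (\<Sum>k\<in>UNIV. E k $ i * E k $ j)" for i j
    by (simp add: matrix_matrix_mult_def transpose_def e_def)
  have ex: "E k = (\<Sum>i\<in>UNIV. E k $ i *\<^sub>R axis i 1)" for k
    by (simp add: vec_eq_iff axis_def if_distrib cong: if_cong)
  have "B (E k) (E k) = (\<Sum>i\<in>UNIV. \<Sum>j\<in>UNIV. (E k $ i * E k $ j) *\<^sub>R B (axis i 1) (axis j 1))" for k
  proof -
    have 1: "B (E k) w = (\<Sum>i\<in>UNIV. E k $ i *\<^sub>R B (axis i 1) w)" for w
      by (subst ex[of k]) (simp add: linear_sum[OF B1] linear_scale[OF B1])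
    have 2: "B w (E k) = (\<Sum>i\<in>UNIV. E k $ i *\<^sub>R B w (axis i 1))" for w
      by (subst ex[of k]) (simp add: linear_sum[OF B2] linear_scale[OF B2])
    have "B (E k) (E k) = (\<Sum>i\<in>UNIV. E k $ i *\<^sub>R (\<Sum>j\<in>UNIV. E k $ j *\<^sub>R B (axis i 1) (axis j 1)))"
      by (subst 1, subst 2) (rule refl)
    then show ?thesis
      by (simp add: scaleR_sum_right)
  qed
  then have "(\<Sum>k\<in>UNIV. B (E k) (E k)) =
      (\<Sum>k\<in>UNIV. \<Sum>i\<in>UNIV. \<Sum>j\<in>UNIV. (E k $ i * E k $ j) *\<^sub>R B (axis i 1) (axis j 1))"
    by simp
  also have "\<dots> = (\<Sum>i\<in>UNIV. \<Sum>k\<in>UNIV. \<Sum>j\<in>UNIV. (E k $ i * E k $ j) *\<^sub>R B (axis i 1) (axis j 1))"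
    by (rule sum.swap)
  also have "\<dots> = (\<Sum>i\<in>UNIV. \<Sum>j\<in>UNIV. \<Sum>k\<in>UNIV. (E k $ i * E k $ j) *\<^sub>R B (axis i 1) (axis j 1))"
    by (intro sum.cong refl sum.swap)
  also have "\<dots> = contract m B"
    by (simp add: contract_def inv scaleR_sum_left)
  finally show ?thesis by simp
qed

lemma christoffel_gip:
  assumes "invertible (G x)"
    and sym: "\<And>u v. gip (G x) u v = gip (G x) v u"
    and dG: "dG = frechet_derivative G (at x)" and lin: "linear dG"
  shows "gip (G x) (christoffel G x u v) w = (gip (dG u) v w + gip (dG v) u w - gip (dG w) u v) / 2"
proof -
  define a where "a = (\<chi> k. (gip (dG u) v (axis k 1) + gip (dG v) u (axis k 1) - gip (dG (axis k 1)) u v) / 2)"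
  have "G x ** matrix_inv (G x) = mat 1"
    using assms(1) by (simp add: matrix_inv_inverse(1))
  then have "G x *v christoffel G x u v = a"
    by (simp add: christoffel_def Let_def a_def dG[symmetric] matrix_vector_mul_assoc)
  then have 1: "gip (G x) (christoffel G x u v) w = w \<bullet> a"
    using sym by (metis gip_def)
  define f where "f = (\<lambda>w. (gip (dG u) v w + gip (dG v) u w - gip (dG w) u v) / 2)"
  have "linear (\<lambda>w. gip (dG w) u v)"
  proof -
    have "gip (p + q) u v = gip p u v + gip q u v" for p q
      by (simp add: gip_def matrix_vector_mult_add_rdistrib inner_add_right)
    moreover have "gip (r *\<^sub>R p) u v = r * gip p u v" for p r
      by (simp add: gip_def scaleR_matrix_vector_assoc[symmetric])
    ultimately show ?thesis
      using lin by (simp add: linear_iff)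
  qed
  then have lf: "linear f"
    unfolding f_def
    using gip_right_linear[of "dG u" v] gip_right_linear[of "dG v" u]
    by (simp add: linear_iff field_simps)
  have "w = (\<Sum>i\<in>UNIV. w $ i *\<^sub>R axis i 1)"
    by (simp add: vec_eq_iff axis_def if_distrib cong: if_cong)
  then have "f w = f (\<Sum>i\<in>UNIV. w $ i *\<^sub>R axis i 1)"
    by simp
  also have "\<dots> = (\<Sum>i\<in>UNIV. w $ i * f (axis i 1))"
    by (simp add: linear_sum[OF lf] linear_scale[OF lf])
  also have "\<dots> = w \<bullet> a"
    by (simp add: inner_vec_def a_def f_def)
  finally show ?thesis
    using 1 by (simp add: f_def)
qed

lemma christoffel_iff:
  assumes inv: "invertible (G x)"
    and sym: "\<And>u v. gip (G x) u v = gip (G x) v u"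
    and dG: "dG = frechet_derivative G (at x)" and lin: "linear dG"
    and dsym: "\<And>w u v. gip (dG w) u v = gip (dG w) v u"
  shows "\<Gamma> = christoffel G x \<longleftrightarrow>
    (\<forall>u v. \<Gamma> u v = \<Gamma> v u) \<and>
    (\<forall>w u v. gip (dG w) u v = gip (G x) (\<Gamma> w u) v + gip (G x) u (\<Gamma> w v))" (is "?L \<longleftrightarrow> ?R")
proof -
  have eqI: "p = q" if "\<And>w. gip (G x) p w = gip (G x) q w" for p q
  proof -
    have "gip (G x) w p = gip (G x) w q" for w
      using that sym by metis
    then have "G x *v p = G x *v q"
      by (metis gip_def vector_eq_ldot)
    then show ?thesis
      using inv by (metis inj_matrix_vector_mult injD)
  qed
  note c = christoffel_gip[where G = G, OF inv sym dG lin]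
  show ?thesis
  proof
    assume L: ?L
    have "christoffel G x u v = christoffel G x v u" for u v
      by (rule eqI) (simp add: c dsym[of _ u v])
    moreover have "gip (dG w) u v = gip (G x) (christoffel G x w u) v + gip (G x) u (christoffel G x w v)" for w u v
      by (simp add: c sym[of u "christoffel G x w v"] dsym[of w v u] dsym[of u w v] dsym[of v w u] field_simps)
    ultimately show ?R
      using L by blast
  next
    assume R: ?R
    then have s: "\<Gamma> u v = \<Gamma> v u"
      and d: "gip (dG w) u v = gip (G x) (\<Gamma> w u) v + gip (G x) u (\<Gamma> w v)" for u v w
      by blast+
    show ?L
    proof (intro ext eqI)
      fix u v w
      show "gip (G x) (\<Gamma> u v) w = gip (G x) (christoffel G x u v) w"
        using d[of u v w] d[of v u w] d[of w u v] s[of u v] s[of w u] s[of w v]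
          sym[of u "\<Gamma> v w"] sym[of v "\<Gamma> u w"]
        by (simp add: c)
    qed
  qed
qed

lemma trace_on_eq:
  assumes C: "independent C" "span C = V" and F: "linear F" "F ` V \<subseteq> V"
  shows "trace_on V F = (\<Sum>c\<in>C. representation C (F c) c)"
proof -
  have tr: "(\<Sum>b\<in>B. representation B (F b) b) = (\<Sum>c\<in>C. representation C (F c) c)"
    if B: "independent B" "span B = V" for B
  proof -
    have fin: "finite B" "finite C"
      using B C by (auto intro: independent_imp_finite)
    have V: "F b \<in> span B" "F b \<in> span C" if "b \<in> V" for b
      using F(2) B C that by auto
    have BV: "b \<in> V" if "b \<in> B" for b using B span_base that by blast
    have CV: "b \<in> V" if "b \<in> C" for b using C span_base that by blast
    have exC: "(\<Sum>c\<in>C. representation C v c *\<^sub>R c) = v" if "v \<in> V" for v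
      using real_vector.sum_representation_eq[OF C(1) _ fin(2), of v] C that by auto
    have exB: "(\<Sum>b\<in>B. representation B v b *\<^sub>R b) = v" if "v \<in> V" for v
      using real_vector.sum_representation_eq[OF B(1) _ fin(1), of v] B that by auto
    have linB: "representation B (\<Sum>c\<in>C. r c *\<^sub>R w c) b = (\<Sum>c\<in>C. r c * representation B (w c) b)"
      if "\<And>c. c \<in> C \<Longrightarrow> w c \<in> V" for r :: "'a \<Rightarrow> real" and w :: "'a \<Rightarrow> 'a" and b
    proof -
      have "representation B (\<Sum>c\<in>C. r c *\<^sub>R w c) b = (\<Sum>c\<in>C. representation B (r c *\<^sub>R w c) b)"
        using real_vector.representation_sum[OF B(1), of C "\<lambda>c. r c *\<^sub>R w c"] that B
        by (auto simp: span_scale)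
      also have "\<dots> = (\<Sum>c\<in>C. r c * representation B (w c) b)"
        using that B by (intro sum.cong refl) (simp add: real_vector.representation_scale)
      finally show ?thesis .
    qed
    have linC: "representation C (\<Sum>b\<in>B. r b *\<^sub>R b) c = (\<Sum>b\<in>B. r b * representation C b c)"
      for r :: "'a \<Rightarrow> real" and c
    proof -
      have "representation C (\<Sum>b\<in>B. r b *\<^sub>R b) c = (\<Sum>b\<in>B. representation C (r b *\<^sub>R b) c)"
        using real_vector.representation_sum[OF C(1), of B "\<lambda>b. r b *\<^sub>R b"] BV C
        by (auto simp: span_scale)
      also have "\<dots> = (\<Sum>b\<in>B. r b * representation C b c)"
        using BV C by (intro sum.cong refl) (simp add: real_vector.representation_scale)
      finally show ?thesis .
    qed
    have "representation B (F b) b = (\<Sum>c\<in>C. representation C b c * representation B (F c) b)" if "b \<in> B" for b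
    proof -
      have "F b = F (\<Sum>c\<in>C. representation C b c *\<^sub>R c)"
        using exC BV that by simp
      also have "\<dots> = (\<Sum>c\<in>C. representation C b c *\<^sub>R F c)"
        by (simp add: linear_sum[OF F(1)] linear_scale[OF F(1)])
      finally have "representation B (F b) b = representation B (\<Sum>c\<in>C. representation C b c *\<^sub>R F c) b"
        by simp
      also have "\<dots> = (\<Sum>c\<in>C. representation C b c * representation B (F c) b)"
        using F(2) CV by (intro linB) auto
      finally show ?thesis .
    qed
    then have "(\<Sum>b\<in>B. representation B (F b) b) =
        (\<Sum>b\<in>B. \<Sum>c\<in>C. representation C b c * representation B (F c) b)"
      by simp
    also have "\<dots> = (\<Sum>c\<in>C. \<Sum>b\<in>B. representation B (F c) b * representation C b c)"
      by (subst sum.swap) (simp add: mult.commute)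
    also have "\<dots> = (\<Sum>c\<in>C. representation C (\<Sum>b\<in>B. representation B (F c) b *\<^sub>R b) c)"
      by (simp add: linC)
    also have "\<dots> = (\<Sum>c\<in>C. representation C (F c) c)"
      using exB F(2) CV by (intro sum.cong refl) (metis image_subset_iff)
    finally show ?thesis .
  qed
  define B where "B = (SOME B. independent B \<and> span B = V)"
  have "independent B \<and> span B = V"
    unfolding B_def by (rule someI[of _ C]) (use C in simp)
  then show ?thesis
    using tr by (simp add: trace_on_def Let_def B_def)
qed

lemma contract_add: "contract m (\<lambda>u v. B u v + C u v) = contract m B + contract m C"
  by (simp add: contract_def sum.distrib scaleR_add_right)

lemma contract_diff: "contract m (\<lambda>u v. B u v - C u v) = contract m B - contract m C"
  by (simp add: contract_def sum_subtractf scaleR_diff_right)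

lemma contract_scaleR_left: "contract m (\<lambda>u v. f u v *\<^sub>R w) = contract m f *\<^sub>R w"
  by (simp add: contract_def scaleR_sum_left)

lemma gip_sym_entry:
  assumes "\<And>u v. gip m u v = gip m v u"
  shows "m $ i $ j = m $ j $ i"
  using assms[of "axis i 1" "axis j 1"] by (simp add: gip_axis)

lemma contract_gip:
  assumes "invertible m" and sym: "\<And>u v. gip m u v = gip m v u"
  shows "contract m (\<lambda>u v. gip m (L u) v) = trace (matrix L)"
proof -
  have "matrix_inv m ** m = mat 1"
    using assms(1) by (simp add: matrix_inv_inverse(2))
  then have *: "(\<Sum>j\<in>UNIV. matrix_inv m $ i $ j * m $ j $ k) = (if i = k then 1 else 0)" for i k
    by (simp add: matrix_matrix_mult_def vec_eq_iff mat_def)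
  have "contract m (\<lambda>u v. gip m (L u) v) =
      (\<Sum>i\<in>UNIV. \<Sum>j\<in>UNIV. \<Sum>k\<in>UNIV. L (axis i 1) $ k * (matrix_inv m $ i $ j * m $ j $ k))"
    by (simp add: contract_def gip_def inner_vec_def matrix_vector_mult_basis column_def
        sum_distrib_left algebra_simps)
       (intro sum.cong refl, use gip_sym_entry[OF sym] in metis)
  also have "\<dots> = (\<Sum>i\<in>UNIV. \<Sum>k\<in>UNIV. L (axis i 1) $ k * (\<Sum>j\<in>UNIV. matrix_inv m $ i $ j * m $ j $ k))"
    unfolding sum_distrib_left by (intro sum.cong[OF refl] sum.swap)
  also have "\<dots> = trace (matrix L)"
    by (simp add: * trace_def matrix_def if_distrib cong: if_cong)
  finally show ?thesis .
qed

lemma contract_sharp: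
  assumes "invertible m" and sym: "\<And>u v. gip m u v = gip m v u" and lin: "linear L"
  shows "contract m (\<lambda>u v. gip m a v *\<^sub>R L u) = L a"
proof -
  have "matrix_inv m ** m = mat 1"
    using assms(1) by (simp add: matrix_inv_inverse(2))
  then have *: "(\<Sum>j\<in>UNIV. matrix_inv m $ i $ j * m $ j $ k) = (if i = k then 1 else 0)" for i k
    by (simp add: matrix_matrix_mult_def vec_eq_iff mat_def)
  have g: "gip m a (axis j 1) = (\<Sum>k\<in>UNIV. a $ k * m $ j $ k)" for j
    by (simp add: gip_def inner_vec_def matrix_vector_mult_basis column_def)
       (intro sum.cong refl, simp add: gip_sym_entry[OF sym])
  have "(\<Sum>j\<in>UNIV. matrix_inv m $ i $ j * gip m a (axis j 1)) = a $ i" for i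
  proof -
    have "(\<Sum>j\<in>UNIV. matrix_inv m $ i $ j * gip m a (axis j 1)) =
        (\<Sum>k\<in>UNIV. a $ k * (\<Sum>j\<in>UNIV. matrix_inv m $ i $ j * m $ j $ k))"
      by (simp add: g sum_distrib_left, subst sum.swap) (simp add: algebra_simps)
    then show ?thesis
      by (simp add: * if_distrib cong: if_cong)
  qed
  then have "contract m (\<lambda>u v. gip m a v *\<^sub>R L u) = (\<Sum>i\<in>UNIV. a $ i *\<^sub>R L (axis i 1))"
    by (simp add: contract_def scaleR_sum_left[symmetric])
  also have "\<dots> = L (\<Sum>i\<in>UNIV. a $ i *\<^sub>R axis i 1)"
    by (simp add: linear_sum[OF lin] linear_scale[OF lin])
  also have "(\<Sum>i\<in>UNIV. a $ i *\<^sub>R axis i 1) = a"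
    by (simp add: vec_eq_iff axis_def if_distrib cong: if_cong)
  finally show ?thesis .
qed

lemma trace_matrix_schouten: "trace (matrix (schouten G x)) = scal G x / 6"
  by (simp add: schouten_def scal_def trace_def matrix_def sum_subtractf sum_divide_distrib[symmetric]
      axis_def)

lemma weyl_trace_free:
  assumes inv: "invertible (G x)" and sym: "\<And>u v. gip (G x) u v = gip (G x) v u"
    and lin: "linear (Ric G x)"
  shows "contract (G x) (\<lambda>v w. weyl G x u v w) = 0"
proof -
  have linP: "linear (schouten G x)"
    using lin unfolding schouten_def linear_iff by (simp add: algebra_simps)
  have "contract (G x) (\<lambda>v w. weyl G x u v w) = Ric G x u -
      ((scal G x / 6) *\<^sub>R u - schouten G x u + 4 *\<^sub>R schouten G x u - schouten G x u)"
    using contract_gip[OF inv sym, of "\<lambda>v. v"]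
    by (simp add: weyl_def contract_diff contract_add contract_scaleR_left contract_gip[OF inv sym]
        contract_sharp[OF inv sym linear_id[unfolded id_def]] contract_sharp[OF inv sym linP]
        trace_matrix_schouten Ric_def[symmetric])
       (simp add: trace_def matrix_def axis_def)
  also have "\<dots> = 0"
    by (simp add: schouten_def vec_eq_iff field_simps)
  finally show ?thesis .
qed

end

theory Submission
  imports Defs
begin

text \<open>
  At every point the self-dual endomorphisms form a copy of the imaginary quaternions with \<open>J\<close> as one of the
  units, and \<open>W\<^sub>+\<close> is a symmetric trace-free operator on this 3-dimensional space. Its entry at \<open>(J, J)\<close> is
  \<open>a = (S\<^sub>\<star> - S/3)/2\<close>. A symmetric trace-free \<open>3 \<times> 3\<close> matrix with first entry \<open>a\<close> has squared norm at least
  \<open>(3/2) a\<^sup>2\<close>, with equality only for the diagonal matrix \<open>(a, -a/2, -a/2)\<close>. So the first equation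
  means that \<open>W\<^sub>+ = (3a/2) (J \<otimes> J - id/3)\<close> (\<open>weyl_op_quaternionic\<close>, \<open>weyl_norm_iff\<close>).

  If this holds near a point, then, self-duality being parallel,
  \<open>\<nabla>W\<^sub>+ = (3/2) da (J \<otimes> J - id/3) + (3a/2) (\<nabla>J \<otimes> J + J \<otimes> \<nabla>J)\<close>. As \<open>\<nabla>J\<close> is orthogonal to \<open>J\<close>, the two summands
  are orthogonal, and \<open>|\<nabla>W\<^sub>+|\<^sup>2\<close> is the sum of \<open>(3/2) |da|\<^sup>2\<close> and a positive multiple of \<open>a\<^sup>2 |\<nabla>J|\<^sup>2\<close>
  (\<open>nabla_weyl_basis\<close>, \<open>nabla_weyl_norm\<close>). On the other hand \<open>|W\<^sub>+|\<close> is \<open>|a|\<close> times the square root of \<open>3/2\<close>, so its gradient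
  has squared norm \<open>(3/2) |da|\<^sup>2\<close> where \<open>a\<close> is not zero. Therefore the second equation holds at a point of \<open>M\<^sub>+\<close>
  if and only if \<open>\<nabla>J = 0\<close> there (\<open>nabla_weyl_norm_iff\<close>), and as \<open>M\<^sub>+\<close> is dense and \<open>\<nabla>J\<close> is continuous, \<open>\<nabla>J\<close> vanishes
  everywhere.

  Conversely, if \<open>\<nabla>J = 0\<close>, the curvature endomorphisms commute with \<open>J\<close> by the Ricci identity. Such endomorphisms
  have no component along the two units orthogonal to \<open>J\<close>, which forces \<open>W\<^sub>+\<close> into the above form
  (\<open>kaehler_curvature\<close>, \<open>weyl_norm_kaehler\<close>), and the second equation follows from the same comparison.

  All computations take place in a single chart. Only the set \<open>M\<^sub>+\<close> relates different charts, because the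
  charts in which \<open>W\<^sub>+\<close> is considered and in which it is known not to vanish may differ. This is settled
  by the naturality of the Levi-Civita connection and its curvature under coordinate changes
  (\<open>conn_change\<close>, \<open>curv_mat_change\<close>).
\<close>

section \<open>Calculus of smooth maps\<close>

lemma Ck_on_cong:
  assumes "open S" "\<And>x. x \<in> S \<Longrightarrow> f x = g x" "Ck_on n f S"
  shows "Ck_on n g S"
  using assms(2,3)
proof (induction n arbitrary: f g)
  case 0
  then show ?case by (simp cong: continuous_on_cong)
next
  case (Suc n)
  have d: "(g has_derivative frechet_derivative f (at x)) (at x)" if "x \<in> S" for x
  proof -
    have "(f has_derivative frechet_derivative f (at x)) (at x)"
      using Suc.prems(2) that frechet_derivative_works by auto
    from has_derivative_transform_within_open[OF this assms(1) that] show ?thesis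
      using Suc.prems(1) by blast
  qed
  then have "frechet_derivative f (at x) = frechet_derivative g (at x)" if "x \<in> S" for x
    using that frechet_derivative_at by blast
  moreover have "Ck_on n (\<lambda>x. frechet_derivative f (at x) v) S" for v
    using Suc.prems(2) by simp
  ultimately have "Ck_on n (\<lambda>x. frechet_derivative g (at x) v) S" for v
    using Suc.IH[of "\<lambda>x. frechet_derivative f (at x) v"] by simp
  moreover have "g differentiable (at x)" if "x \<in> S" for x
    using d[OF that] unfolding differentiable_def by blast
  ultimately show ?case
    by simp
qed

lemma Ck_on_SucD: "Ck_on (Suc n) f S \<Longrightarrow> Ck_on n f S"
proof (induction n arbitrary: f)
  case 0
  then show ?case
    by (auto intro!: differentiable_imp_continuous_on
        simp: differentiable_on_def differentiable_at_withinI)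
next
  case (Suc n)
  then show ?case by auto
qed

text \<open>The derivative in the definition of \<^const>\<open>Ck_on\<close> is a choice operator; this introduction rule
  accepts any derivative, which is what the closure properties below produce.\<close>

lemma Ck_on_SucI:
  assumes "open S" "\<And>x. x \<in> S \<Longrightarrow> (f has_derivative f' x) (at x)"
    and "\<And>v. Ck_on n (\<lambda>x. f' x v) S"
  shows "Ck_on (Suc n) f S"
proof -
  have "f' x = frechet_derivative f (at x)" if "x \<in> S" for x
    using assms(2)[OF that] frechet_derivative_at by blast
  then have "Ck_on n (\<lambda>x. frechet_derivative f (at x) v) S" for v
    using Ck_on_cong[of S "\<lambda>x. f' x v" _ n] assms(1,3) by simp
  moreover have "f differentiable (at x)" if "x \<in> S" for x
    using assms(2)[OF that] unfolding differentiable_def by blast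
  ultimately show ?thesis
    by simp
qed

lemma Ck_on_const: "open S \<Longrightarrow> Ck_on n (\<lambda>_. c) S"
  by (induction n arbitrary: c) (simp_all add: continuous_on_const)

lemma Ck_on_linear:
  assumes "bounded_linear L" "open S" "Ck_on n f S"
  shows "Ck_on n (\<lambda>x. L (f x)) S"
  using assms(3)
proof (induction n arbitrary: f)
  case 0
  then show ?case by (simp add: assms(1) bounded_linear.continuous_on)
next
  case (Suc n)
  have "((\<lambda>x. L (f x)) has_derivative (\<lambda>v. L (frechet_derivative f (at x) v))) (at x)" if "x \<in> S" for x
    using Suc.prems that
    by (intro bounded_linear.has_derivative[OF assms(1)] frechet_derivative_works[THEN iffD1]) auto
  moreover have "Ck_on n (\<lambda>x. L (frechet_derivative f (at x) v)) S" for v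
    using Suc by simp
  ultimately show ?case
    by (rule Ck_on_SucI[OF assms(2)])
qed

lemma Ck_on_add:
  assumes "open S" "Ck_on n f S" "Ck_on n g S"
  shows "Ck_on n (\<lambda>x. f x + g x) S"
  using assms(2,3)
proof (induction n arbitrary: f g)
  case 0
  then show ?case by (simp add: continuous_on_add)
next
  case (Suc n)
  have "((\<lambda>x. f x + g x) has_derivative
      (\<lambda>v. frechet_derivative f (at x) v + frechet_derivative g (at x) v)) (at x)" if "x \<in> S" for x
    using Suc.prems that
    by (intro has_derivative_add frechet_derivative_works[THEN iffD1]) auto
  moreover have "Ck_on n (\<lambda>x. frechet_derivative f (at x) v + frechet_derivative g (at x) v) S" for v
    using Suc by simp
  ultimately show ?case
    by (rule Ck_on_SucI[OF assms(1)])
qed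

lemma Ck_on_bilinear:
  assumes "bounded_bilinear P" "open S" "Ck_on n f S" "Ck_on n g S"
  shows "Ck_on n (\<lambda>x. P (f x) (g x)) S"
  using assms(3,4)
proof (induction n arbitrary: f g)
  case 0
  then show ?case by (simp add: assms(1) bounded_bilinear.continuous_on)
next
  case (Suc n)
  note low = Suc.prems[THEN Ck_on_SucD]
  have "((\<lambda>x. P (f x) (g x)) has_derivative
      (\<lambda>v. P (f x) (frechet_derivative g (at x) v) + P (frechet_derivative f (at x) v) (g x))) (at x)"
    if "x \<in> S" for x
    using Suc.prems that
    by (intro bounded_bilinear.FDERIV[OF assms(1)] frechet_derivative_works[THEN iffD1]) auto
  moreover have "Ck_on n (\<lambda>x. P (f x) (frechet_derivative g (at x) v) + P (frechet_derivative f (at x) v) (g x)) S" for v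
    using Suc.prems low by (intro Ck_on_add assms(2) Suc.IH) auto
  ultimately show ?case
    by (rule Ck_on_SucI[OF assms(2)])
qed

lemma smooth_onD:
  assumes "smooth_on S f"
  shows "x \<in> S \<Longrightarrow> f differentiable (at x)"
    and "x \<in> S \<Longrightarrow> (f has_derivative frechet_derivative f (at x)) (at x)"
    and "smooth_on S (\<lambda>x. frechet_derivative f (at x) v)"
    and "continuous_on S f"
proof -
  have *: "Ck_on (Suc n) f S" for n using assms unfolding smooth_on_def by blast
  show d: "x \<in> S \<Longrightarrow> f differentiable (at x)" using *[of 0] by simp
  show "x \<in> S \<Longrightarrow> (f has_derivative frechet_derivative f (at x)) (at x)"
    using d frechet_derivative_works[THEN iffD1] by blast
  show "smooth_on S (\<lambda>x. frechet_derivative f (at x) v)"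
    using * by (simp add: smooth_on_def)
  show "continuous_on S f" using assms Ck_on.simps(1) smooth_on_def by blast
qed

lemma smooth_on_cong:
  "open S \<Longrightarrow> smooth_on S f \<Longrightarrow> (\<And>x. x \<in> S \<Longrightarrow> f x = g x) \<Longrightarrow> smooth_on S g"
  unfolding smooth_on_def using Ck_on_cong by blast

lemma smooth_on_const: "open S \<Longrightarrow> smooth_on S (\<lambda>_. c)"
  by (simp add: smooth_on_def Ck_on_const)

lemma smooth_on_linear:
  "bounded_linear L \<Longrightarrow> open S \<Longrightarrow> smooth_on S f \<Longrightarrow> smooth_on S (\<lambda>x. L (f x))"
  by (simp add: smooth_on_def Ck_on_linear)

lemma smooth_on_bilinear:
  "bounded_bilinear P \<Longrightarrow> open S \<Longrightarrow> smooth_on S f \<Longrightarrow> smooth_on S g \<Longrightarrow> smooth_on S (\<lambda>x. P (f x) (g x))"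
  by (simp add: smooth_on_def Ck_on_bilinear)

lemma smooth_on_add:
  "open S \<Longrightarrow> smooth_on S f \<Longrightarrow> smooth_on S g \<Longrightarrow> smooth_on S (\<lambda>x. f x + g x)"
  by (simp add: smooth_on_def Ck_on_add)

lemma smooth_on_diff:
  assumes "open S" "smooth_on S f" "smooth_on S g"
  shows "smooth_on S (\<lambda>x. f x - g x)"
  using smooth_on_add[OF assms(1,2) smooth_on_linear[OF bounded_linear_minus[OF bounded_linear_ident] assms(1,3)]]
  by simp

lemma smooth_on_sum:
  assumes "open S" "finite I" "\<And>i. i \<in> I \<Longrightarrow> smooth_on S (f i)"
  shows "smooth_on S (\<lambda>x. \<Sum>i\<in>I. f i x)"
  using assms(2,3)
  by (induction I rule: finite_induct) (auto intro: smooth_on_const smooth_on_add assms(1))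

lemma smooth_on_vec_lambda:
  fixes f :: "'n::finite \<Rightarrow> 'a::real_normed_vector \<Rightarrow> 'b::euclidean_space"
  assumes "open S" "\<And>i. smooth_on S (f i)"
  shows "smooth_on S (\<lambda>x. \<chi> i. f i x)"
proof -
  have bl: "bounded_linear (axis i :: 'b \<Rightarrow> 'b^'n)" for i
    by (rule linear_conv_bounded_linear[THEN iffD1])
       (simp add: linear_iff vec_eq_iff axis_def)
  have "smooth_on S (\<lambda>x. \<Sum>i\<in>UNIV. axis i (f i x))"
    by (intro smooth_on_sum assms smooth_on_linear[OF bl]) auto
  moreover have "(\<chi> i. f i x) = (\<Sum>i\<in>UNIV. axis i (f i x))" for x
    by (simp add: vec_eq_iff axis_def)
  ultimately show ?thesis by simp
qed

text \<open>Two applications of the mean value theorem express the second difference of \<open>f\<close> over the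
  parallelogram spanned by \<open>s u\<close> and \<open>s v\<close> as \<open>s\<^sup>2\<close> times a mixed derivative at a point of it. The left side
  is symmetric in \<open>u\<close> and \<open>v\<close>, so the symmetry of the second derivative follows for \<open>s\<close> tending to
  zero, by continuity of the mixed derivatives.\<close>

lemma second_difference:
  fixes f :: "'a::real_normed_vector \<Rightarrow> real"
  assumes f: "\<And>y. y \<in> S \<Longrightarrow> (f has_derivative f' y) (at y)"
    and f': "\<And>y. y \<in> S \<Longrightarrow> ((\<lambda>y. f' y u) has_derivative f'' y) (at y)"
    and S: "\<And>a b. 0 \<le> a \<Longrightarrow> a \<le> s \<Longrightarrow> 0 \<le> b \<Longrightarrow> b \<le> s \<Longrightarrow> x + a *\<^sub>R u + b *\<^sub>R v \<in> S"
    and "0 < s"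
  obtains a b where "0 \<le> a" "a \<le> s" "0 \<le> b" "b \<le> s"
    "f (x + s *\<^sub>R u + s *\<^sub>R v) - f (x + s *\<^sub>R u) - f (x + s *\<^sub>R v) + f x = s * (s * f'' (x + a *\<^sub>R u + b *\<^sub>R v) v)"
proof -
  have lin: "linear (f' y)" if "y \<in> S" for y using f[OF that] has_derivative_linear by blast
  have lin2: "linear (f'' y)" if "y \<in> S" for y using f'[OF that] has_derivative_linear by blast
  define p where "p r = f (x + r *\<^sub>R u + s *\<^sub>R v) - f (x + r *\<^sub>R u + 0 *\<^sub>R v)" for r
  have dp: "(p has_real_derivative (f' (x + r *\<^sub>R u + s *\<^sub>R v) u - f' (x + r *\<^sub>R u + 0 *\<^sub>R v) u)) (at r)"
    if r: "0 \<le> r" "r \<le> s" for r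
  proof -
    have in_S: "x + r *\<^sub>R u + s *\<^sub>R v \<in> S" "x + r *\<^sub>R u + 0 *\<^sub>R v \<in> S"
      using r \<open>0 < s\<close> by (auto intro!: S simp del: scaleR_zero_left)
    have "((\<lambda>r. f (x + r *\<^sub>R u + b *\<^sub>R v)) has_derivative (\<lambda>h. f' (x + r *\<^sub>R u + b *\<^sub>R v) (h *\<^sub>R u))) (at r)"
      if "x + r *\<^sub>R u + b *\<^sub>R v \<in> S" for b
      by (rule has_derivative_compose[where f = "\<lambda>r. x + r *\<^sub>R u + b *\<^sub>R v" and g = f])
         (auto intro!: derivative_eq_intros f[OF that])
    from has_derivative_diff[OF this[OF in_S(1)] this[OF in_S(2)]] show ?thesis
      unfolding p_def has_field_derivative_def
      by (rule has_derivative_eq_rhs)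
         (simp add: fun_eq_iff linear_scale[OF lin[OF in_S(1)]] linear_scale[OF lin[OF in_S(2)], simplified] right_diff_distrib mult.commute)
  qed
  obtain a where a: "0 < a" "a < s" and pa: "p s - p 0 = (s - 0) * (f' (x + a *\<^sub>R u + s *\<^sub>R v) u - f' (x + a *\<^sub>R u + 0 *\<^sub>R v) u)"
    using MVT2[OF \<open>0 < s\<close> dp] by blast
  define q where "q r = f' (x + a *\<^sub>R u + r *\<^sub>R v) u" for r
  have dq: "(q has_real_derivative f'' (x + a *\<^sub>R u + r *\<^sub>R v) v) (at r)" if r: "0 \<le> r" "r \<le> s" for r
  proof -
    have in_S: "x + a *\<^sub>R u + r *\<^sub>R v \<in> S" using r a by (auto intro!: S)
    have "((\<lambda>r. f' (x + a *\<^sub>R u + r *\<^sub>R v) u) has_derivative (\<lambda>h. f'' (x + a *\<^sub>R u + r *\<^sub>R v) (h *\<^sub>R v))) (at r)"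
      by (rule has_derivative_compose[where f = "\<lambda>r. x + a *\<^sub>R u + r *\<^sub>R v" and g = "\<lambda>y. f' y u"])
         (auto intro!: derivative_eq_intros f'[OF in_S])
    then show ?thesis
      unfolding q_def has_field_derivative_def
      by (rule has_derivative_eq_rhs) (simp add: fun_eq_iff linear_scale[OF lin2[OF in_S]] mult.commute)
  qed
  obtain b where b: "0 < b" "b < s" and qb: "q s - q 0 = (s - 0) * f'' (x + a *\<^sub>R u + b *\<^sub>R v) v"
    using MVT2[OF \<open>0 < s\<close> dq] by blast
  show ?thesis
    using that[of a b] a b pa qb by (simp add: p_def q_def)
qed

lemma mixed_derivatives_real:
  fixes f :: "'a::real_normed_vector \<Rightarrow> real"
  assumes "open S" "smooth_on S f" "x \<in> S"
  shows "frechet_derivative (\<lambda>y. frechet_derivative f (at y) u) (at x) v =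
    frechet_derivative (\<lambda>y. frechet_derivative f (at y) v) (at x) u"
proof (rule ccontr)
  let ?D = "\<lambda>u v y. frechet_derivative (\<lambda>y. frechet_derivative f (at y) u) (at y) v"
  assume ne: "?D u v x \<noteq> ?D v u x"
  define e where "e = \<bar>?D u v x - ?D v u x\<bar> / 2"
  have "0 < e" using ne by (simp add: e_def)
  have "continuous_on S (?D a b)" for a b
    using assms(2) by (intro smooth_onD(4) smooth_onD(3))
  then have "isCont (?D a b) x" for a b
    using assms(1,3) by (simp add: continuous_on_eq_continuous_at)
  then have "\<exists>d>0. \<forall>y. dist y x < d \<longrightarrow> dist (?D a b y) (?D a b x) < e" for a b
    using \<open>0 < e\<close> unfolding continuous_at_eps_delta by blast
  then obtain d1 d2 where d1: "0 < d1" "\<And>y. dist y x < d1 \<Longrightarrow> dist (?D u v y) (?D u v x) < e"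
    and d2: "0 < d2" "\<And>y. dist y x < d2 \<Longrightarrow> dist (?D v u y) (?D v u x) < e"
    by meson
  obtain d3 where d3: "0 < d3" "ball x d3 \<subseteq> S"
    using assms(1,3) open_contains_ball by blast
  define d where "d = min d3 (min d1 d2)"
  \<comment> \<open>The summand 1 avoids division by zero; the parallelogram stays within distance \<open>d / 2\<close> of \<open>x\<close>.\<close>
  define s where "s = d / (2 * (norm u + norm v + 1))"
  have np: "0 < norm u + norm v + 1" by (smt (verit) norm_ge_zero)
  have "0 < d" using d1 d2 d3 by (simp add: d_def)
  then have "0 < s" using np by (simp add: s_def)
  have near: "dist (x + a *\<^sub>R p + b *\<^sub>R q) x < d"
    if "0 \<le> a" "a \<le> s" "0 \<le> b" "b \<le> s" "norm p + norm q = norm u + norm v" for a b p q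
  proof -
    have "norm (a *\<^sub>R p + b *\<^sub>R q) \<le> s * norm p + s * norm q"
      using that by (intro norm_triangle_le add_mono) (auto intro: mult_right_mono)
    also have "\<dots> < s * (norm u + norm v + 1)"
      using \<open>0 < s\<close> that(5) by (simp add: distrib_left[symmetric])
    also have "\<dots> = d / 2"
    proof -
      have "norm u + norm v + 1 \<noteq> 0" using np by simp
      then show ?thesis unfolding s_def by (metis nonzero_eq_divide_eq divide_divide_eq_left mult.commute)
    qed
    finally show ?thesis using \<open>0 < d\<close> by (simp add: dist_norm algebra_simps)
  qed
  have dd: "(f has_derivative frechet_derivative f (at y)) (at y)"
    "((\<lambda>y. frechet_derivative f (at y) w) has_derivative
      frechet_derivative (\<lambda>y. frechet_derivative f (at y) w) (at y)) (at y)" if "y \<in> S" for y w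
    using that assms(2) smooth_onD by blast+
  have inS: "y \<in> S" if "dist y x < d" for y
    using that d3 by (auto simp: d_def mem_ball dist_commute)
  obtain a b where ab: "0 \<le> a" "a \<le> s" "0 \<le> b" "b \<le> s"
    "f (x + s *\<^sub>R u + s *\<^sub>R v) - f (x + s *\<^sub>R u) - f (x + s *\<^sub>R v) + f x = s * (s * ?D u v (x + a *\<^sub>R u + b *\<^sub>R v))"
    by (rule second_difference[of S f "\<lambda>y. frechet_derivative f (at y)" u
        "\<lambda>y. frechet_derivative (\<lambda>y. frechet_derivative f (at y) u) (at y)" s x v])
      (use dd near inS \<open>0 < s\<close> in auto)
  obtain a' b' where ab': "0 \<le> a'" "a' \<le> s" "0 \<le> b'" "b' \<le> s"
    "f (x + s *\<^sub>R v + s *\<^sub>R u) - f (x + s *\<^sub>R v) - f (x + s *\<^sub>R u) + f x = s * (s * ?D v u (x + a' *\<^sub>R v + b' *\<^sub>R u))"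
    by (rule second_difference[of S f "\<lambda>y. frechet_derivative f (at y)" v
        "\<lambda>y. frechet_derivative (\<lambda>y. frechet_derivative f (at y) v) (at y)" s x u])
      (use dd near inS \<open>0 < s\<close> in auto)
  have "?D u v (x + a *\<^sub>R u + b *\<^sub>R v) = ?D v u (x + a' *\<^sub>R v + b' *\<^sub>R u)"
    using ab(5) ab'(5) \<open>0 < s\<close> by (simp add: algebra_simps)
  moreover have "dist (?D u v (x + a *\<^sub>R u + b *\<^sub>R v)) (?D u v x) < e"
    using near[OF ab(1-4)] d1(2) by (simp add: d_def)
  moreover have "dist (?D v u (x + a' *\<^sub>R v + b' *\<^sub>R u)) (?D v u x) < e"
    using near[OF ab'(1-4)] d2(2) by (simp add: d_def)
  ultimately have "\<bar>?D u v x - ?D v u x\<bar> < 2 * e"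
    by (simp add: dist_real_def)
  then show False by (simp add: e_def)
qed

lemma mixed_derivatives:
  fixes f :: "'a::real_normed_vector \<Rightarrow> 'b::euclidean_space"
  assumes "open S" "smooth_on S f" "x \<in> S"
  shows "frechet_derivative (\<lambda>y. frechet_derivative f (at y) u) (at x) v =
    frechet_derivative (\<lambda>y. frechet_derivative f (at y) v) (at x) u"
proof (rule euclidean_eqI)
  fix b :: 'b assume "b \<in> Basis"
  define h where "h y = f y \<bullet> b" for y
  have sh: "smooth_on S h"
    unfolding h_def by (rule smooth_on_linear[OF bounded_linear_inner_left assms(1,2)])
  have 1: "frechet_derivative h (at y) w = frechet_derivative f (at y) w \<bullet> b" if "y \<in> S" for y w
    unfolding h_def
    using bounded_linear.has_derivative[OF bounded_linear_inner_left smooth_onD(2)[OF assms(2) that], of b]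
    by (metis frechet_derivative_at)
  have 2: "frechet_derivative (\<lambda>y. frechet_derivative h (at y) w) (at x) z
      = frechet_derivative (\<lambda>y. frechet_derivative f (at y) w) (at x) z \<bullet> b" for w z
  proof -
    have "((\<lambda>y. frechet_derivative f (at y) w \<bullet> b) has_derivative
        (\<lambda>z. frechet_derivative (\<lambda>y. frechet_derivative f (at y) w) (at x) z \<bullet> b)) (at x)"
      using assms(2,3) by (intro bounded_linear.has_derivative[OF bounded_linear_inner_left] smooth_onD(2,3))
    then have "((\<lambda>y. frechet_derivative h (at y) w) has_derivative
        (\<lambda>z. frechet_derivative (\<lambda>y. frechet_derivative f (at y) w) (at x) z \<bullet> b)) (at x)"
      by (rule has_derivative_transform_within_open[OF _ assms(1,3)]) (simp add: 1)
    then show ?thesis by (metis frechet_derivative_at)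
  qed
  show "frechet_derivative (\<lambda>y. frechet_derivative f (at y) u) (at x) v \<bullet> b =
    frechet_derivative (\<lambda>y. frechet_derivative f (at y) v) (at x) u \<bullet> b"
    using mixed_derivatives_real[OF assms(1) sh assms(3)] by (simp add: 2)
qed

section \<open>Matrix calculus\<close>

lemma bounded_bilinear_matrix_mult: "bounded_bilinear ((**) :: real^4^4 \<Rightarrow> real^4^4 \<Rightarrow> real^4^4)"
  by (rule bilinear_conv_bounded_bilinear[THEN iffD1])
     (simp add: bilinear_def linear_iff vec_eq_iff matrix_matrix_mult_def sum.distrib sum_distrib_left
       algebra_simps)

lemma bounded_bilinear_matrix_vector_mult: "bounded_bilinear ((*v) :: real^4^4 \<Rightarrow> real^4 \<Rightarrow> real^4)"
  by (rule bilinear_conv_bounded_bilinear[THEN iffD1])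
     (simp add: bilinear_def linear_iff vec_eq_iff matrix_vector_mult_def sum.distrib sum_distrib_left
       algebra_simps)

lemma bounded_linear_transpose: "bounded_linear (transpose :: real^4^4 \<Rightarrow> real^4^4)"
  by (rule linear_conv_bounded_linear[THEN iffD1]) (simp add: linear_iff vec_eq_iff transpose_def)

interpretation mm: bounded_bilinear "(**) :: real^4^4 \<Rightarrow> real^4^4 \<Rightarrow> real^4^4"
  by (rule bounded_bilinear_matrix_mult)
interpretation mv: bounded_bilinear "(*v) :: real^4^4 \<Rightarrow> real^4 \<Rightarrow> real^4"
  by (rule bounded_bilinear_matrix_vector_mult)
lemma transpose_linear:
  fixes A B :: "real^4^4"
  shows "transpose (A + B) = transpose A + transpose B" "transpose (A - B) = transpose A - transpose B"
    "transpose (- A) = - transpose A" "transpose (c *\<^sub>R A) = c *\<^sub>R transpose A"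
    "transpose (0 :: real^4^4) = 0"
  by (simp_all add: vec_eq_iff transpose_def)

lemmas mat_algebra = mm.add_left mm.add_right mm.diff_left mm.diff_right mm.minus_left mm.minus_right
  mm.scaleR_left mm.scaleR_right mm.zero_left mm.zero_right
  mv.add_left mv.add_right mv.diff_left mv.diff_right mv.minus_left mv.minus_right
  mv.scaleR_left mv.scaleR_right mv.zero_left mv.zero_right
  transpose_linear matrix_transpose_mul
  matrix_mul_assoc[symmetric] matrix_vector_mul_assoc[symmetric]
  scaleR_add_right scaleR_diff_right

lemma differentiable_vec_lambda:
  fixes f :: "'n::finite \<Rightarrow> 'a::real_normed_vector \<Rightarrow> 'b::euclidean_space"
  assumes "\<And>i. f i differentiable (at x)"
  shows "(\<lambda>x. \<chi> i. f i x) differentiable (at x)"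
proof -
  have bl: "bounded_linear (axis i :: 'b \<Rightarrow> 'b^'n)" for i
    by (rule linear_conv_bounded_linear[THEN iffD1]) (simp add: linear_iff vec_eq_iff axis_def)
  have "(\<lambda>x. axis i (f i x)) differentiable (at x)" for i
    using bounded_linear.has_derivative[OF bl frechet_derivative_works[THEN iffD1, OF assms]]
    by (rule differentiableI)
  then have "(\<lambda>x. \<Sum>i\<in>UNIV. axis i (f i x)) differentiable (at x)"
    by (intro differentiable_sum) auto
  moreover have "(\<chi> i. f i x) = (\<Sum>i\<in>UNIV. axis i (f i x))" for x
    by (simp add: vec_eq_iff axis_def)
  ultimately show ?thesis by simp
qed

lemma differentiable_det:
  fixes M :: "'a::real_normed_vector \<Rightarrow> real^'n^'n"
  assumes "\<And>i j. (\<lambda>y. M y $ i $ j) differentiable (at x)"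
  shows "(\<lambda>y. det (M y)) differentiable (at x)"
proof -
  have "(\<lambda>y. \<Prod>i\<in>UNIV. M y $ i $ q i) differentiable (at x)" for q
    unfolding differentiable_def
    by (rule exI, rule has_derivative_prod) (rule assms[THEN frechet_derivative_works[THEN iffD1]])
  then show ?thesis
    unfolding det_def by (intro differentiable_sum differentiable_mult) auto
qed

text \<open>Cramer's rule gives differentiability; then \<open>d(G\<^sup>-\<^sup>1) = - G\<^sup>-\<^sup>1 dG G\<^sup>-\<^sup>1\<close> gains one order of
  differentiability after the other.\<close>

lemma smooth_on_matrix_inv:
  fixes G :: "'a::real_normed_vector \<Rightarrow> real^4^4"
  assumes S: "open S" and inv: "\<And>x. x \<in> S \<Longrightarrow> invertible (G x)" and sm: "smooth_on S G"
  shows "smooth_on S (\<lambda>x. matrix_inv (G x))"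
proof -
  let ?H = "\<lambda>x. matrix_inv (G x)"
  note GH = matrix_inv_inverse[OF inv]
  have dif: "?H differentiable (at x)" if x: "x \<in> S" for x
  proof -
    \<comment> \<open>Cramer's rule: the entries of the inverse are rational in those of the matrix.\<close>
    let ?M = "\<lambda>i j y. (\<chi> k l. if l = i then axis j 1 $ k else G y $ k $ l) :: real^4^4"
    have cof: "?H y = (\<chi> i j. det (?M i j y) / det (G y))" if "y \<in> S" for y
    proof -
      have "det (G y) \<noteq> 0" using inv[OF that] invertible_det_nz by blast
      moreover have "G y *v column j (?H y) = axis j 1" for j
        by (metis GH(1) that matrix_vector_mul_assoc matrix_vector_mul_lid matrix_vector_mult_basis)
      ultimately have "column j (?H y) = (\<chi> i. det (?M i j y) / det (G y))" for j
        using cramer by blast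
      then show ?thesis
        by (simp add: vec_eq_iff column_def)
    qed
    have c: "(\<lambda>y. G y $ k $ l) differentiable (at x)" for k l
      using bounded_linear.has_derivative[OF bounded_linear_compose[OF bounded_linear_vec_nth bounded_linear_vec_nth]
          smooth_onD(2)[OF sm x]]
      by (auto simp: differentiable_def)
    have dz: "det (G x) \<noteq> 0" using inv[OF x] invertible_det_nz by blast
    have "(\<lambda>y. ?M i j y $ k $ l) differentiable (at x)" for i j k l
      by (cases "l = i") (simp_all add: c)
    then have "(\<lambda>y. \<chi> i j. det (?M i j y) / det (G y)) differentiable (at x)"
      by (intro differentiable_vec_lambda differentiable_divide differentiable_det dz c)
    then show ?thesis
      unfolding differentiable_def
      using has_derivative_transform_within_open[OF _ S x] cof by (metis (no_types, lifting))
  qed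
  have der: "(?H has_derivative (\<lambda>v. - (?H x ** frechet_derivative G (at x) v ** ?H x))) (at x)"
    if x: "x \<in> S" for x
  proof -
    obtain H' where H': "(?H has_derivative H') (at x)" using dif[OF x] by (auto simp: differentiable_def)
    have "((\<lambda>y. G y ** ?H y) has_derivative (\<lambda>v. G x ** H' v + frechet_derivative G (at x) v ** ?H x)) (at x)"
      by (rule mm.FDERIV[OF smooth_onD(2)[OF sm x] H'])
    moreover have "((\<lambda>y. G y ** ?H y) has_derivative (\<lambda>v. 0)) (at x)"
      by (rule has_derivative_transform_within_open[OF has_derivative_const[of "mat 1"] S x]) (simp add: GH)
    ultimately have "G x ** H' v + frechet_derivative G (at x) v ** ?H x = 0" for v
      by (blast dest: has_derivative_unique[THEN fun_cong])
    then have "?H x ** (G x ** H' v) = - (?H x ** (frechet_derivative G (at x) v ** ?H x))" for v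
      by (metis add_eq_0_iff mm.minus_right add.commute)
    then have "H' v = - (?H x ** frechet_derivative G (at x) v ** ?H x)" for v
      by (metis GH(2)[OF x] matrix_mul_assoc matrix_mul_lid)
    then show ?thesis using H' by presburger
  qed
  have "Ck_on n ?H S" for n
  proof (induction n)
    case 0
    then show ?case using dif by (auto intro!: differentiable_imp_continuous_on
        simp: differentiable_on_def differentiable_at_withinI)
  next
    case (Suc n)
    have "Ck_on n (\<lambda>x. frechet_derivative G (at x) v) S" for v
      using smooth_onD(3)[OF sm] unfolding smooth_on_def by blast
    then have "Ck_on n (\<lambda>x. - (?H x ** frechet_derivative G (at x) v ** ?H x)) S" for v
      by (intro Ck_on_linear[OF bounded_linear_minus[OF bounded_linear_ident]]
          Ck_on_bilinear[OF bounded_bilinear_matrix_mult] S Suc)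
    from der this show ?case
      by (rule Ck_on_SucI[OF S])
  qed
  then show ?thesis by (simp add: smooth_on_def)
qed


section \<open>The Levi-Civita connection and its curvature as matrices\<close>

abbreviation pd :: "('a::real_normed_vector \<Rightarrow> 'b::real_normed_vector) \<Rightarrow> 'a \<Rightarrow> 'a \<Rightarrow> 'b"
  where "pd f u x \<equiv> frechet_derivative f (at x) u"

lemma pd_eqI: "(f has_derivative f') (at x) \<Longrightarrow> pd f u x = f' u"
  by (metis frechet_derivative_at)

lemma pd_cong:
  assumes "open S" "x \<in> S" "\<And>y. y \<in> S \<Longrightarrow> f y = g y" "f differentiable (at x)"
  shows "pd f u x = pd g u x"
  using frechet_derivative_transform_within_open[OF assms(4,1,2,3)] by simp

lemma pd_matrix_mult:
  fixes A B :: "'a::real_normed_vector \<Rightarrow> real^4^4"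
  assumes "A differentiable (at x)" "B differentiable (at x)"
  shows "pd (\<lambda>y. A y ** B y) u x = A x ** pd B u x + pd A u x ** B x"
  by (rule pd_eqI[OF mm.FDERIV]) (use assms frechet_derivative_works in auto)

lemma pd_transpose:
  fixes A :: "'a::real_normed_vector \<Rightarrow> real^4^4"
  assumes "A differentiable (at x)"
  shows "pd (\<lambda>y. transpose (A y)) u x = transpose (pd A u x)"
  using bounded_linear.has_derivative[OF bounded_linear_transpose frechet_derivative_works[THEN iffD1, OF assms]]
  by (rule pd_eqI)

lemma pd_matrix_vector_mult:
  fixes A :: "'a::real_normed_vector \<Rightarrow> real^4^4"
  assumes "A differentiable (at x)"
  shows "pd (\<lambda>y. A y *v w) u x = pd A u x *v w"
  using bounded_linear.has_derivative[OF mv.bounded_linear_left frechet_derivative_works[THEN iffD1, OF assms]]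
  by (rule pd_eqI)

lemma pd_add:
  assumes "A differentiable (at x)" "B differentiable (at x)"
  shows "pd (\<lambda>y. A y + B y) u x = pd A u x + pd B u x"
  by (rule pd_eqI[OF has_derivative_add]) (use assms frechet_derivative_works in auto)

lemma pd_diff:
  assumes "A differentiable (at x)" "B differentiable (at x)"
  shows "pd (\<lambda>y. A y - B y) u x = pd A u x - pd B u x"
  by (rule pd_eqI[OF has_derivative_diff]) (use assms frechet_derivative_works in auto)

lemma gip_linear:
  "gip m (u + v) w = gip m u w + gip m v w" "gip m (u - v) w = gip m u w - gip m v w"
  "gip m (- u) w = - gip m u w" "gip m (c *\<^sub>R u) w = c * gip m u w" "gip m 0 w = 0"
  "gip m w (u + v) = gip m w u + gip m w v" "gip m w (u - v) = gip m w u - gip m w v"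
  "gip m w (- u) = - gip m w u" "gip m w (c *\<^sub>R u) = c * gip m w u" "gip m w 0 = 0"
  by (simp_all add: gip_def mat_algebra inner_add_left inner_add_right inner_diff_left inner_diff_right)

lemma gip_matrix_linear:
  "gip (m + n) u v = gip m u v + gip n u v" "gip (m - n) u v = gip m u v - gip n u v"
  "gip (c *\<^sub>R m) u v = c * gip m u v" "gip (- m) u v = - gip m u v" "gip 0 u v = 0"
  by (simp_all add: gip_def mat_algebra inner_add_right inner_diff_right)

lemma gip_mult: "gip m (A *v u) v = gip (transpose A ** m) u v" "gip m u (A *v v) = gip (m ** A) u v"
proof -
  have "(A *v u) \<bullet> y = u \<bullet> (transpose A *v y)" for y
    by (metis dot_lmul_matrix vector_transpose_matrix)
  then show "gip m (A *v u) v = gip (transpose A ** m) u v"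
    by (simp only: gip_def matrix_vector_mul_assoc)
qed (simp add: gip_def matrix_vector_mul_assoc)

lemma gip_eq_iff: "m = n \<longleftrightarrow> (\<forall>u v. gip m u v = gip n u v)"
  by (metis gip_axis vec_eq_iff)

lemma gip_sym_iff: "(\<forall>u v. gip m u v = gip m v u) \<longleftrightarrow> transpose m = m"
proof -
  have "gip m v u = gip (transpose m) u v" for u v
    by (metis dot_lmul_matrix gip_def inner_commute transpose_matrix_vector)
  then show ?thesis by (metis gip_eq_iff)
qed

lemma bounded_linear_gip: "bounded_linear (\<lambda>m. gip m u v)"
  by (rule linear_conv_bounded_linear[THEN iffD1]) (simp add: linear_iff gip_matrix_linear)

lemma matrix_mult_basis:
  fixes L :: "real^4 \<Rightarrow> real^4"
  shows "linear L \<Longrightarrow> matrix L *v u = L u"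
  using matrix_works[of L u] linear_matrix_vector_mul_eq by (simp add: linear_def)

lemma matrix_of_mult:
  fixes A :: "real^4^4"
  shows "matrix (\<lambda>u. A *v u) = A"
  by (simp add: matrix_def matrix_vector_mult_basis column_def vec_eq_iff)

text \<open>The Levi-Civita connection as a matrix-valued 1-form. In this form the covariant derivative of an
  endomorphism field is \<open>dA + [conn, A]\<close>, and the curvature is the matrix \<open>d conn + conn \<and> conn\<close>, so that the
  identities of Riemannian geometry become identities between products of matrices.\<close>

definition conn :: "(real^4 \<Rightarrow> real^4^4) \<Rightarrow> real^4 \<Rightarrow> real^4 \<Rightarrow> real^4^4" where
  "conn G u x = matrix (christoffel G x u)"

definition curv_mat :: "(real^4 \<Rightarrow> real^4^4) \<Rightarrow> real^4 \<Rightarrow> real^4 \<Rightarrow> real^4 \<Rightarrow> real^4^4" where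
  "curv_mat G u v x = pd (conn G v) u x - pd (conn G u) v x + conn G u x ** conn G v x - conn G v x ** conn G u x"

locale metric_patch =
  fixes S :: "(real^4) set" and G :: "real^4 \<Rightarrow> real^4^4"
  assumes open_S: "open S" and smooth_G: "smooth_on S G"
    and sym_G: "x \<in> S \<Longrightarrow> gip (G x) u v = gip (G x) v u"
    and pos_G: "x \<in> S \<Longrightarrow> u \<noteq> 0 \<Longrightarrow> gip (G x) u u > 0"
begin

lemma inv_G: "x \<in> S \<Longrightarrow> invertible (G x)"
  by (rule posdef_invertible) (rule pos_G)

lemma transpose_G: "x \<in> S \<Longrightarrow> transpose (G x) = G x"
  using sym_G gip_sym_iff by blast

lemma smooth_inv_G: "smooth_on S (\<lambda>x. matrix_inv (G x))"
  by (rule smooth_on_matrix_inv[OF open_S inv_G smooth_G])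

lemma linear_dG: "x \<in> S \<Longrightarrow> linear (frechet_derivative G (at x))"
  using smooth_onD(1)[OF smooth_G] linear_frechet_derivative by blast

lemma smooth_component: "smooth_on S f \<Longrightarrow> smooth_on S (\<lambda>x. f x $ i)"
  for f :: "_ \<Rightarrow> (_::real_normed_vector)^4"
  by (rule smooth_on_linear[OF bounded_linear_vec_nth open_S])

lemma smooth_gip: "smooth_on S M \<Longrightarrow> smooth_on S (\<lambda>x. gip (M x) u v)"
  by (rule smooth_on_linear[OF bounded_linear_gip open_S])

lemmas smooth_rules = smooth_on_const[OF open_S] smooth_on_add[OF open_S] smooth_on_diff[OF open_S]
  smooth_on_sum[OF open_S] smooth_on_vec_lambda[OF open_S] smooth_component
  smooth_on_bilinear[OF bounded_bilinear_matrix_mult open_S]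
  smooth_on_bilinear[OF bounded_bilinear_matrix_vector_mult open_S]
  smooth_on_bilinear[OF bounded_bilinear_scaleR open_S]
  smooth_on_bilinear[OF bounded_bilinear_mult open_S]
  smooth_on_linear[OF bounded_linear_transpose open_S]
  smooth_gip smooth_onD(3)

lemma smooth_divide_const: "smooth_on S f \<Longrightarrow> smooth_on S (\<lambda>x. f x / (c::real))"
  by (rule smooth_on_linear[OF bounded_linear_divide open_S])

lemma smooth_christoffel: "smooth_on S (\<lambda>x. christoffel G x u v)"
  unfolding christoffel_def Let_def
  by (intro smooth_rules smooth_divide_const smooth_inv_G smooth_G)

lemma smooth_matrix:
  fixes L :: "real^4 \<Rightarrow> real^4 \<Rightarrow> real^4"
  assumes "\<And>i. smooth_on S (\<lambda>x. L x (axis i 1))"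
  shows "smooth_on S (\<lambda>x. matrix (L x))"
  unfolding matrix_def by (intro smooth_rules assms)

lemma smooth_conn: "smooth_on S (conn G u)"
  unfolding conn_def by (intro smooth_matrix smooth_christoffel)

lemmas diff_conn = smooth_onD(1)[OF smooth_conn]

lemma
  assumes "x \<in> S"
  shows linear_christoffel: "linear (christoffel G x u)"
    and conn_add: "conn G (u + v) x = conn G u x + conn G v x"
    and conn_scale: "conn G (r *\<^sub>R u) x = r *\<^sub>R conn G u x"
proof -
  let ?a = "\<lambda>u v. \<chi> k. (gip (pd G u x) v (axis k 1) + gip (pd G v x) u (axis k 1) - gip (pd G (axis k 1) x) u v) / 2"
  note l = linear_add[OF linear_dG[OF assms]] linear_scale[OF linear_dG[OF assms]]
  have a: "?a u (v + w) = ?a u v + ?a u w" "?a u (r *\<^sub>R v) = r *\<^sub>R ?a u v"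
    "?a (u + v) w = ?a u w + ?a v w" "?a (r *\<^sub>R u) v = r *\<^sub>R ?a u v" for u v w r
    by (simp_all add: vec_eq_iff l gip_linear gip_matrix_linear field_simps)
  show "linear (christoffel G x u)" for u
    by (simp add: linear_iff christoffel_def Let_def a mat_algebra)
  show "conn G (u + v) x = conn G u x + conn G v x" "conn G (r *\<^sub>R u) x = r *\<^sub>R conn G u x"
    by (simp_all add: conn_def matrix_def vec_eq_iff christoffel_def Let_def a mat_algebra)
qed

lemma conn_christoffel: "x \<in> S \<Longrightarrow> conn G u x *v v = christoffel G x u v"
  by (simp add: conn_def matrix_mult_basis linear_christoffel)

text \<open>The two properties that characterize the Levi-Civita connection, read off from \<open>christoffel_iff\<close>; its
  hypothesis that \<open>dG\<close> is symmetric holds since \<open>G\<close> is symmetric in a neighbourhood.\<close>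

lemma
  assumes "x \<in> S"
  shows torsion_free: "conn G u x *v v = conn G v x *v u"
    and metric_connection: "pd G u x = transpose (conn G u x) ** G x + G x ** conn G u x"
proof -
  have dsym: "gip (pd G w x) u v = gip (pd G w x) v u" for u v w
  proof -
    have "pd G w x = pd (\<lambda>y. transpose (G y)) w x"
      using open_S assms transpose_G smooth_onD(1)[OF smooth_G] by (intro pd_cong) auto
    then have "transpose (pd G w x) = pd G w x"
      using pd_transpose[OF smooth_onD(1)[OF smooth_G assms]] by metis
    then show ?thesis using gip_sym_iff by blast
  qed
  have c: "\<forall>u v. christoffel G x u v = christoffel G x v u"
    "\<forall>w u v. gip (pd G w x) u v = gip (G x) (christoffel G x w u) v + gip (G x) u (christoffel G x w v)"
    using christoffel_iff[where \<Gamma> = "christoffel G x", OF inv_G[OF assms] sym_G[OF assms] refl linear_dG[OF assms] dsym]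
    by blast+
  show "conn G u x *v v = conn G v x *v u"
    using c(1) assms by (simp add: conn_christoffel)
  show "pd G u x = transpose (conn G u x) ** G x + G x ** conn G u x"
    using c(2) assms unfolding gip_eq_iff[of "pd G u x"]
    by (simp add: gip_matrix_linear gip_mult conn_christoffel[symmetric])
qed

lemma curvature_matrix:
  assumes "x \<in> S"
  shows "curvature G x u v w = curv_mat G u v x *v w"
proof -
  have n: "nabla G (\<lambda>_. v) (\<lambda>_. w) = (\<lambda>y. christoffel G y v w)" for v w
    by (simp add: nabla_def fun_eq_iff)
  have p: "pd (\<lambda>y. christoffel G y v w) u x = pd (conn G v) u x *v w" for u v w
  proof -
    have "pd (\<lambda>y. christoffel G y v w) u x = pd (\<lambda>y. conn G v y *v w) u x"
      by (rule pd_cong[OF open_S assms]) (auto simp: conn_christoffel smooth_onD(1)[OF smooth_christoffel assms])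
    then show ?thesis by (simp add: pd_matrix_vector_mult diff_conn assms)
  qed
  have n2: "nabla2 G (\<lambda>_. u) (\<lambda>_. v) (\<lambda>_. w) x
      = (pd (conn G v) u x + conn G u x ** conn G v x - conn G (conn G u x *v v) x) *v w" for u v
    by (simp add: nabla2_def n) (simp add: nabla_def p conn_christoffel[symmetric] assms mat_algebra)
  show ?thesis
    by (simp add: curvature_def curv_mat_def n2 torsion_free[OF assms, of v u] mat_algebra)
qed

lemma smooth_curv_mat: "smooth_on S (curv_mat G u v)"
  unfolding curv_mat_def by (intro smooth_rules smooth_conn)

lemma smooth_curvature: "smooth_on S (\<lambda>x. curvature G x u v w)"
  by (rule smooth_on_cong[OF open_S, where f = "\<lambda>x. curv_mat G u v x *v w"])
     (auto intro!: smooth_rules smooth_curv_mat simp: curvature_matrix)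

text \<open>The Ricci identity for the parallel tensor \<open>G\<close>: differentiating \<open>dG(u) = conn(u)\<^sup>T G + G conn(u)\<close> once
  more and antisymmetrizing leaves only curvature, because the second derivative of \<open>G\<close> is symmetric.\<close>

lemma curv_mat_skew:
  assumes "x \<in> S"
  shows "transpose (curv_mat G u v x) ** G x + G x ** curv_mat G u v x = 0"
proof -
  have dG: "G differentiable (at x)" by (rule smooth_onD(1)[OF smooth_G assms])
  have dc: "conn G w differentiable (at x)" "(\<lambda>y. transpose (conn G w y)) differentiable (at x)" for w
    by (intro smooth_onD(1)[OF _ assms] smooth_rules smooth_conn)+
  have "pd (pd G w) z x = transpose (conn G w x) ** pd G z x + transpose (pd (conn G w) z x) ** G x
      + (G x ** pd (conn G w) z x + pd G z x ** conn G w x)" for w z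
  proof -
    have "pd (pd G w) z x = pd (\<lambda>y. transpose (conn G w y) ** G y + G y ** conn G w y) z x"
      by (rule pd_cong[OF open_S assms])
         (auto simp: metric_connection intro!: smooth_onD(1)[OF _ assms] smooth_rules smooth_G)
    also have "\<dots> = pd (\<lambda>y. transpose (conn G w y) ** G y) z x + pd (\<lambda>y. G y ** conn G w y) z x"
      by (rule pd_add) (intro smooth_onD(1)[OF _ assms] smooth_rules smooth_G smooth_conn)+
    finally show ?thesis
      by (simp add: pd_matrix_mult pd_transpose dG dc)
  qed
  moreover have "pd (pd G u) v x = pd (pd G v) u x"
    by (rule mixed_derivatives[OF open_S smooth_G assms])
  ultimately show ?thesis
    by (simp add: metric_connection[OF assms] curv_mat_def mat_algebra algebra_simps)
qed

lemma curvature_antisym: "curvature G x u v w = - curvature G x v u w"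
  by (simp add: curvature_def)

lemma curvature_skew:
  assumes "x \<in> S"
  shows "gip (G x) (curvature G x u v w) z = - gip (G x) w (curvature G x u v z)"
  using curv_mat_skew[OF assms, of u v] assms
  by (simp add: curvature_matrix gip_mult add_eq_0_iff gip_matrix_linear(4)[symmetric])

text \<open>The derivative of the symmetry \<open>conn(u) v = conn(v) u\<close>, which holds on the whole patch, makes the terms with
  derivatives cancel in the cyclic sum.\<close>

lemma first_bianchi:
  assumes "x \<in> S"
  shows "curvature G x u v w + curvature G x v w u + curvature G x w u v = 0"
proof -
  have "pd (conn G v) u x *v w = pd (conn G w) u x *v v" for u v w
  proof -
    have "pd (\<lambda>y. conn G v y *v w) u x = pd (\<lambda>y. conn G w y *v v) u x"
      by (rule pd_cong[OF open_S assms])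
         (auto simp: torsion_free[of _ v] intro!: smooth_onD(1)[OF _ assms] smooth_rules smooth_conn)
    then show ?thesis by (simp add: pd_matrix_vector_mult diff_conn assms)
  qed
  from this[of v u w] this[of u v w] this[of u w v]
  show ?thesis
    by (simp add: curvature_matrix assms curv_mat_def mat_algebra
        torsion_free[OF assms, of w v] torsion_free[OF assms, of w u] torsion_free[OF assms, of v u])
qed

lemma
  assumes "x \<in> S"
  shows curv_mat_add_left: "curv_mat G (u + u') v x = curv_mat G u v x + curv_mat G u' v x"
    and curv_mat_scale_left: "curv_mat G (r *\<^sub>R u) v x = r *\<^sub>R curv_mat G u v x"
proof -
  have 1: "pd (conn G (u + u')) v x = pd (conn G u) v x + pd (conn G u') v x"
  proof -
    have "pd (conn G (u + u')) v x = pd (\<lambda>y. conn G u y + conn G u' y) v x"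
      by (rule pd_cong[OF open_S assms]) (auto simp: conn_add diff_conn assms)
    then show ?thesis by (simp add: pd_add diff_conn assms)
  qed
  have 2: "pd (conn G (r *\<^sub>R u)) v x = r *\<^sub>R pd (conn G u) v x"
  proof -
    have "pd (conn G (r *\<^sub>R u)) v x = pd (\<lambda>y. r *\<^sub>R conn G u y) v x"
      by (rule pd_cong[OF open_S assms]) (auto simp: conn_scale diff_conn assms)
    then show ?thesis
      using pd_eqI[OF has_derivative_scaleR_right[OF frechet_derivative_works[THEN iffD1, OF diff_conn[OF assms]]]]
      by simp
  qed
  have 3: "linear (frechet_derivative (conn G v) (at x))"
    using linear_frechet_derivative diff_conn assms by blast
  show "curv_mat G (u + u') v x = curv_mat G u v x + curv_mat G u' v x"
    "curv_mat G (r *\<^sub>R u) v x = r *\<^sub>R curv_mat G u v x"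
    by (simp_all add: curv_mat_def 1 2 linear_add[OF 3] linear_scale[OF 3] conn_add conn_scale assms mat_algebra algebra_simps)
qed

lemma smooth_contract:
  assumes "\<And>i j. smooth_on S (\<lambda>x. B x (axis i 1) (axis j 1))"
  shows "smooth_on S (\<lambda>x. contract (G x) (B x))"
  unfolding contract_def by (intro smooth_rules assms smooth_inv_G) auto

lemma smooth_Ric: "smooth_on S (\<lambda>x. Ric G x u)"
  unfolding Ric_def by (intro smooth_contract smooth_curvature)

lemma smooth_scal: "smooth_on S (scal G)"
  unfolding scal_def trace_def matrix_def
  by (simp, intro smooth_rules smooth_Ric) auto

lemma smooth_schouten: "smooth_on S (\<lambda>x. schouten G x u)"
  unfolding schouten_def by (intro smooth_rules smooth_Ric smooth_scal smooth_divide_const)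

lemma smooth_gip_left: "smooth_on S f \<Longrightarrow> smooth_on S (\<lambda>x. gip (G x) (f x) w)"
  unfolding gip_def by (intro smooth_on_bilinear[OF bounded_bilinear_inner open_S] smooth_rules smooth_G)

lemma smooth_weyl: "smooth_on S (\<lambda>x. weyl G x u v w)"
  unfolding weyl_def
  by (intro smooth_rules smooth_gip_left smooth_curvature smooth_schouten smooth_G)

lemma smooth_weyl_op: "smooth_on S (\<lambda>x. weyl_op G x A)"
  unfolding weyl_op_def by (intro smooth_matrix smooth_contract smooth_weyl)

lemma nabla_end_matrix:
  assumes "x \<in> S" "A differentiable (at x)"
  shows "nabla_end G (\<lambda>_. u) A x = pd A u x + conn G u x ** A x - A x ** conn G u x"
proof -
  have "nabla G (\<lambda>_. u) (\<lambda>y. A y *v v) x - A x *v nabla G (\<lambda>_. u) (\<lambda>_. v) x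
      = (pd A u x + conn G u x ** A x - A x ** conn G u x) *v v" for v
    using assms by (simp add: nabla_def pd_matrix_vector_mult conn_christoffel[symmetric] mat_algebra)
  then show ?thesis
    by (simp add: nabla_end_def matrix_of_mult)
qed

end


section \<open>Algebraic curvature tensors on a Hermitian vector space\<close>

text \<open>The curvature quantities at one point depend only on the metric \<open>m\<close>, the complex structure \<open>j\<close> and the
  trilinear map \<open>R\<close> there. Stating them in this generality allows to move them along linear isometries:
  to a standard frame for computations, and between charts.\<close>

definition ric_of :: "real^4^4 \<Rightarrow> (real^4 \<Rightarrow> real^4 \<Rightarrow> real^4 \<Rightarrow> real^4) \<Rightarrow> real^4 \<Rightarrow> real^4" where
  "ric_of m R u = contract m (\<lambda>v v'. R u v v')"

definition scal_of :: "real^4^4 \<Rightarrow> (real^4 \<Rightarrow> real^4 \<Rightarrow> real^4 \<Rightarrow> real^4) \<Rightarrow> real" where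
  "scal_of m R = trace (matrix (ric_of m R))"

definition ric_star_of :: "real^4^4 \<Rightarrow> real^4^4 \<Rightarrow> (real^4 \<Rightarrow> real^4 \<Rightarrow> real^4 \<Rightarrow> real^4) \<Rightarrow> real^4 \<Rightarrow> real^4" where
  "ric_star_of m j R u = contract m (\<lambda>v v'. R (j *v u) (j *v v) v')"

definition scal_star_of :: "real^4^4 \<Rightarrow> real^4^4 \<Rightarrow> (real^4 \<Rightarrow> real^4 \<Rightarrow> real^4 \<Rightarrow> real^4) \<Rightarrow> real" where
  "scal_star_of m j R = trace (matrix (ric_star_of m j R))"

definition schouten_of :: "real^4^4 \<Rightarrow> (real^4 \<Rightarrow> real^4 \<Rightarrow> real^4 \<Rightarrow> real^4) \<Rightarrow> real^4 \<Rightarrow> real^4" where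
  "schouten_of m R u = (1/2) *\<^sub>R (ric_of m R u - (scal_of m R / 6) *\<^sub>R u)"

definition weyl_of :: "real^4^4 \<Rightarrow> (real^4 \<Rightarrow> real^4 \<Rightarrow> real^4 \<Rightarrow> real^4) \<Rightarrow> real^4 \<Rightarrow> real^4 \<Rightarrow> real^4 \<Rightarrow> real^4" where
  "weyl_of m R u v w = R u v w
     - (gip m (schouten_of m R v) w *\<^sub>R u - gip m (schouten_of m R u) w *\<^sub>R v
        + gip m v w *\<^sub>R schouten_of m R u - gip m u w *\<^sub>R schouten_of m R v)"

definition weyl_op_of :: "real^4^4 \<Rightarrow> (real^4 \<Rightarrow> real^4 \<Rightarrow> real^4 \<Rightarrow> real^4) \<Rightarrow> real^4^4 \<Rightarrow> real^4^4" where
  "weyl_op_of m R A = matrix (\<lambda>w. contract m (\<lambda>u v. weyl_of m R (A *v u) v w))"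

lemma curvature_quantities_of:
  "Ric G x = ric_of (G x) (curvature G x)" "scal G x = scal_of (G x) (curvature G x)"
  "scal_star G J x = scal_star_of (G x) (J x) (curvature G x)"
  "weyl_op G x = weyl_op_of (G x) (curvature G x)"
proof -
  show 1: "Ric G x = ric_of (G x) (curvature G x)" by (simp add: fun_eq_iff Ric_def ric_of_def)
  show 2: "scal G x = scal_of (G x) (curvature G x)" by (simp add: scal_def scal_of_def 1)
  have "Ric_star G J x = ric_star_of (G x) (J x) (curvature G x)"
    by (simp add: fun_eq_iff Ric_star_def ric_star_of_def)
  then show "scal_star G J x = scal_star_of (G x) (J x) (curvature G x)"
    by (simp add: scal_star_def scal_star_of_def)
  have "schouten G x = schouten_of (G x) (curvature G x)"
    by (simp add: fun_eq_iff schouten_def schouten_of_def 1 2)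
  then have "weyl G x = weyl_of (G x) (curvature G x)"
    by (simp add: fun_eq_iff weyl_def weyl_of_def)
  then show "weyl_op G x = weyl_op_of (G x) (curvature G x)"
    by (simp add: fun_eq_iff weyl_op_def weyl_op_of_def)
qed

lemma gip_congruence: "gip (transpose A ** m ** A) u v = gip m (A *v u) (A *v v)"
  by (simp add: gip_mult matrix_mul_assoc)

lemma linear_contract:
  fixes B :: "'a::real_vector \<Rightarrow> real^4 \<Rightarrow> real^4 \<Rightarrow> 'b::real_vector"
  assumes "\<And>u v. linear (\<lambda>w. B w u v)"
  shows "linear (\<lambda>w. contract m (B w))"
  by (simp add: linear_iff contract_def linear_add[OF assms] linear_scale[OF assms]
      scaleR_add_right sum.distrib scaleR_sum_right mult.commute)

lemma contract_linear_image:
  assumes "linear L"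
  shows "contract m (\<lambda>u v. L (B u v)) = L (contract m B)"
  by (simp add: contract_def linear_sum[OF assms] linear_scale[OF assms])

lemma linear_matrix_vector_mult: "linear ((*v) (A::real^4^4))"
  by (simp add: linear_iff mat_algebra)

lemma linear_gip: "linear (gip m u)" "linear (\<lambda>u. gip m u v)"
  by (simp_all add: linear_iff gip_linear)

locale trilinear_map =
  fixes R :: "real^4 \<Rightarrow> real^4 \<Rightarrow> real^4 \<Rightarrow> real^4"
  assumes lin1: "linear (\<lambda>u. R u v w)" and lin2: "linear (\<lambda>v. R u v w)" and lin3: "linear (R u v)"
begin

lemmas R_linear = linear_add[OF lin1] linear_add[OF lin2] linear_add[OF lin3]
  linear_scale[OF lin1] linear_scale[OF lin2] linear_scale[OF lin3]
  linear_neg[OF lin1] linear_neg[OF lin2] linear_neg[OF lin3]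
  linear_0[OF lin1] linear_0[OF lin2] linear_0[OF lin3]

lemma linear_ric: "linear (ric_of m R)"
  unfolding ric_of_def by (rule linear_contract) (rule lin1)

lemma linear_ric_star: "linear (ric_star_of m j R)"
  unfolding ric_star_of_def by (rule linear_contract) (simp add: linear_iff R_linear mat_algebra)

lemma linear_schouten: "linear (schouten_of m R)"
  by (simp add: schouten_of_def linear_iff linear_add[OF linear_ric] linear_scale[OF linear_ric] algebra_simps)

lemma trilinear_weyl: "trilinear_map (weyl_of m R)"
  by unfold_locales
     (simp_all add: linear_iff weyl_of_def R_linear gip_linear linear_add[OF linear_schouten]
       linear_scale[OF linear_schouten] algebra_simps)

lemma linear_weyl_op: "linear (weyl_op_of m R)"
proof -
  interpret W: trilinear_map "weyl_of m R" by (rule trilinear_weyl)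
  have "linear (\<lambda>A. contract m (\<lambda>u v. weyl_of m R (A *v u) v w))" for w
    by (rule linear_contract) (simp add: linear_iff mat_algebra W.R_linear)
  then show ?thesis
    unfolding weyl_op_of_def linear_iff by (simp add: matrix_def vec_eq_iff)
qed

end

subsection \<open>Adapted frames\<close>

text \<open>Multiplication by \<open>i\<close>, \<open>j\<close>, \<open>k\<close> on the quaternions, spanning the self-dual endomorphisms of the standard
  Hermitian structure on \<open>\<real>\<^sup>4\<close>. The frame is \<open>e\<^sub>1\<close>, \<open>e\<^sub>2 = J0 e\<^sub>1\<close>, \<open>e\<^sub>3\<close>, \<open>e\<^sub>4 = J0 e\<^sub>3\<close>, and \<open>I0\<close> maps \<open>e\<^sub>1\<close> to \<open>e\<^sub>3\<close>.\<close>

definition J0 :: "real^4^4" where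
  "J0 = (\<chi> i k. if i = 2 \<and> k = 1 \<or> i = 4 \<and> k = 3 then 1 else if i = 1 \<and> k = 2 \<or> i = 3 \<and> k = 4 then -1 else 0)"

definition I0 :: "real^4^4" where
  "I0 = (\<chi> i k. if i = 3 \<and> k = 1 \<or> i = 2 \<and> k = 4 then 1 else if i = 1 \<and> k = 3 \<or> i = 4 \<and> k = 2 then -1 else 0)"

definition K0 :: "real^4^4" where
  "K0 = (\<chi> i k. if i = 4 \<and> k = 1 \<or> i = 3 \<and> k = 2 then 1 else if i = 1 \<and> k = 4 \<or> i = 2 \<and> k = 3 then -1 else 0)"

lemma mat4_eq_iff: "A = B \<longleftrightarrow> (\<forall>i j. A $ i $ j = B $ i $ j)" for A B :: "real^4^4"
  by (simp add: vec_eq_iff)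

lemmas quat_defs = J0_def I0_def K0_def
lemmas mat4_simps = mat4_eq_iff forall_4 matrix_matrix_mult_def matrix_vector_mult_def sum_4 quat_defs mat_def
  transpose_def trace_def

lemma quaternion_relations:
  "J0 ** J0 = - mat 1" "I0 ** I0 = - mat 1" "K0 ** K0 = - mat 1"
  "J0 ** I0 = K0" "I0 ** J0 = - K0" "I0 ** K0 = J0" "K0 ** I0 = - J0" "K0 ** J0 = I0" "J0 ** K0 = - I0"
  "transpose J0 = - J0" "transpose I0 = - I0" "transpose K0 = - K0"
  by (simp_all add: mat4_simps)

lemma quat_entries:
  "J0 $ i $ k = (if i = 2 \<and> k = 1 \<or> i = 4 \<and> k = 3 then 1 else if i = 1 \<and> k = 2 \<or> i = 3 \<and> k = 4 then -1 else 0)"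
  "I0 $ i $ k = (if i = 3 \<and> k = 1 \<or> i = 2 \<and> k = 4 then 1 else if i = 1 \<and> k = 3 \<or> i = 4 \<and> k = 2 then -1 else 0)"
  "K0 $ i $ k = (if i = 4 \<and> k = 1 \<or> i = 3 \<and> k = 2 then 1 else if i = 1 \<and> k = 4 \<or> i = 2 \<and> k = 3 then -1 else 0)"
  by (simp_all add: quat_defs)

lemma frame_images:
  "J0 *v axis 1 1 = axis 2 1" "J0 *v axis 2 1 = - axis 1 1" "J0 *v axis 3 1 = axis 4 1" "J0 *v axis 4 1 = - axis 3 1"
  "I0 *v axis 1 1 = axis 3 1" "I0 *v axis 2 1 = - axis 4 1" "I0 *v axis 3 1 = - axis 1 1" "I0 *v axis 4 1 = axis 2 1"
  "K0 *v axis 1 1 = axis 4 1" "K0 *v axis 2 1 = axis 3 1" "K0 *v axis 3 1 = - axis 2 1" "K0 *v axis 4 1 = - axis 1 1"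
  by (simp_all add: vec_eq_iff forall_4 matrix_vector_mult_def sum_4 quat_defs axis_def)

locale hermitian_space =
  fixes m j :: "real^4^4"
  assumes sym: "gip m u v = gip m v u" and pos: "u \<noteq> 0 \<Longrightarrow> gip m u u > 0"
    and jj: "j ** j = - mat 1" and skew: "gip m (j *v u) v = - gip m u (j *v v)"
begin

lemma j_j_apply: "j *v (j *v u) = - u"
  using jj by (metis matrix_vector_mul_assoc matrix_vector_mul_lid mv.minus_left)

lemma j_isometry: "gip m (j *v u) (j *v v) = gip m u v"
  by (simp add: skew j_j_apply gip_linear)

lemma j_orthogonal: "gip m (j *v u) u = 0"
  using skew[of u u] sym[of "j *v u" u] by simp

lemma normalize:
  assumes "w \<noteq> 0"
  obtains r where "r \<noteq> 0" "gip m (r *\<^sub>R w) (r *\<^sub>R w) = 1"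
proof
  show "1 / sqrt (gip m w w) \<noteq> 0" using pos[OF assms] by simp
  show "gip m ((1 / sqrt (gip m w w)) *\<^sub>R w) ((1 / sqrt (gip m w w)) *\<^sub>R w) = 1"
    using pos[OF assms] by (simp add: gip_linear)
qed

text \<open>Gram-Schmidt with every second vector replaced by the image of its predecessor under \<open>j\<close>, which is
  automatically a unit vector orthogonal to it.\<close>

lemma adapted_frame:
  obtains E C where "C ** E = mat 1" "E ** C = mat 1" "transpose E ** m ** E = mat 1" "j ** E = E ** J0"
proof -
  obtain r where r: "gip m (r *\<^sub>R axis 1 1) (r *\<^sub>R axis 1 1) = 1"
    by (rule normalize[of "axis 1 1"]) auto
  define a where "a = r *\<^sub>R (axis 1 1 :: real^4)"
  define b where "b = j *v a"
  have "span {a, b} \<noteq> UNIV"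
  proof
    assume *: "span {a, b} = UNIV"
    have "dim (span {a, b}) \<le> card {a, b}" by (simp add: dim_le_card')
    then show False using * card_insert_le_m1[of 2 "{b}" a] by (simp add: dim_UNIV card_insert_if split: if_splits)
  qed
  then obtain w where w: "w \<notin> span {a, b}" by blast
  define w' where "w' = w - gip m w a *\<^sub>R a - gip m w b *\<^sub>R b"
  have "w' \<noteq> 0"
  proof
    assume "w' = 0"
    then have "w = gip m w a *\<^sub>R a + gip m w b *\<^sub>R b" by (simp add: w'_def algebra_simps)
    moreover have "gip m w a *\<^sub>R a + gip m w b *\<^sub>R b \<in> span {a, b}"
      by (intro span_add span_scale span_base) auto
    ultimately show False using w by simp
  qed
  then obtain s where s: "gip m (s *\<^sub>R w') (s *\<^sub>R w') = 1" by (rule normalize)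
  define c where "c = s *\<^sub>R w'"
  define d where "d = j *v c"
  have aa: "gip m a a = 1" and cc: "gip m c c = 1" using r s by (simp_all add: a_def c_def)
  have bb: "gip m b b = 1" and dd: "gip m d d = 1" by (simp_all add: b_def d_def j_isometry aa cc)
  have ba: "gip m b a = 0" and dc: "gip m d c = 0" by (simp_all add: b_def d_def j_orthogonal)
  have ca: "gip m c a = 0" by (simp add: c_def w'_def gip_linear aa ba)
  have cb: "gip m c b = 0" by (simp add: c_def w'_def gip_linear bb sym[of a b] ba)
  have da: "gip m d a = 0" using skew[of c a] cb by (simp add: b_def d_def)
  have db: "gip m d b = 0" by (simp add: d_def b_def j_isometry ca)
  define F where "F k = (if k = 1 then a else if k = 2 then b else if k = 3 then c else d)" for k :: 4
  define E :: "real^4^4" where "E = (\<chi> i k. F k $ i)"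
  have EF: "E *v axis k 1 = F k" for k
    by (simp add: E_def matrix_vector_mult_basis column_def vec_eq_iff)
  have "gip m (F k) (F l) = (if k = l then 1 else 0)" for k l
    using exhaust_4[of k] exhaust_4[of l]
    by (elim disjE)
       (simp_all add: F_def aa bb cc dd ba ca cb da db dc sym[of a b] sym[of a c] sym[of a d] sym[of b c] sym[of b d] sym[of c d])
  then have "gip (transpose E ** m ** E) (axis k 1) (axis l 1) = (if k = l then 1 else 0)" for k l
    by (simp add: gip_congruence EF)
  then have EmE: "transpose E ** m ** E = mat 1"
    by (simp add: gip_axis vec_eq_iff mat_def)
  then have "E ** (transpose E ** m) = mat 1"
    using matrix_left_right_inverse by blast
  moreover have "j *v F k = E *v (J0 *v axis k 1)" for k
  proof -
    have jb: "j *v b = - a" "j *v d = - c" by (simp_all add: b_def d_def j_j_apply)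
    have F: "F 1 = a" "F 2 = b" "F 3 = c" "F 4 = d" by (simp_all add: F_def)
    show ?thesis
      using exhaust_4[of k] by (elim disjE) (simp_all add: frame_images F EF mat_algebra jb b_def[symmetric] d_def[symmetric])
  qed
  then have "(j ** E) *v axis k 1 = (E ** J0) *v axis k 1" for k
    by (simp add: EF mat_algebra)
  then have "j ** E = E ** J0"
    by (simp add: matrix_vector_mult_basis column_def vec_eq_iff)
  ultimately show thesis using EmE that by blast
qed

end

interpretation std: hermitian_space "mat 1" J0
proof
  show "gip (mat 1) u v = gip (mat 1) v u" for u v by (simp add: gip_def inner_commute)
  show "u \<noteq> 0 \<Longrightarrow> gip (mat 1) u u > 0" for u by (simp add: gip_def)
  show "J0 ** J0 = - mat 1" by (rule quaternion_relations)
  show "gip (mat 1) (J0 *v u) v = - gip (mat 1) u (J0 *v v)" for u v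
    by (simp add: gip_mult quaternion_relations gip_matrix_linear mm.minus_left)
qed

subsection \<open>Naturality\<close>

text \<open>An isomorphism \<open>D\<close>, with inverse \<open>C\<close>, of Hermitian vector spaces from \<open>(m, j)\<close> to \<open>(m', j')\<close>. It is used for
  adapted frames and for the derivatives of coordinate changes.\<close>

locale hermitian_isometry = hermitian_space m j for m j +
  fixes m' j' D C :: "real^4^4"
  assumes DC: "D ** C = mat 1" and CD: "C ** D = mat 1"
    and iso: "gip m' (D *v u) (D *v v) = gip m u v" and jD: "j' ** D = D ** j"
begin

lemma inverse_apply: "D *v (C *v u) = u" "C *v (D *v u) = u"
  by (simp_all add: matrix_vector_mul_assoc DC CD)

lemma inverse_mult: "D ** (C ** A) = A" "C ** (D ** A) = A"
  by (simp_all add: matrix_mul_assoc DC CD)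

lemma D_intertwines: "j' *v (D *v u) = D *v (j *v u)"
  by (simp add: matrix_vector_mul_assoc jD)

text \<open>Isometries map orthonormal frames to orthonormal frames, and a contraction may be computed in any of them.\<close>

lemma contract_pullback:
  fixes B :: "real^4 \<Rightarrow> real^4 \<Rightarrow> 'b::real_vector"
  assumes "\<And>v. linear (\<lambda>u. B u v)" "\<And>u. linear (B u)"
  shows "contract m' B = contract m (\<lambda>u v. B (D *v u) (D *v v))"
proof -
  obtain E :: "real^4^4" and C where "C ** E = mat 1" "E ** C = mat 1"
    and E: "transpose E ** m ** E = mat 1" and "j ** E = E ** J0"
    by (rule adapted_frame)
  have "gip m (E *v axis k 1) (E *v axis l 1) = (if k = l then 1 else 0)" for k l
    by (simp add: gip_congruence[symmetric] E gip_axis) (simp add: mat_def)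
  then have "contract m' B = (\<Sum>k\<in>UNIV. B (D *v (E *v axis k 1)) (D *v (E *v axis k 1)))"
    "contract m (\<lambda>u v. B (D *v u) (D *v v)) = (\<Sum>k\<in>UNIV. B (D *v (E *v axis k 1)) (D *v (E *v axis k 1)))"
    by (intro contract_frame; simp add: iso assms linear_compose[OF linear_matrix_vector_mult assms(1), unfolded o_def]
        linear_compose[OF linear_matrix_vector_mult assms(2), unfolded o_def])+
  then show ?thesis by simp
qed

lemma matrix_conj:
  assumes "linear L"
  shows "matrix (\<lambda>w. D *v L (C *v w)) = D ** matrix L ** C"
proof -
  have "D *v L (C *v w) = (D ** matrix L ** C) *v w" for w
    by (simp add: mat_algebra matrix_mult_basis assms)
  then show ?thesis by (simp add: matrix_of_mult)
qed

lemma trace_conj: "trace (D ** A ** C) = trace A"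
  by (metis CD matrix_mul_assoc matrix_mul_lid trace_mul_sym)

lemma form2_conj: "form2 m' (D ** A ** C) (D *v u) (D *v v) = form2 m A u v"
  by (simp add: form2_def mat_algebra inverse_apply iso)

lemma j_conj: "j' = D ** j ** C"
  by (metis DC jD matrix_mul_assoc matrix_mul_rid)

lemma hodge2_conj: "hodge2 m' j' (form2 m' (D ** A ** C)) (D *v a) (D *v b) = hodge2 m j (form2 m A) a b"
proof -
  have f: "linear (form2 m A u)" "linear (\<lambda>u. form2 m A u v)" for m A u v
    by (simp_all add: form2_def linear_iff gip_linear mat_algebra)
  note fl = linear_add[OF f(1)] linear_add[OF f(2)] linear_scale[OF f(1)] linear_scale[OF f(2)]
  have v: "linear (\<lambda>v. vol_form m j u v a b)" "linear (\<lambda>u. vol_form m j u v a b)" for m j u v a b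
    by (simp_all add: vol_form_def wedge22_def linear_iff fl field_simps)
  note vl = linear_add[OF v(1)] linear_add[OF v(2)] linear_scale[OF v(1)] linear_scale[OF v(2)]
  have vol: "vol_form m' j' (D *v u) (D *v v) (D *v a) (D *v b) = vol_form m j u v a b" for u v a b
    by (simp add: vol_form_def wedge22_def j_conj form2_conj)
  let ?A = "D ** A ** C"
  have "contract m' (\<lambda>u u'. contract m' (\<lambda>v v'. form2 m' ?A u v * vol_form m' j' u' v' (D *v a) (D *v b)))
      = contract m (\<lambda>u u'. contract m' (\<lambda>v v'. form2 m' ?A (D *v u) v * vol_form m' j' (D *v u') v' (D *v a) (D *v b)))"
    by (rule contract_pullback; rule linear_contract) (simp_all add: linear_iff fl vl algebra_simps)
  also have "\<dots> = contract m (\<lambda>u u'. contract m (\<lambda>v v'. form2 m' ?A (D *v u) (D *v v) * vol_form m' j' (D *v u') (D *v v') (D *v a) (D *v b)))"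
    by (subst contract_pullback) (simp_all add: linear_iff fl vl algebra_simps)
  finally show ?thesis
    by (simp add: hodge2_def form2_conj vol)
qed

lemma self_dual_conj: "D ** A ** C \<in> self_dual m' j' \<longleftrightarrow> A \<in> self_dual m j"
proof -
  have "(\<forall>u v. gip m' ((D ** A ** C) *v u) v = - gip m' u ((D ** A ** C) *v v))
      \<longleftrightarrow> (\<forall>u v. gip m' ((D ** A ** C) *v (D *v u)) (D *v v) = - gip m' (D *v u) ((D ** A ** C) *v (D *v v)))"
    by (metis inverse_apply(1))
  also have "\<dots> \<longleftrightarrow> (\<forall>u v. gip m (A *v u) v = - gip m u (A *v v))"
    by (simp add: mat_algebra inverse_apply iso)
  finally have 1: "(\<forall>u v. gip m' ((D ** A ** C) *v u) v = - gip m' u ((D ** A ** C) *v v))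
      \<longleftrightarrow> (\<forall>u v. gip m (A *v u) v = - gip m u (A *v v))" .
  have "hodge2 m' j' (form2 m' (D ** A ** C)) = form2 m' (D ** A ** C)
    \<longleftrightarrow> (\<forall>a b. hodge2 m' j' (form2 m' (D ** A ** C)) (D *v a) (D *v b) = form2 m' (D ** A ** C) (D *v a) (D *v b))"
    unfolding fun_eq_iff by (metis inverse_apply(1))
  also have "\<dots> \<longleftrightarrow> hodge2 m j (form2 m A) = form2 m A"
    by (simp add: hodge2_conj form2_conj fun_eq_iff)
  finally show ?thesis using 1 by (simp add: self_dual_def)
qed

end

text \<open>An isomorphism that also carries \<open>R\<close> to \<open>R'\<close> carries every quantity derived from \<open>R\<close> to its counterpart.\<close>

locale curvature_isometry = hermitian_isometry m j m' j' D C + R: trilinear_map R + R': trilinear_map R'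
  for m j m' j' D C R R' +
  assumes R_iso: "R' (D *v u) (D *v v) (D *v w) = D *v R u v w"
begin

lemma ric_conj: "ric_of m' R' (D *v u) = D *v ric_of m R u"
proof -
  have "ric_of m' R' (D *v u) = contract m (\<lambda>v v'. R' (D *v u) (D *v v) (D *v v'))"
    unfolding ric_of_def by (rule contract_pullback) (rule R'.lin2 R'.lin3)+
  then show ?thesis
    by (simp add: R_iso ric_of_def contract_linear_image[OF linear_matrix_vector_mult])
qed

lemma ric_star_conj: "ric_star_of m' j' R' (D *v u) = D *v ric_star_of m j R u"
proof -
  have "ric_star_of m' j' R' (D *v u) = contract m (\<lambda>v v'. R' (j' *v (D *v u)) (j' *v (D *v v)) (D *v v'))"
    unfolding ric_star_of_def by (rule contract_pullback) (simp_all add: linear_iff R'.R_linear mat_algebra)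
  then show ?thesis
    by (simp add: D_intertwines R_iso ric_star_of_def contract_linear_image[OF linear_matrix_vector_mult])
qed

lemma scal_conj: "scal_of m' R' = scal_of m R"
proof -
  have "ric_of m' R' = (\<lambda>w. D *v ric_of m R (C *v w))"
    using ric_conj[of "C *v _"] by (simp add: inverse_apply fun_eq_iff)
  then show ?thesis
    by (simp add: scal_of_def matrix_conj R.linear_ric trace_conj)
qed

lemma scal_star_conj: "scal_star_of m' j' R' = scal_star_of m j R"
proof -
  have "ric_star_of m' j' R' = (\<lambda>w. D *v ric_star_of m j R (C *v w))"
    using ric_star_conj[of "C *v _"] by (simp add: inverse_apply fun_eq_iff)
  then show ?thesis
    by (simp add: scal_star_of_def matrix_conj R.linear_ric_star trace_conj)
qed

lemma weyl_conj: "weyl_of m' R' (D *v u) (D *v v) (D *v w) = D *v weyl_of m R u v w"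
proof -
  have "schouten_of m' R' (D *v u) = D *v schouten_of m R u" for u
    by (simp add: schouten_of_def ric_conj scal_conj mat_algebra)
  then show ?thesis
    by (simp add: weyl_of_def R_iso iso mat_algebra)
qed

lemma weyl_op_conj: "weyl_op_of m' R' (D ** A ** C) = D ** weyl_op_of m R A ** C"
proof -
  interpret W: trilinear_map "weyl_of m R" by (rule R.trilinear_weyl)
  interpret W': trilinear_map "weyl_of m' R'" by (rule R'.trilinear_weyl)
  have "contract m' (\<lambda>u v. weyl_of m' R' ((D ** A ** C) *v u) v w)
      = D *v contract m (\<lambda>u v. weyl_of m R (A *v u) v (C *v w))" for w
  proof -
    have "contract m' (\<lambda>u v. weyl_of m' R' ((D ** A ** C) *v u) v w)
      = contract m (\<lambda>u v. weyl_of m' R' (D *v (A *v u)) (D *v v) (D *v (C *v w)))"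
      by (subst contract_pullback) (simp_all add: linear_iff W'.R_linear mat_algebra inverse_apply)
    then show ?thesis
      by (simp add: weyl_conj contract_linear_image[OF linear_matrix_vector_mult])
  qed
  then show ?thesis
    unfolding weyl_op_of_def
    by (simp, intro matrix_conj linear_contract) (rule W.lin3)
qed

end

subsection \<open>The Weyl operator in an adapted frame\<close>

lemma gip_std: "gip (mat 1) u v = u \<bullet> v"
  by (simp add: gip_def)

lemma contract_std: "contract (mat 1) B = (\<Sum>k\<in>UNIV. B (axis k 1) (axis k 1))"
proof -
  have "matrix_inv (mat 1) = (mat 1 :: real^4^4)"
    using matrix_inv_inverse(1)[of "mat 1"] by (metis invertible_def matrix_mul_lid)
  then show ?thesis
    by (simp add: contract_def mat_def if_distrib[of "\<lambda>c. c *\<^sub>R _"] cong: if_cong)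
qed

text \<open>The algebraic symmetries of a Riemannian curvature tensor.\<close>

locale algebraic_curvature = hermitian_space m j + trilinear_map R for m j R +
  assumes antisym: "R u v w = - R v u w"
    and skew_R: "gip m (R u v w) z = - gip m w (R u v z)"
    and bianchi: "R u v w + R v w u + R w u v = 0"

locale std_curvature = algebraic_curvature "mat 1" J0 R for R
begin

definition R_comp :: "4 \<Rightarrow> 4 \<Rightarrow> 4 \<Rightarrow> 4 \<Rightarrow> real" where
  "R_comp i k l n = R (axis i 1) (axis k 1) (axis l 1) $ n"

lemma R_comp_antisym: "R_comp k i l n = - R_comp i k l n"
  by (metis antisym R_comp_def vector_uminus_component)

lemma R_comp_skew: "R_comp i k n l = - R_comp i k l n"
  using skew_R[of "axis i 1" "axis k 1" "axis n 1" "axis l 1"]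
  by (simp add: gip_std R_comp_def inner_axis inner_axis')

lemma R_comp_bianchi: "R_comp i k l n + R_comp k l i n + R_comp l i k n = 0"
  using bianchi[of "axis i 1" "axis k 1" "axis l 1"] by (simp add: R_comp_def vec_eq_iff)

text \<open>The octahedron argument: a signed sum of the Bianchi identities for the four cyclic permutations of the indices.\<close>

lemma R_comp_pair: "R_comp l n i k = R_comp i k l n"
  using R_comp_bianchi[of i k l n] R_comp_bianchi[of k l n i] R_comp_bianchi[of l n i k] R_comp_bianchi[of n i k l]
    R_comp_antisym[of i k l n] R_comp_antisym[of k l] R_comp_antisym[of l i] R_comp_antisym[of l n] R_comp_antisym[of n k] R_comp_antisym[of n i]
    R_comp_skew[of _ _ i k] R_comp_skew[of _ _ k l] R_comp_skew[of _ _ l i] R_comp_skew[of _ _ l n] R_comp_skew[of _ _ n k] R_comp_skew[of _ _ n i]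
  by smt

lemma R_comp_zero: "R_comp i i l n = 0" "R_comp l n i i = 0"
  using R_comp_antisym[of i i l n] R_comp_skew[of l n i i] by simp_all

text \<open>Rewrite rules that leave 21 components, those with both index pairs increasing and in lexicographic
  order. With \<open>R_comp_1423\<close> the remaining 20 components are independent, and linear identities
  between components are decided by simplification.\<close>

lemmas R_comp_reduce =
  R_comp_zero R_comp_antisym[of 2 1] R_comp_antisym[of 3 1] R_comp_antisym[of 4 1] R_comp_antisym[of 3 2] R_comp_antisym[of 4 2] R_comp_antisym[of 4 3]
  R_comp_skew[of _ _ 2 1] R_comp_skew[of _ _ 3 1] R_comp_skew[of _ _ 4 1] R_comp_skew[of _ _ 3 2] R_comp_skew[of _ _ 4 2] R_comp_skew[of _ _ 4 3]
  R_comp_pair[of 1 3 1 2] R_comp_pair[of 1 4 1 2] R_comp_pair[of 2 3 1 2] R_comp_pair[of 2 4 1 2] R_comp_pair[of 3 4 1 2]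
  R_comp_pair[of 1 4 1 3] R_comp_pair[of 2 3 1 3] R_comp_pair[of 2 4 1 3] R_comp_pair[of 3 4 1 3]
  R_comp_pair[of 2 3 1 4] R_comp_pair[of 2 4 1 4] R_comp_pair[of 3 4 1 4]
  R_comp_pair[of 2 4 2 3] R_comp_pair[of 3 4 2 3] R_comp_pair[of 3 4 2 4]

lemma R_comp_1423: "R_comp 1 4 2 3 = R_comp 1 3 2 4 - R_comp 1 2 3 4"
  using R_comp_bianchi[of 1 2 3 4] by (simp add: R_comp_reduce)

definition W_comp :: "4 \<Rightarrow> 4 \<Rightarrow> 4 \<Rightarrow> 4 \<Rightarrow> real" where
  "W_comp i k l n = weyl_of (mat 1) R (axis i 1) (axis k 1) (axis l 1) $ n"

definition P_comp :: "4 \<Rightarrow> 4 \<Rightarrow> real" where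
  "P_comp i n = schouten_of (mat 1) R (axis i 1) $ n"

lemma scal_std: "scal_of (mat 1) R = (\<Sum>i\<in>UNIV. \<Sum>k\<in>UNIV. R_comp i k k i)"
  by (simp add: scal_of_def trace_def matrix_def ric_of_def contract_std R_comp_def)

lemma P_comp_eq: "P_comp i n = ((\<Sum>k\<in>UNIV. R_comp i k k n) - (if i = n then scal_of (mat 1) R / 6 else 0)) / 2"
  by (simp add: P_comp_def schouten_of_def ric_of_def contract_std R_comp_def axis_def)

lemma W_comp_eq: "W_comp i k l n = R_comp i k l n - ((if i = n then P_comp k l else 0) - (if k = n then P_comp i l else 0)
    + (if k = l then P_comp i n else 0) - (if i = l then P_comp k n else 0))"
  by (simp add: W_comp_def weyl_of_def R_comp_def P_comp_def gip_std inner_axis) (simp add: axis_def)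

lemma W_comp_antisym: "W_comp k i l n = - W_comp i k l n"
  by (simp add: W_comp_eq R_comp_antisym[of k i])

lemma weyl_op_entries:
  "weyl_op_of (mat 1) R J0 $ n $ l = 2 * (W_comp 2 1 l n + W_comp 4 3 l n)"
  "weyl_op_of (mat 1) R I0 $ n $ l = 2 * (W_comp 3 1 l n + W_comp 2 4 l n)"
  "weyl_op_of (mat 1) R K0 $ n $ l = 2 * (W_comp 4 1 l n + W_comp 3 2 l n)"
proof -
  interpret W: trilinear_map "weyl_of (mat 1) R" by (rule trilinear_weyl)
  show "weyl_op_of (mat 1) R J0 $ n $ l = 2 * (W_comp 2 1 l n + W_comp 4 3 l n)"
  "weyl_op_of (mat 1) R I0 $ n $ l = 2 * (W_comp 3 1 l n + W_comp 2 4 l n)"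
  "weyl_op_of (mat 1) R K0 $ n $ l = 2 * (W_comp 4 1 l n + W_comp 3 2 l n)"
    by (simp_all add: weyl_op_of_def matrix_def contract_std sum_4 frame_images W.R_linear W_comp_def[symmetric]
        W_comp_antisym[of 1 2] W_comp_antisym[of 3 4] W_comp_antisym[of 1 3] W_comp_antisym[of 4 2] W_comp_antisym[of 1 4] W_comp_antisym[of 2 3])
qed

lemma scal_star_std:
  "scal_star_of (mat 1) J0 R = 2 * (R_comp 2 1 1 2 + R_comp 4 3 1 2 + R_comp 2 1 3 4 + R_comp 4 3 3 4)"
  by (simp add: scal_star_of_def trace_def matrix_def ric_star_of_def contract_std sum_4 frame_images R_linear
      R_comp_def[symmetric] R_comp_reduce R_comp_1423)

lemmas expand_W_comp = W_comp_eq P_comp_eq scal_std sum_4 R_comp_reduce R_comp_1423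

text \<open>On the self-dual endomorphisms the Weyl operator is a symmetric trace-free \<open>3 \<times> 3\<close> matrix in the
  basis \<open>J0\<close>, \<open>I0\<close>, \<open>K0\<close>, and its first entry is half of \<open>S\<^sub>\<star> - S/3\<close>. If the curvature
  endomorphisms commute with \<open>J0\<close>, they have no components along \<open>I0\<close> and \<open>K0\<close>; then the matrix minus a multiple of
  the identity has only its first entry, so it is diagonal with two equal last entries.\<close>

lemma weyl_op_std:
  obtains b c d e f where
    "weyl_op_of (mat 1) R J0 = ((scal_star_of (mat 1) J0 R - scal_of (mat 1) R / 3) / 2) *\<^sub>R J0 + b *\<^sub>R I0 + c *\<^sub>R K0"
    "weyl_op_of (mat 1) R I0 = b *\<^sub>R J0 + d *\<^sub>R I0 + e *\<^sub>R K0"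
    "weyl_op_of (mat 1) R K0 = c *\<^sub>R J0 + e *\<^sub>R I0 + f *\<^sub>R K0"
    "(scal_star_of (mat 1) J0 R - scal_of (mat 1) R / 3) / 2 + d + f = 0"
    "(\<forall>u v w. R u v (J0 *v w) = J0 *v R u v w) \<longrightarrow> b = 0 \<and> c = 0 \<and> e = 0 \<and> d = f"
proof -
  define b c d e f where bcd: "b = weyl_op_of (mat 1) R J0 $ 3 $ 1" "c = weyl_op_of (mat 1) R J0 $ 4 $ 1"
    "d = weyl_op_of (mat 1) R I0 $ 3 $ 1" "e = weyl_op_of (mat 1) R I0 $ 4 $ 1" "f = weyl_op_of (mat 1) R K0 $ 4 $ 1"
  let ?a = "(scal_star_of (mat 1) J0 R - scal_of (mat 1) R / 3) / 2"
  have a: "weyl_op_of (mat 1) R J0 $ 2 $ 1 = ?a"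
    by (simp add: weyl_op_entries scal_star_std expand_W_comp field_simps)
  have 1: "weyl_op_of (mat 1) R J0 = ?a *\<^sub>R J0 + b *\<^sub>R I0 + c *\<^sub>R K0"
    unfolding a[symmetric] bcd by (simp add: mat4_eq_iff forall_4 quat_entries weyl_op_entries expand_W_comp field_simps)
  have 2: "weyl_op_of (mat 1) R I0 = b *\<^sub>R J0 + d *\<^sub>R I0 + e *\<^sub>R K0"
    unfolding bcd by (simp add: mat4_eq_iff forall_4 quat_entries weyl_op_entries expand_W_comp field_simps)
  have 3: "weyl_op_of (mat 1) R K0 = c *\<^sub>R J0 + e *\<^sub>R I0 + f *\<^sub>R K0"
    unfolding bcd by (simp add: mat4_eq_iff forall_4 quat_entries weyl_op_entries expand_W_comp field_simps)
  have 4: "?a + d + f = 0"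
    unfolding a[symmetric] bcd by (simp add: weyl_op_entries expand_W_comp field_simps)
  have 5: "b = 0 \<and> c = 0 \<and> e = 0 \<and> d = f" if K: "\<And>u v w. R u v (J0 *v w) = J0 *v R u v w"
  proof -
    \<comment> \<open>The endomorphism \<open>R(e\<^sub>i, e\<^sub>l)\<close> has no component along \<open>K0\<close> and \<open>I0\<close>.\<close>
    have k: "R_comp i l 2 3 = - R_comp i l 1 4" "R_comp i l 2 4 = R_comp i l 1 3" for i l
    proof -
      have "R (axis i 1) (axis l 1) (axis 2 1) = J0 *v R (axis i 1) (axis l 1) (axis 1 1)"
        using K[of "axis i 1" "axis l 1" "axis 1 1"] by (simp add: frame_images)
      then show "R_comp i l 2 3 = - R_comp i l 1 4" "R_comp i l 2 4 = R_comp i l 1 3"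
        by (simp_all add: R_comp_def matrix_vector_mult_def sum_4 J0_def)
    qed
    have "R_comp 1 3 2 4 = R_comp 1 3 1 3" "R_comp 2 4 2 4 = R_comp 1 3 2 4" "R_comp 1 3 2 3 = - R_comp 1 3 1 4" "R_comp 2 3 2 4 = R_comp 1 3 2 3"
      "R_comp 1 2 2 3 = - R_comp 1 2 1 4" "R_comp 1 2 2 4 = R_comp 1 2 1 3" "R_comp 2 4 3 4 = R_comp 1 3 3 4" "R_comp 2 3 3 4 = - R_comp 1 4 3 4"
      "R_comp 1 4 2 4 = R_comp 1 3 1 4" "R_comp 2 3 2 3 = - R_comp 1 4 2 3" "R_comp 1 4 2 3 = - R_comp 1 4 1 4"
      using k[of 1 3] k[of 2 4] k[of 1 2] k[of 3 4] k[of 1 4] k[of 2 3] R_comp_reduce by (simp_all)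
    then show ?thesis
      unfolding bcd by (simp add: weyl_op_entries expand_W_comp field_simps)
  qed
  show thesis by (rule that[OF 1 2 3 4]) (use 5 in blast)
qed

end


subsection \<open>Self-dual endomorphisms as imaginary quaternions\<close>

definition skew_wrt :: "real^4^4 \<Rightarrow> real^4^4 \<Rightarrow> bool" where
  "skew_wrt m A \<longleftrightarrow> (\<forall>u v. gip m (A *v u) v = - gip m u (A *v v))"

lemma skew_wrt_iff: "skew_wrt m A \<longleftrightarrow> transpose A ** m + m ** A = 0"
proof -
  have "skew_wrt m A \<longleftrightarrow> transpose A ** m = - (m ** A)"
    by (simp only: skew_wrt_def gip_mult gip_eq_iff[of "transpose A ** m"] gip_matrix_linear)
  then show ?thesis by (simp add: eq_neg_iff_add_eq_0)
qed

text \<open>\<open>j\<close>, \<open>I\<close>, \<open>K\<close> multiply like the imaginary quaternions and form a basis of the self-dual endomorphisms,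
  in which \<open>I\<close> and \<open>K\<close> span the skew endomorphisms that anticommute with \<open>j\<close>.\<close>

locale quaternionic =
  fixes m j I K :: "real^4^4"
  assumes products: "j ** j = - mat 1" "I ** I = - mat 1" "K ** K = - mat 1"
    "j ** I = K" "I ** j = - K" "I ** K = j" "K ** I = - j" "K ** j = I" "j ** K = - I"
    and traces: "trace j = 0" "trace I = 0" "trace K = 0"
    and self_dual_iff: "A \<in> self_dual m j \<longleftrightarrow> (\<exists>\<alpha> \<beta> \<gamma>. A = \<alpha> *\<^sub>R j + \<beta> *\<^sub>R I + \<gamma> *\<^sub>R K)"
    and anticommuting: "skew_wrt m A \<Longrightarrow> A ** j = - (j ** A) \<Longrightarrow> \<exists>\<beta> \<gamma>. A = \<beta> *\<^sub>R I + \<gamma> *\<^sub>R K"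

lemma omega_std: "form2 (mat 1) J0 a b = a $ 1 * b $ 2 - a $ 2 * b $ 1 + a $ 3 * b $ 4 - a $ 4 * b $ 3"
  by (simp add: form2_def gip_std inner_vec_def matrix_vector_mult_def sum_4 quat_entries)

lemma hodge2_std:
  "hodge2 (mat 1) J0 (form2 (mat 1) A) a b
     = (\<Sum>k\<in>UNIV. \<Sum>l\<in>UNIV. A $ l $ k * vol_form (mat 1) J0 (axis k 1) (axis l 1) a b) / 2"
  by (simp add: hodge2_def contract_std form2_def gip_std inner_axis matrix_vector_mult_basis column_def)

lemma skew_wrt_std: "skew_wrt (mat 1) A \<longleftrightarrow> (\<forall>i k. A $ i $ k = - A $ k $ i)"
  by (simp add: skew_wrt_iff vec_eq_iff transpose_def add_eq_0_iff)

lemma self_dual_std: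
  "A \<in> self_dual (mat 1) J0 \<longleftrightarrow> (\<exists>\<alpha> \<beta> \<gamma>. A = \<alpha> *\<^sub>R J0 + \<beta> *\<^sub>R I0 + \<gamma> *\<^sub>R K0)"
proof
  assume A: "A \<in> self_dual (mat 1) J0"
  then have s: "A $ i $ k = - A $ k $ i" for i k
    using skew_wrt_std[of A] unfolding self_dual_def skew_wrt_def by blast
  have f: "form2 (mat 1) A (axis k 1) (axis l 1) = A $ l $ k" for k l
    by (simp add: form2_def gip_std inner_axis matrix_vector_mult_basis column_def)
  then have h: "hodge2 (mat 1) J0 (form2 (mat 1) A) (axis k 1) (axis l 1) = A $ l $ k" for k l
    using A by (simp add: self_dual_def)
  have z: "A $ 1 $ 1 = 0" "A $ 2 $ 2 = 0" "A $ 3 $ 3 = 0" "A $ 4 $ 4 = 0"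
    using s[of 1 1] s[of 2 2] s[of 3 3] s[of 4 4] by simp_all
  note ss = s[of 1 2] s[of 1 3] s[of 1 4] s[of 2 3] s[of 2 4] s[of 3 4]
  have "A $ 4 $ 3 = A $ 2 $ 1"
    using h[of 1 2]
    by (simp add: hodge2_std sum_4 vol_form_def wedge22_def omega_std axis_def ss z)
  moreover have "A $ 4 $ 2 = - A $ 3 $ 1"
    using h[of 1 3]
    by (simp add: hodge2_std sum_4 vol_form_def wedge22_def omega_std axis_def ss z)
  moreover have "A $ 3 $ 2 = A $ 4 $ 1"
    using h[of 1 4]
    by (simp add: hodge2_std sum_4 vol_form_def wedge22_def omega_std axis_def ss z)
  ultimately have "A = (A $ 2 $ 1) *\<^sub>R J0 + (A $ 3 $ 1) *\<^sub>R I0 + (A $ 4 $ 1) *\<^sub>R K0"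
    by (simp add: mat4_eq_iff forall_4 quat_entries ss z)
  then show "\<exists>\<alpha> \<beta> \<gamma>. A = \<alpha> *\<^sub>R J0 + \<beta> *\<^sub>R I0 + \<gamma> *\<^sub>R K0" by blast
next
  assume "\<exists>\<alpha> \<beta> \<gamma>. A = \<alpha> *\<^sub>R J0 + \<beta> *\<^sub>R I0 + \<gamma> *\<^sub>R K0"
  then obtain \<alpha> \<beta> \<gamma> where A: "A = \<alpha> *\<^sub>R J0 + \<beta> *\<^sub>R I0 + \<gamma> *\<^sub>R K0" by blast
  have "skew_wrt (mat 1) A"
    by (simp add: skew_wrt_std forall_4 A quat_entries)
  moreover have "hodge2 (mat 1) J0 (form2 (mat 1) A) a b = form2 (mat 1) A a b" for a b
    by (simp add: hodge2_std sum_4 vol_form_def wedge22_def omega_std axis_def A quat_entries)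
       (simp add: form2_def gip_std inner_vec_def matrix_vector_mult_def sum_4 quat_entries field_simps)
  ultimately show "A \<in> self_dual (mat 1) J0"
    by (simp add: self_dual_def skew_wrt_def fun_eq_iff)
qed

lemma anticommuting_std:
  assumes "skew_wrt (mat 1) A" "A ** J0 = - (J0 ** A)"
  shows "A = (A $ 3 $ 1) *\<^sub>R I0 + (A $ 4 $ 1) *\<^sub>R K0"
proof -
  have s: "A $ i $ k = - A $ k $ i" for i k
    using assms(1) skew_wrt_std by blast
  have z: "A $ 1 $ 1 = 0" "A $ 2 $ 2 = 0" "A $ 3 $ 3 = 0" "A $ 4 $ 4 = 0"
    using s[of 1 1] s[of 2 2] s[of 3 3] s[of 4 4] by simp_all
  note ss = s[of 1 2] s[of 1 3] s[of 1 4] s[of 2 3] s[of 2 4] s[of 3 4]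
  have "(A ** J0) $ i $ k = - (J0 ** A) $ i $ k" for i k using assms(2) by simp
  from this[of 1 1] this[of 1 3] this[of 1 4] this[of 3 3] show ?thesis
    by (simp add: mat4_eq_iff forall_4 quat_entries ss z matrix_matrix_mult_def sum_4)
qed

context hermitian_space
begin

lemma frame_isometry:
  assumes "C ** E = mat 1" "E ** C = mat 1" "transpose E ** m ** E = mat 1" "j ** E = E ** J0"
  shows "hermitian_isometry (mat 1) J0 m j E C"
proof
  show "gip m (E *v u) (E *v v) = gip (mat 1) u v" for u v
    using assms(3) gip_congruence[of E m u v] by simp
qed (use assms in auto)

lemma frame_quaternionic:
  assumes "C ** E = mat 1" "E ** C = mat 1" "transpose E ** m ** E = mat 1" "j ** E = E ** J0"
  shows "quaternionic m j (E ** I0 ** C) (E ** K0 ** C)"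
proof -
  interpret hermitian_isometry "mat 1" J0 m j E C by (rule frame_isometry[OF assms])
  have mult: "(E ** A ** C) ** (E ** B ** C) = E ** (A ** B) ** C" for A B
    by (simp add: matrix_mul_assoc[symmetric] inverse_mult)
  note q = quaternion_relations
  have one: "E ** C = mat 1" by (rule assms)
  show ?thesis
  proof
    show "j ** j = - mat 1" by (rule jj)
    show "(E ** I0 ** C) ** (E ** I0 ** C) = - mat 1" "(E ** K0 ** C) ** (E ** K0 ** C) = - mat 1"
      "j ** (E ** I0 ** C) = E ** K0 ** C" "(E ** I0 ** C) ** j = - (E ** K0 ** C)"
      "(E ** I0 ** C) ** (E ** K0 ** C) = j" "(E ** K0 ** C) ** (E ** I0 ** C) = - j"
      "(E ** K0 ** C) ** j = E ** I0 ** C" "j ** (E ** K0 ** C) = - (E ** I0 ** C)"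
      by (simp_all only: j_conj mult q mm.minus_left mm.minus_right matrix_mul_rid one)
    have "trace J0 = 0" "trace I0 = 0" "trace K0 = 0"
      by (simp_all add: trace_def sum_4 quat_entries)
    then show "trace j = 0" "trace (E ** I0 ** C) = 0" "trace (E ** K0 ** C) = 0"
      by (simp_all only: j_conj trace_conj)
  next
    fix A
    have A: "A = E ** (C ** A ** E) ** C" by (simp add: matrix_mul_assoc[symmetric] inverse_mult DC)
    have "A \<in> self_dual m j \<longleftrightarrow> C ** A ** E \<in> self_dual (mat 1) J0"
      by (subst A) (rule self_dual_conj)
    also have "\<dots> \<longleftrightarrow> (\<exists>\<alpha> \<beta> \<gamma>. C ** A ** E = \<alpha> *\<^sub>R J0 + \<beta> *\<^sub>R I0 + \<gamma> *\<^sub>R K0)"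
      by (rule self_dual_std)
    also have "\<dots> \<longleftrightarrow> (\<exists>\<alpha> \<beta> \<gamma>. A = E ** (\<alpha> *\<^sub>R J0 + \<beta> *\<^sub>R I0 + \<gamma> *\<^sub>R K0) ** C)"
    proof -
      have "C ** A ** E = B \<longleftrightarrow> A = E ** B ** C" for B
      proof
        assume "A = E ** B ** C"
        then show "C ** A ** E = B" by (simp add: matrix_mul_assoc[symmetric] inverse_mult CD)
      qed (use A in metis)
      then show ?thesis by simp
    qed
    finally show "A \<in> self_dual m j \<longleftrightarrow>
        (\<exists>\<alpha> \<beta> \<gamma>. A = \<alpha> *\<^sub>R j + \<beta> *\<^sub>R (E ** I0 ** C) + \<gamma> *\<^sub>R (E ** K0 ** C))"
      by (simp add: j_conj mat_algebra)
    assume sk: "skew_wrt m A" and anti: "A ** j = - (j ** A)"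
    let ?B = "C ** A ** E"
    have "skew_wrt (mat 1) ?B"
      using sk unfolding skew_wrt_def
      by (simp add: iso[symmetric] mat_algebra inverse_apply)
    moreover have "?B ** J0 = - (J0 ** ?B)"
    proof -
      have "C ** (A ** j) ** E = - (C ** (j ** A) ** E)" by (simp add: anti mat_algebra)
      then show ?thesis by (simp add: j_conj matrix_mul_assoc[symmetric] inverse_mult CD)
    qed
    ultimately have "?B = (?B $ 3 $ 1) *\<^sub>R I0 + (?B $ 4 $ 1) *\<^sub>R K0"
      by (rule anticommuting_std)
    then obtain b c where "?B = b *\<^sub>R I0 + c *\<^sub>R K0" by blast
    then have "A = b *\<^sub>R (E ** I0 ** C) + c *\<^sub>R (E ** K0 ** C)"
      by (subst A) (simp add: mat_algebra)
    then show "\<exists>\<beta> \<gamma>. A = \<beta> *\<^sub>R (E ** I0 ** C) + \<gamma> *\<^sub>R (E ** K0 ** C)" by blast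
  qed
qed

end

lemma trace_linear:
  fixes A B :: "real^4^4"
  shows "trace (A + B) = trace A + trace B" "trace (A - B) = trace A - trace B"
    "trace (- A) = - trace A" "trace (c *\<^sub>R A) = c * trace A" "trace (0 :: real^4^4) = 0"
    "trace (mat 1 :: real^4^4) = 4"
  by (simp_all add: trace_def sum.distrib sum_subtractf sum_negf sum_distrib_left mat_def)

context quaternionic
begin

lemma coefficients_zero:
  assumes "\<alpha> *\<^sub>R j + \<beta> *\<^sub>R I + \<gamma> *\<^sub>R K = 0"
  shows "\<alpha> = 0" "\<beta> = 0" "\<gamma> = 0"
proof -
  have "trace (X ** (\<alpha> *\<^sub>R j + \<beta> *\<^sub>R I + \<gamma> *\<^sub>R K)) = 0" for X
    by (simp add: assms mm.zero_right trace_linear)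
  from this[of j] this[of I] this[of K] show "\<alpha> = 0" "\<beta> = 0" "\<gamma> = 0"
    by (simp_all add: mat_algebra products trace_linear traces)
qed

lemma self_dual_span: "self_dual m j = span {j, I, K}"
proof -
  have "A \<in> span {j, I, K} \<longleftrightarrow> (\<exists>\<alpha> \<beta> \<gamma>. A = \<alpha> *\<^sub>R j + \<beta> *\<^sub>R I + \<gamma> *\<^sub>R K)" for A
    by (simp add: span_insert span_singleton algebra_simps)
  then show ?thesis using self_dual_iff by blast
qed

lemma distinct_basis: "j \<noteq> I" "j \<noteq> K" "I \<noteq> K"
  using coefficients_zero[of 1 "-1" 0] coefficients_zero[of 1 0 "-1"] coefficients_zero[of 0 1 "-1"] by auto

lemma independent_basis: "independent {j, I, K}"
proof
  assume "dependent {j, I, K}"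
  then obtain c where c: "\<exists>v\<in>{j, I, K}. c v \<noteq> 0" "(\<Sum>v\<in>{j, I, K}. c v *\<^sub>R v) = 0"
    using dependent_finite[of "{j, I, K}"] by auto
  from c(2) have "c j *\<^sub>R j + c I *\<^sub>R I + c K *\<^sub>R K = 0"
    using distinct_basis by (simp add: add.assoc)
  from coefficients_zero[OF this] c(1) show False by auto
qed

lemma trace_on_self_dual:
  assumes F: "linear F"
    and "F j = a1 *\<^sub>R j + a2 *\<^sub>R I + a3 *\<^sub>R K"
    and "F I = b1 *\<^sub>R j + b2 *\<^sub>R I + b3 *\<^sub>R K"
    and "F K = c1 *\<^sub>R j + c2 *\<^sub>R I + c3 *\<^sub>R K"
  shows "trace_on (self_dual m j) F = a1 + b2 + c3"
proof -
  let ?B = "{j, I, K}"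
  have sp: "p *\<^sub>R j + q *\<^sub>R I + s *\<^sub>R K \<in> span ?B" for p q s
    by (intro span_add span_scale span_base) auto
  have "F ` self_dual m j \<subseteq> self_dual m j"
  proof
    fix X assume "X \<in> F ` self_dual m j"
    then obtain Y where "Y \<in> self_dual m j" "X = F Y" by blast
    then obtain p q s where "X = F (p *\<^sub>R j + q *\<^sub>R I + s *\<^sub>R K)" using self_dual_iff by metis
    then have "X = p *\<^sub>R F j + q *\<^sub>R F I + s *\<^sub>R F K"
      by (simp add: linear_add[OF F] linear_scale[OF F])
    then show "X \<in> self_dual m j"
      unfolding self_dual_span assms(2-4) by (simp only:) (intro span_add span_scale span_base; simp)
  qed
  then have "trace_on (self_dual m j) F = (\<Sum>c\<in>?B. representation ?B (F c) c)"
    by (intro trace_on_eq independent_basis F) (simp_all add: self_dual_span)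
  moreover have rep: "representation ?B (p *\<^sub>R j + q *\<^sub>R I + s *\<^sub>R K) = (\<lambda>v. p * (if v = j then 1 else 0) + q * (if v = I then 1 else 0) + s * (if v = K then 1 else 0))" for p q s
  proof -
    have b: "b \<in> span ?B" if "b \<in> ?B" for b using that by (rule span_base)
    show ?thesis
      by (simp add: representation_add[OF independent_basis] representation_scale[OF independent_basis]
          b span_add span_scale representation_basis[OF independent_basis])
  qed
  ultimately show ?thesis
    using distinct_basis by (simp add: assms(2-4))
qed

text \<open>Self-duality without the Hodge operator: a skew endomorphism is self-dual once its anticommutator with \<open>j\<close> is
  scalar, since adding a multiple of \<open>j\<close> then makes it anticommute with \<open>j\<close>. This is a condition that
  can be differentiated.\<close>

lemma self_dualI:
  assumes "skew_wrt m A" "A ** j + j ** A = c *\<^sub>R mat 1"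
    and "skew_wrt m j"
  shows "A \<in> self_dual m j"
proof -
  let ?A = "A + (c / 2) *\<^sub>R j"
  have "skew_wrt m ?A"
    using assms(1,3) by (simp add: skew_wrt_def gip_linear mat_algebra)
  moreover have "?A ** j = - (j ** ?A)"
  proof -
    have "A ** j = c *\<^sub>R mat 1 - j ** A" using assms(2) by (simp add: eq_diff_eq)
    moreover have "c *\<^sub>R mat 1 = (c / 2) *\<^sub>R (mat 1 :: real^4^4) + (c / 2) *\<^sub>R mat 1"
      by (simp add: scaleR_add_left[symmetric])
    ultimately show ?thesis by (simp add: mm.add_left mm.add_right mm.scaleR_left mm.scaleR_right products)
  qed
  ultimately obtain \<beta> \<gamma> where "?A = \<beta> *\<^sub>R I + \<gamma> *\<^sub>R K" using anticommuting by blast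
  then have "A = (- c / 2) *\<^sub>R j + \<beta> *\<^sub>R I + \<gamma> *\<^sub>R K"
    by (simp add: algebra_simps)
  then show ?thesis using self_dual_iff by blast
qed

end

text \<open>The operator \<open>(3a/2) (j \<otimes> j - id/3)\<close>, where \<open>- tr(j A)/4\<close> is the scalar product of \<open>j\<close> and \<open>A\<close>. On self-dual
  endomorphisms it has the eigenvalues \<open>a\<close>, \<open>-a/2\<close>, \<open>-a/2\<close>.\<close>

definition model_op :: "real \<Rightarrow> real^4^4 \<Rightarrow> real^4^4 \<Rightarrow> real^4^4" where
  "model_op a j A = (3 * a / 2) *\<^sub>R ((- trace (j ** A) / 4) *\<^sub>R j - (1/3) *\<^sub>R A)"

lemma (in quaternionic) model_op_basis:
  "model_op t j (\<alpha> *\<^sub>R j + \<beta> *\<^sub>R I + \<gamma> *\<^sub>R K) = (t * \<alpha>) *\<^sub>R j - (t / 2 * \<beta>) *\<^sub>R I - (t / 2 * \<gamma>) *\<^sub>R K"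
proof -
  have "- trace (j ** (\<alpha> *\<^sub>R j + \<beta> *\<^sub>R I + \<gamma> *\<^sub>R K)) / 4 = \<alpha>"
    by (simp add: mat_algebra products trace_linear traces)
  then show ?thesis
    by (simp add: model_op_def vec_eq_iff field_simps)
qed

context algebraic_curvature
begin

abbreviation "SD \<equiv> self_dual m j"
abbreviation "W \<equiv> weyl_op_of m R"
abbreviation "a \<equiv> (scal_star_of m j R - scal_of m R / 3) / 2"

text \<open>The statement \<open>weyl_op_std\<close>, transported from the standard structure along an adapted frame.\<close>

lemma weyl_op_quaternionic:
  obtains I K b c d e f where "quaternionic m j I K"
    "W j = a *\<^sub>R j + b *\<^sub>R I + c *\<^sub>R K"
    "W I = b *\<^sub>R j + d *\<^sub>R I + e *\<^sub>R K"
    "W K = c *\<^sub>R j + e *\<^sub>R I + f *\<^sub>R K"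
    "a + d + f = 0"
    "(\<forall>u v w. R u v (j *v w) = j *v R u v w) \<longrightarrow> b = 0 \<and> c = 0 \<and> e = 0 \<and> d = f"
proof -
  obtain E C where E: "C ** E = mat 1" "E ** C = mat 1" "transpose E ** m ** E = mat 1" "j ** E = E ** J0"
    by (rule adapted_frame)
  define R0 where "R0 u v w = C *v R (E *v u) (E *v v) (E *v w)" for u v w
  interpret h: hermitian_isometry "mat 1" J0 m j E C by (rule frame_isometry[OF E])
  have R0: "std_curvature R0"
  proof (intro std_curvature.intro algebraic_curvature.intro trilinear_map.intro
      algebraic_curvature_axioms.intro std.hermitian_space_axioms)
    show "linear (\<lambda>u. R0 u v w)" for v w by (simp add: R0_def linear_iff mat_algebra R_linear)
    show "linear (\<lambda>v. R0 u v w)" for u w by (simp add: R0_def linear_iff mat_algebra R_linear)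
    show "linear (R0 u v)" for u v by (simp add: R0_def linear_iff mat_algebra R_linear)
    show "R0 u v w = - R0 v u w" for u v w
      by (simp add: R0_def antisym[of "E *v u"] mat_algebra)
    show "gip (mat 1) (R0 u v w) z = - gip (mat 1) w (R0 u v z)" for u v w z
      by (simp add: h.iso[symmetric] R0_def h.inverse_apply skew_R[of _ _ "E *v w"])
    show "R0 u v w + R0 v w u + R0 w u v = 0" for u v w
      by (simp add: R0_def mv.add_right[symmetric] bianchi mv.zero_right)
  qed
  interpret s: std_curvature R0 by (rule R0)
  interpret ci: curvature_isometry "mat 1" J0 m j E C R0 R
    by unfold_locales (simp add: R0_def h.inverse_apply)
  obtain b c d e f where q:
    "weyl_op_of (mat 1) R0 J0 = ((scal_star_of (mat 1) J0 R0 - scal_of (mat 1) R0 / 3) / 2) *\<^sub>R J0 + b *\<^sub>R I0 + c *\<^sub>R K0"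
    "weyl_op_of (mat 1) R0 I0 = b *\<^sub>R J0 + d *\<^sub>R I0 + e *\<^sub>R K0"
    "weyl_op_of (mat 1) R0 K0 = c *\<^sub>R J0 + e *\<^sub>R I0 + f *\<^sub>R K0"
    "(scal_star_of (mat 1) J0 R0 - scal_of (mat 1) R0 / 3) / 2 + d + f = 0"
    "(\<forall>u v w. R0 u v (J0 *v w) = J0 *v R0 u v w) \<longrightarrow> b = 0 \<and> c = 0 \<and> e = 0 \<and> d = f"
    by (rule s.weyl_op_std)
  have sc: "scal_of (mat 1) R0 = scal_of m R" "scal_star_of (mat 1) J0 R0 = scal_star_of m j R"
    by (simp_all add: ci.scal_conj ci.scal_star_conj)
  have K: "R0 u v (J0 *v w) = J0 *v R0 u v w" if "\<And>u v w. R u v (j *v w) = j *v R u v w" for u v w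
    using that by (simp add: R0_def h.D_intertwines[symmetric]) (simp add: h.j_conj mat_algebra h.inverse_apply)
  show thesis
  proof (rule that)
    show "quaternionic m j (E ** I0 ** C) (E ** K0 ** C)" by (rule frame_quaternionic[OF E])
    show "W j = a *\<^sub>R j + b *\<^sub>R (E ** I0 ** C) + c *\<^sub>R (E ** K0 ** C)"
      by (simp only: h.j_conj ci.weyl_op_conj q(1) sc) (simp add: mat_algebra)
    show "W (E ** I0 ** C) = b *\<^sub>R j + d *\<^sub>R (E ** I0 ** C) + e *\<^sub>R (E ** K0 ** C)"
      by (simp only: h.j_conj ci.weyl_op_conj q(2)) (simp add: mat_algebra)
    show "W (E ** K0 ** C) = c *\<^sub>R j + e *\<^sub>R (E ** I0 ** C) + f *\<^sub>R (E ** K0 ** C)"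
      by (simp only: h.j_conj ci.weyl_op_conj q(3)) (simp add: mat_algebra)
    show "a + d + f = 0" using q(4) sc by simp
    show "(\<forall>u v w. R u v (j *v w) = j *v R u v w) \<longrightarrow> b = 0 \<and> c = 0 \<and> e = 0 \<and> d = f"
      using K q(5) by blast
  qed
qed

lemma linear_weyl_op_squared: "linear (\<lambda>A. W (W A))"
  using linear_compose[OF linear_weyl_op linear_weyl_op] by (simp add: o_def)

text \<open>With the off-diagonal entries \<open>b\<close>, \<open>c\<close>, \<open>e\<close> and the diagonal \<open>a\<close>, \<open>d\<close>, \<open>f\<close> of trace zero, the left side exceeds the right side
  by \<open>2(b\<^sup>2 + c\<^sup>2 + e\<^sup>2) + (d - f)\<^sup>2/2\<close>. Hence equality is the extremal case of an inequality, and it determines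
  the whole self-dual Weyl operator.\<close>

lemma weyl_norm_iff:
  "trace_on SD (\<lambda>A. W (W A)) = 3/8 * (scal_star_of m j R - scal_of m R / 3)\<^sup>2
     \<longleftrightarrow> (\<forall>A\<in>SD. W A = model_op a j A)"
proof -
  \<comment> \<open>An opaque name keeps simplification from expanding the coefficient.\<close>
  define t where "t = a"
  obtain I K b c d e f where q: "quaternionic m j I K" and
    W: "W j = t *\<^sub>R j + b *\<^sub>R I + c *\<^sub>R K" "W I = b *\<^sub>R j + d *\<^sub>R I + e *\<^sub>R K"
    "W K = c *\<^sub>R j + e *\<^sub>R I + f *\<^sub>R K" and tr: "t + d + f = 0"
    unfolding t_def by (rule weyl_op_quaternionic)
  interpret quaternionic m j I K by (rule q)
  note Wl = linear_add[OF linear_weyl_op] linear_scale[OF linear_weyl_op]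
  have "trace_on SD (\<lambda>A. W (W A)) = (t * t + b * b + c * c) + (b * b + d * d + e * e) + (c * c + e * e + f * f)"
    by (rule trace_on_self_dual[OF linear_weyl_op_squared, where ?a2.0 = "t * b + b * d + c * e" and ?a3.0 = "t * c + b * e + c * f"
        and ?b1.0 = "t * b + b * d + c * e" and ?b3.0 = "b * c + d * e + e * f"
        and ?c1.0 = "t * c + b * e + c * f" and ?c2.0 = "b * c + d * e + e * f"])
       (simp_all only: Wl W, simp_all add: algebra_simps)
  moreover have "3/8 * (scal_star_of m j R - scal_of m R / 3)\<^sup>2 = 3/2 * t\<^sup>2"
    by (simp add: t_def power2_eq_square field_simps)
  moreover have "t = - d - f" using tr by linarith
  then have "(t * t + b * b + c * c) + (b * b + d * d + e * e) + (c * c + e * e + f * f) - 3/2 * t\<^sup>2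
      = 2 * (b\<^sup>2 + c\<^sup>2 + e\<^sup>2) + (d - f)\<^sup>2 / 2"
    by (simp only: power2_eq_square) (simp add: field_simps)
  ultimately have "trace_on SD (\<lambda>A. W (W A)) = 3/8 * (scal_star_of m j R - scal_of m R / 3)\<^sup>2
      \<longleftrightarrow> 2 * (b\<^sup>2 + c\<^sup>2 + e\<^sup>2) + (d - f)\<^sup>2 / 2 = 0"
    by linarith
  also have "\<dots> \<longleftrightarrow> b = 0 \<and> c = 0 \<and> e = 0 \<and> d = f"
  proof
    assume "2 * (b\<^sup>2 + c\<^sup>2 + e\<^sup>2) + (d - f)\<^sup>2 / 2 = 0"
    moreover note zero_le_power2[of b] zero_le_power2[of c] zero_le_power2[of e] zero_le_power2[of "d - f"]
    ultimately have "b\<^sup>2 \<le> 0" and "c\<^sup>2 \<le> 0" and "e\<^sup>2 \<le> 0" and "(d - f)\<^sup>2 \<le> 0"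
      by argo+
    then show "b = 0 \<and> c = 0 \<and> e = 0 \<and> d = f" by simp
  qed simp
  also have "\<dots> \<longleftrightarrow> (\<forall>A\<in>SD. W A = model_op t j A)"
  proof
    assume *: "b = 0 \<and> c = 0 \<and> e = 0 \<and> d = f"
    then have "d = - (t / 2)" "f = - (t / 2)" using tr by auto
    then show "\<forall>A\<in>SD. W A = model_op t j A"
      using * by (auto simp: self_dual_iff model_op_basis Wl W mult.commute)
  next
    assume *: "\<forall>A\<in>SD. W A = model_op t j A"
    have "j \<in> SD" "I \<in> SD" "K \<in> SD" unfolding self_dual_span by (auto intro: span_base)
    with * have "W j = model_op t j (1 *\<^sub>R j + 0 *\<^sub>R I + 0 *\<^sub>R K)" "W I = model_op t j (0 *\<^sub>R j + 1 *\<^sub>R I + 0 *\<^sub>R K)"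
      "W K = model_op t j (0 *\<^sub>R j + 0 *\<^sub>R I + 1 *\<^sub>R K)" by simp_all
    then have "0 *\<^sub>R j + b *\<^sub>R I + c *\<^sub>R K = 0" "b *\<^sub>R j + (d + t / 2) *\<^sub>R I + e *\<^sub>R K = 0"
      "c *\<^sub>R j + e *\<^sub>R I + (f + t / 2) *\<^sub>R K = 0"
      unfolding model_op_basis W by (simp_all add: algebra_simps eq_neg_iff_add_eq_0)
    from coefficients_zero[OF this(1)] coefficients_zero[OF this(2)] coefficients_zero[OF this(3)]
    show "b = 0 \<and> c = 0 \<and> e = 0 \<and> d = f" by simp
  qed
  finally show ?thesis unfolding t_def .
qed

lemma weyl_norm_kaehler:
  assumes "\<And>u v w. R u v (j *v w) = j *v R u v w"
  shows "trace_on SD (\<lambda>A. W (W A)) = 3/8 * (scal_star_of m j R - scal_of m R / 3)\<^sup>2"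
proof -
  define t where "t = a"
  obtain I K b c d e f where q: "quaternionic m j I K" and
    W: "W j = t *\<^sub>R j + b *\<^sub>R I + c *\<^sub>R K" "W I = b *\<^sub>R j + d *\<^sub>R I + e *\<^sub>R K"
    "W K = c *\<^sub>R j + e *\<^sub>R I + f *\<^sub>R K" and tr: "t + d + f = 0" and "b = 0 \<and> c = 0 \<and> e = 0 \<and> d = f"
    unfolding t_def by (rule weyl_op_quaternionic) (use assms in simp)
  then have z: "b = 0" "c = 0" "e = 0" "d = - (t / 2)" "f = - (t / 2)" by auto
  interpret quaternionic m j I K by (rule q)
  have "W A = model_op t j A" if "A \<in> SD" for A
    using that by (auto simp: self_dual_iff model_op_basis linear_add[OF linear_weyl_op]
        linear_scale[OF linear_weyl_op] W z mult.commute)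
  then show ?thesis unfolding weyl_norm_iff t_def by blast
qed

end


lemma (in hermitian_space) ex_quaternionic: "\<exists>I K. quaternionic m j I K"
proof -
  obtain E C where E: "C ** E = mat 1" "E ** C = mat 1" "transpose E ** m ** E = mat 1" "j ** E = E ** J0"
    by (rule adapted_frame)
  then show ?thesis using frame_quaternionic by blast
qed

text \<open>Expresses the coefficient through the Weyl operator, whose smoothness is available.\<close>

lemma (in algebraic_curvature) weyl_op_J: "a = - trace (j ** W j) / 4"
proof -
  define t where "t = a"
  obtain I K b c d e f where q: "quaternionic m j I K"
    and W: "W j = t *\<^sub>R j + b *\<^sub>R I + c *\<^sub>R K" and "W I = b *\<^sub>R j + d *\<^sub>R I + e *\<^sub>R K"
    "W K = c *\<^sub>R j + e *\<^sub>R I + f *\<^sub>R K" and tr: "t + d + f = 0"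
    unfolding t_def by (rule weyl_op_quaternionic)
  interpret quaternionic m j I K by (rule q)
  have "t = - trace (j ** W j) / 4"
    by (simp add: W mat_algebra products trace_linear traces)
  then show ?thesis by (simp only: t_def)
qed

section \<open>Covariant derivatives of endomorphism fields\<close>

text \<open>The covariant derivative of an endomorphism field as a total matrix expression. It is a derivation for the
  matrix product.\<close>

definition cov :: "(real^4 \<Rightarrow> real^4^4) \<Rightarrow> real^4 \<Rightarrow> (real^4 \<Rightarrow> real^4^4) \<Rightarrow> real^4 \<Rightarrow> real^4^4" where
  "cov G u A x = pd A u x + conn G u x ** A x - A x ** conn G u x"

lemma cov_mult:
  assumes "A differentiable (at x)" "B differentiable (at x)"
  shows "cov G u (\<lambda>y. A y ** B y) x = cov G u A x ** B x + A x ** cov G u B x"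
  by (simp add: cov_def pd_matrix_mult assms mat_algebra)

lemma cov_add:
  assumes "A differentiable (at x)" "B differentiable (at x)"
  shows "cov G u (\<lambda>y. A y + B y) x = cov G u A x + cov G u B x"
  by (simp add: cov_def pd_add assms mat_algebra)

lemma cov_diff:
  assumes "A differentiable (at x)" "B differentiable (at x)"
  shows "cov G u (\<lambda>y. A y - B y) x = cov G u A x - cov G u B x"
  by (simp add: cov_def pd_diff assms mat_algebra)

lemma pd_scale:
  fixes A :: "'a::real_normed_vector \<Rightarrow> 'b::real_normed_vector"
  assumes "f differentiable (at x)" "A differentiable (at x)"
  shows "pd (\<lambda>y. f y *\<^sub>R A y) u x = pd f u x *\<^sub>R A x + f x *\<^sub>R pd A u x"
proof -
  have "pd (\<lambda>y. f y *\<^sub>R A y) u x = f x *\<^sub>R pd A u x + pd f u x *\<^sub>R A x"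
    by (rule pd_eqI[OF has_derivative_scaleR]) (use assms frechet_derivative_works in auto)
  then show ?thesis by simp
qed

lemma cov_scale:
  assumes "f differentiable (at x)" "A differentiable (at x)"
  shows "cov G u (\<lambda>y. f y *\<^sub>R A y) x = pd f u x *\<^sub>R A x + f x *\<^sub>R cov G u A x"
  by (simp add: cov_def pd_scale assms mat_algebra)

lemma cov_scale_const:
  assumes "A differentiable (at x)"
  shows "cov G u (\<lambda>y. r *\<^sub>R A y) x = r *\<^sub>R cov G u A x"
  using cov_scale[of "\<lambda>_. r" x A G u] assms by simp

lemma cov_minus_id: "cov G u (\<lambda>_. - mat 1) x = 0"
  by (simp add: cov_def mat_algebra)

lemma bounded_linear_trace: "bounded_linear (trace :: real^4^4 \<Rightarrow> real)"
  by (rule linear_conv_bounded_linear[THEN iffD1]) (simp add: linear_iff trace_linear)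

lemma pd_trace:
  fixes A :: "real^4 \<Rightarrow> real^4^4"
  assumes "A differentiable (at x)"
  shows "pd (\<lambda>y. trace (A y)) u x = trace (cov G u A x)"
proof -
  have "pd (\<lambda>y. trace (A y)) u x = trace (pd A u x)"
    using bounded_linear.has_derivative[OF bounded_linear_trace frechet_derivative_works[THEN iffD1, OF assms]]
    by (rule pd_eqI)
  then show ?thesis
    by (simp add: cov_def trace_linear trace_mul_sym[of "conn G u x"])
qed

context metric_patch
begin

lemma cov_cong:
  assumes "x \<in> S" "\<And>y. y \<in> S \<Longrightarrow> A y = B y" "A differentiable (at x)"
  shows "cov G u A x = cov G u B x"
  using pd_cong[OF open_S assms(1,2,3)] assms(2)[OF assms(1)] by (simp add: cov_def)

lemma nabla_end_cov: "x \<in> S \<Longrightarrow> A differentiable (at x) \<Longrightarrow> nabla_end G (\<lambda>_. u) A x = cov G u A x"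
  by (simp add: nabla_end_matrix cov_def)

lemma linear_cov:
  assumes "x \<in> S" "A differentiable (at x)"
  shows "linear (\<lambda>u. cov G u A x)"
  using linear_frechet_derivative[OF assms(2)]
  by (simp add: linear_iff cov_def conn_add conn_scale assms(1) mat_algebra)

text \<open>Skew-symmetry is preserved because the metric is parallel.\<close>

lemma cov_skew:
  assumes x: "x \<in> S" and A: "A differentiable (at x)" and sk: "\<And>y. y \<in> S \<Longrightarrow> skew_wrt (G y) (A y)"
  shows "skew_wrt (G x) (cov G u A x)"
proof -
  have dG: "G differentiable (at x)" by (rule smooth_onD(1)[OF smooth_G x])
  have dT: "(\<lambda>y. transpose (A y)) differentiable (at x)"
    using bounded_linear.has_derivative[OF bounded_linear_transpose frechet_derivative_works[THEN iffD1, OF A]]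
    by (rule differentiableI)
  have d: "(\<lambda>y. transpose (A y) ** G y) differentiable (at x)" "(\<lambda>y. G y ** A y) differentiable (at x)"
    using mm.FDERIV[OF frechet_derivative_works[THEN iffD1, OF dT] frechet_derivative_works[THEN iffD1, OF dG]]
      mm.FDERIV[OF frechet_derivative_works[THEN iffD1, OF dG] frechet_derivative_works[THEN iffD1, OF A]]
    by (blast intro: differentiableI)+
  have "pd (\<lambda>y. transpose (A y) ** G y + G y ** A y) u x = pd (\<lambda>_. 0) u x"
    by (rule pd_cong[OF open_S x]) (use sk d in \<open>auto simp: skew_wrt_iff intro: differentiable_add\<close>)
  then have "transpose (A x) ** pd G u x + transpose (pd A u x) ** G x + (G x ** pd A u x + pd G u x ** A x) = 0"
    by (simp add: pd_add d pd_matrix_mult pd_transpose dG A dT)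
  moreover have "transpose (A x) ** G x = - (G x ** A x)"
    using sk[OF x] by (simp add: skew_wrt_iff eq_neg_iff_add_eq_0)
  then have "transpose (A x) ** (G x ** B) = - (G x ** (A x ** B))" for B :: "real^4^4"
    by (simp add: matrix_mul_assoc mm.minus_left)
  ultimately show ?thesis
    using \<open>transpose (A x) ** G x = - (G x ** A x)\<close>
    by (simp add: skew_wrt_iff cov_def metric_connection[OF x] mat_algebra algebra_simps)
qed

lemma trilinear_curvature:
  assumes "x \<in> S"
  shows "trilinear_map (curvature G x)"
proof (rule trilinear_map.intro)
  show 1: "linear (\<lambda>u. curvature G x u v w)" for v w
    by (simp add: linear_iff curvature_matrix curv_mat_add_left curv_mat_scale_left assms mat_algebra)
  show "linear (\<lambda>v. curvature G x u v w)" for u w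
    using 1[of u w] by (simp add: curvature_antisym[of x u] linear_iff)
  show "linear (curvature G x u v)" for u v
    by (simp add: linear_iff curvature_matrix assms mat_algebra)
qed

lemma linear_weyl_op: "x \<in> S \<Longrightarrow> linear (weyl_op G x)"
  by (simp add: curvature_quantities_of trilinear_map.linear_weyl_op[OF trilinear_curvature])

lemma weyl_op_expand:
  assumes "x \<in> S"
  shows "weyl_op G x A = (\<Sum>i\<in>UNIV. \<Sum>k\<in>UNIV. A $ i $ k *\<^sub>R weyl_op G x (axis i (axis k 1)))"
proof -
  have "A = (\<Sum>i\<in>UNIV. \<Sum>k\<in>UNIV. A $ i $ k *\<^sub>R axis i (axis k 1))"
    by (simp add: mat4_eq_iff forall_4 sum_4 axis_def)
  then have "weyl_op G x A = weyl_op G x (\<Sum>i\<in>UNIV. \<Sum>k\<in>UNIV. A $ i $ k *\<^sub>R axis i (axis k 1))"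
    by simp
  then show ?thesis
    by (simp add: linear_sum[OF linear_weyl_op[OF assms]] linear_scale[OF linear_weyl_op[OF assms]])
qed

lemma smooth_weyl_field:
  assumes "smooth_on S B"
  shows "smooth_on S (\<lambda>y. weyl_op G y (B y))"
proof (rule smooth_on_cong[OF open_S])
  show "smooth_on S (\<lambda>y. \<Sum>i\<in>UNIV. \<Sum>k\<in>UNIV. B y $ i $ k *\<^sub>R weyl_op G y (axis i (axis k 1)))"
    by (intro smooth_rules smooth_weyl_op assms) auto
qed (simp add: weyl_op_expand)

text \<open>The Leibniz rule for the evaluation of the Weyl operator on a field, by expansion in matrix units.\<close>

lemma pd_weyl_field:
  assumes x: "x \<in> S" and B: "smooth_on S B"
  shows "pd (\<lambda>y. weyl_op G y (B y)) u x = pd (\<lambda>y. weyl_op G y (B x)) u x + weyl_op G x (pd B u x)"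
proof -
  let ?V = "\<lambda>i k y. weyl_op G y (axis i (axis k 1))"
  have V: "?V i k differentiable (at x)" for i k by (rule smooth_onD(1)[OF smooth_weyl_op x])
  have *: "pd (\<lambda>y. weyl_op G y (B y)) u x
      = (\<Sum>i\<in>UNIV. \<Sum>k\<in>UNIV. B x $ i $ k *\<^sub>R pd (?V i k) u x + pd B u x $ i $ k *\<^sub>R ?V i k x)"
    if B: "smooth_on S B" for B
  proof -
    have "pd (\<lambda>y. weyl_op G y (B y)) u x = pd (\<lambda>y. \<Sum>i\<in>UNIV. \<Sum>k\<in>UNIV. B y $ i $ k *\<^sub>R ?V i k y) u x"
      by (rule pd_cong[OF open_S x]) (auto simp: weyl_op_expand[symmetric] smooth_onD(1)[OF smooth_weyl_field[OF B] x])
    also have "((\<lambda>y. B y $ i $ k) has_derivative (\<lambda>u. pd B u x $ i $ k)) (at x)" for i k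
      using bounded_linear.has_derivative[OF bounded_linear_compose[OF bounded_linear_vec_nth bounded_linear_vec_nth]
          smooth_onD(2)[OF B x]] .
    then have "((\<lambda>y. \<Sum>i\<in>UNIV. \<Sum>k\<in>UNIV. B y $ i $ k *\<^sub>R ?V i k y) has_derivative
        (\<lambda>u. \<Sum>i\<in>UNIV. \<Sum>k\<in>UNIV. B x $ i $ k *\<^sub>R pd (?V i k) u x + pd B u x $ i $ k *\<^sub>R ?V i k x)) (at x)"
      by (intro has_derivative_sum has_derivative_scaleR frechet_derivative_works[THEN iffD1] V)
    then have "pd (\<lambda>y. \<Sum>i\<in>UNIV. \<Sum>k\<in>UNIV. B y $ i $ k *\<^sub>R ?V i k y) u x
        = (\<Sum>i\<in>UNIV. \<Sum>k\<in>UNIV. B x $ i $ k *\<^sub>R pd (?V i k) u x + pd B u x $ i $ k *\<^sub>R ?V i k x)"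
      by (rule pd_eqI)
    finally show ?thesis .
  qed
  from *[OF B] *[OF smooth_on_const[OF open_S, of "B x"]] show ?thesis
    by (simp add: weyl_op_expand[OF x, of "pd B u x"] sum.distrib)
qed

text \<open>The covariant derivative of the Weyl operator, defined with constant endomorphism fields, may be computed with
  any extension \<open>B\<close> of an endomorphism, in particular with a self-dual one.\<close>

lemma nabla_weyl_field:
  assumes x: "x \<in> S" and B: "smooth_on S B"
  shows "nabla_weyl_op G x u (B x) = cov G u (\<lambda>y. weyl_op G y (B y)) x - weyl_op G x (cov G u B x)"
proof -
  note l = linear_add[OF linear_weyl_op[OF x]] linear_diff[OF linear_weyl_op[OF x]]
  have "nabla_weyl_op G x u (B x)
      = cov G u (\<lambda>y. weyl_op G y (B x)) x - weyl_op G x (cov G u (\<lambda>_. B x) x)"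
    by (simp add: nabla_weyl_op_def nabla_end_cov x smooth_onD(1)[OF smooth_weyl_op x])
  then show ?thesis
    by (simp add: cov_def pd_weyl_field[OF x B] l)
qed

lemma linear_nabla_weyl_op:
  assumes x: "x \<in> S"
  shows "linear (nabla_weyl_op G x u)"
proof -
  note l = linear_add[OF linear_weyl_op[OF x]] linear_diff[OF linear_weyl_op[OF x]] linear_scale[OF linear_weyl_op[OF x]]
  have n: "nabla_weyl_op G x u A = cov G u (\<lambda>y. weyl_op G y A) x - weyl_op G x (conn G u x ** A - A ** conn G u x)" for A
    using nabla_weyl_field[OF x smooth_on_const[OF open_S, of A], of u] by (simp add: cov_def)
  have d: "(\<lambda>y. weyl_op G y A) differentiable (at x)" for A by (rule smooth_onD(1)[OF smooth_weyl_op x])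
  have 1: "cov G u (\<lambda>y. weyl_op G y (A + B)) x = cov G u (\<lambda>y. weyl_op G y A) x + cov G u (\<lambda>y. weyl_op G y B) x" for A B
    unfolding cov_add[OF d d, symmetric]
    by (rule cov_cong[OF x]) (auto simp: linear_add[OF linear_weyl_op] d)
  have 2: "cov G u (\<lambda>y. weyl_op G y (r *\<^sub>R A)) x = r *\<^sub>R cov G u (\<lambda>y. weyl_op G y A) x" for r A
    unfolding cov_scale_const[OF d, symmetric]
    by (rule cov_cong[OF x]) (auto simp: linear_scale[OF linear_weyl_op] d)
  show ?thesis
    by (simp add: linear_iff n 1 2 l mat_algebra algebra_simps)
qed

end

section \<open>The derivative of the self-dual Weyl tensor\<close>

locale hermitian_patch = metric_patch S G for S G +
  fixes J :: "real^4 \<Rightarrow> real^4^4"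
  assumes smooth_J: "smooth_on S J" and JJ: "x \<in> S \<Longrightarrow> J x ** J x = - mat 1"
    and skew_J: "x \<in> S \<Longrightarrow> gip (G x) (J x *v u) v = - gip (G x) u (J x *v v)"
begin

lemma hermitian: "x \<in> S \<Longrightarrow> hermitian_space (G x) (J x)"
  by (intro hermitian_space.intro sym_G pos_G JJ skew_J)

lemma algebraic_curvature: "x \<in> S \<Longrightarrow> algebraic_curvature (G x) (J x) (curvature G x)"
  by (intro algebraic_curvature.intro algebraic_curvature_axioms.intro hermitian trilinear_curvature
      curvature_antisym curvature_skew first_bianchi)

definition weyl_coeff :: "real^4 \<Rightarrow> real" where "weyl_coeff x = (scal_star G J x - scal G x / 3) / 2"

lemma diff_J: "x \<in> S \<Longrightarrow> J differentiable (at x)"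
  by (rule smooth_onD(1)[OF smooth_J])

lemma skew_wrt_J: "x \<in> S \<Longrightarrow> skew_wrt (G x) (J x)"
  using skew_J by (simp add: skew_wrt_def)

lemma weyl_coeff_eq: "x \<in> S \<Longrightarrow> weyl_coeff x = - trace (J x ** weyl_op G x (J x)) / 4"
proof -
  assume x: "x \<in> S"
  interpret ac: algebraic_curvature "G x" "J x" "curvature G x" by (rule algebraic_curvature[OF x])
  show ?thesis
    unfolding weyl_coeff_def curvature_quantities_of by (rule ac.weyl_op_J)
qed

lemma smooth_trace:
  fixes A :: "real^4 \<Rightarrow> real^4^4"
  shows "smooth_on S A \<Longrightarrow> smooth_on S (\<lambda>y. trace (A y))"
  by (rule smooth_on_linear[OF bounded_linear_trace open_S])

lemma smooth_weyl_coeff: "smooth_on S weyl_coeff"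
proof (rule smooth_on_cong[OF open_S])
  show "smooth_on S (\<lambda>y. (- 1 / 4) * trace (J y ** weyl_op G y (J y)))"
    by (intro smooth_rules smooth_trace smooth_weyl_field smooth_J)
qed (simp add: weyl_coeff_eq)

lemma diff_weyl_coeff: "x \<in> S \<Longrightarrow> weyl_coeff differentiable (at x)"
  by (rule smooth_onD(1)[OF smooth_weyl_coeff])

text \<open>The derivative of \<open>J\<^sup>2 = -1\<close>. Together with skew-symmetry it says that \<open>\<nabla>J\<close> takes values in the span of \<open>I\<close> and \<open>K\<close>, the
  orthogonal complement of \<open>J\<close> in the self-dual endomorphisms.\<close>

lemma cov_J_anticommutes: "x \<in> S \<Longrightarrow> cov G u J x ** J x = - (J x ** cov G u J x)"
proof -
  assume x: "x \<in> S"
  have "cov G u (\<lambda>y. J y ** J y) x = cov G u (\<lambda>_. - mat 1) x"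
    by (rule cov_cong[OF x]) (auto simp: JJ intro!: smooth_onD(1)[OF _ x] smooth_rules smooth_J)
  then show ?thesis
    by (simp add: cov_mult[OF diff_J[OF x] diff_J[OF x]] cov_minus_id eq_neg_iff_add_eq_0)
qed

lemma cov_J_skew: "x \<in> S \<Longrightarrow> skew_wrt (G x) (cov G u J x)"
  by (intro cov_skew diff_J skew_wrt_J)

definition weyl_model :: bool where
  "weyl_model \<longleftrightarrow> (\<forall>x\<in>S. \<forall>A\<in>self_dual (G x) (J x). weyl_op G x A = model_op (weyl_coeff x) (J x) A)"

text \<open>The derivative of \<open>(3a/2) (J \<otimes> J - id/3)\<close> applied to the self-dual endomorphism \<open>B x\<close>. The terms with the derivative of
  \<open>B\<close> cancel, for which that derivative has to be self-dual, too.\<close>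

lemma nabla_weyl_self_dual:
  assumes model: weyl_model and x: "x \<in> S" and B: "smooth_on S B"
    and sd: "\<And>y. y \<in> S \<Longrightarrow> B y \<in> self_dual (G y) (J y)" "cov G u B x \<in> self_dual (G x) (J x)"
  defines "N \<equiv> cov G u J x" and "\<phi> \<equiv> - trace (J x ** B x) / 4"
  shows "nabla_weyl_op G x u (B x) = (3 * pd weyl_coeff u x / 2) *\<^sub>R (\<phi> *\<^sub>R J x - (1/3) *\<^sub>R B x)
    + (3 * weyl_coeff x / 2) *\<^sub>R ((- trace (N ** B x) / 4) *\<^sub>R J x + \<phi> *\<^sub>R N)"
proof -
  let ?f = "\<lambda>y. (- 1 / 4) * trace (J y ** B y)"
  let ?F = "\<lambda>y. ?f y *\<^sub>R J y - (1/3) *\<^sub>R B y"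
  have sm: "smooth_on S ?f" "smooth_on S (\<lambda>y. ?f y *\<^sub>R J y)" "smooth_on S (\<lambda>y. (1/3) *\<^sub>R B y)" "smooth_on S ?F"
    "smooth_on S (\<lambda>y. (3 / 2) * weyl_coeff y)" "smooth_on S (\<lambda>y. trace (J y ** B y))" "smooth_on S (\<lambda>y. J y ** B y)"
    by (intro smooth_rules smooth_trace smooth_J B smooth_weyl_coeff)+
  note d = sm[THEN smooth_onD(1), OF x]
  have dB: "B differentiable (at x)" by (rule smooth_onD(1)[OF B x])
  have "cov G u (\<lambda>y. weyl_op G y (B y)) x = cov G u (\<lambda>y. ((3 / 2) * weyl_coeff y) *\<^sub>R ?F y) x"
    using model sd(1)
    by (intro cov_cong[OF x] smooth_onD(1)[OF smooth_weyl_field[OF B] x])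
       (simp add: weyl_model_def model_op_def)
  also have "\<dots> = (pd (\<lambda>y. (3 / 2) * weyl_coeff y) u x) *\<^sub>R ?F x + ((3 / 2) * weyl_coeff x) *\<^sub>R cov G u ?F x"
    by (rule cov_scale[OF d(5) d(4)])
  also have "cov G u ?F x = pd ?f u x *\<^sub>R J x + ?f x *\<^sub>R N - (1/3) *\<^sub>R cov G u B x"
    by (simp only: cov_diff[OF d(2) d(3)] cov_scale[OF d(1) diff_J[OF x]] cov_scale_const[OF dB] N_def)
  also have "pd (\<lambda>y. (3 / 2) * weyl_coeff y) u x = 3 / 2 * pd weyl_coeff u x"
    using pd_scale[of "\<lambda>_. 3/2" x weyl_coeff u] diff_weyl_coeff[OF x] by simp
  also have "pd ?f u x = - (1 / 4) * trace (N ** B x + J x ** cov G u B x)"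
    using pd_scale[of "\<lambda>_. - 1/4" x "\<lambda>y. trace (J y ** B y)" u] d(6)
    by (simp add: pd_trace[OF d(7), of u G] cov_mult[OF diff_J[OF x] dB] N_def)
  finally have 1: "cov G u (\<lambda>y. weyl_op G y (B y)) x = (3 / 2 * pd weyl_coeff u x) *\<^sub>R ?F x + ((3 / 2) * weyl_coeff x) *\<^sub>R
    ((- (1 / 4) * trace (N ** B x + J x ** cov G u B x)) *\<^sub>R J x + ?f x *\<^sub>R N - (1/3) *\<^sub>R cov G u B x)" .
  have 2: "weyl_op G x (cov G u B x) = ((3 / 2) * weyl_coeff x) *\<^sub>R ((- (1 / 4) * trace (J x ** cov G u B x)) *\<^sub>R J x - (1/3) *\<^sub>R cov G u B x)"
    using model sd(2) x by (simp add: weyl_model_def model_op_def)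
  show ?thesis
    unfolding nabla_weyl_field[OF x B] 1 2 \<phi>_def
    by (simp add: vec_eq_iff trace_linear field_simps)
qed

text \<open>The orthogonal projection of a constant matrix to the skew endomorphisms that anticommute with \<open>J\<close>. It extends
  such an endomorphism at one point to a smooth self-dual field.\<close>

definition extension :: "real^4^4 \<Rightarrow> real^4 \<Rightarrow> real^4^4" where
  "extension A y = (1/4) *\<^sub>R ((A - matrix_inv (G y) ** transpose A ** G y)
     + J y ** (A - matrix_inv (G y) ** transpose A ** G y) ** J y)"

lemma smooth_extension: "smooth_on S (extension A)"
  unfolding extension_def by (intro smooth_rules smooth_inv_G smooth_G smooth_J)

lemma
  assumes y: "y \<in> S"
  shows extension_skew: "skew_wrt (G y) (extension A y)"
    and extension_anticommutes: "extension A y ** J y + J y ** extension A y = 0"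
proof -
  let ?H = "matrix_inv (G y)"
  note GH = matrix_inv_inverse[OF inv_G[OF y]]
  have GH': "G y ** (?H ** B) = B" for B :: "real^4^4" by (simp add: matrix_mul_assoc GH)
  have HG': "transpose ?H ** G y = mat 1"
    using GH(1) transpose_G[OF y] by (metis matrix_transpose_mul transpose_mat)
  have HG'': "transpose ?H ** (G y ** B) = B" for B :: "real^4^4" by (simp add: matrix_mul_assoc HG')
  have TG: "transpose (G y) = G y" by (rule transpose_G[OF y])
  define Q where "Q = A - ?H ** transpose A ** G y"
  have QG: "transpose Q ** G y = - (G y ** Q)"
    by (simp add: Q_def mat_algebra GH' HG' TG)
  have JG: "transpose (J y) ** G y = - (G y ** J y)"
    using skew_wrt_J[OF y] by (simp add: skew_wrt_iff eq_neg_iff_add_eq_0)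
  have 1: "transpose (J y) ** (G y ** B) = - (G y ** (J y ** B))" for B :: "real^4^4"
    by (simp add: matrix_mul_assoc JG mm.minus_left)
  have "transpose (J y ** Q ** J y) ** G y = transpose (J y) ** (transpose Q ** (transpose (J y) ** G y))"
    by (simp add: matrix_transpose_mul matrix_mul_assoc)
  also have "\<dots> = - (G y ** (J y ** Q ** J y))"
  proof -
    have "transpose Q ** (G y ** J y) = - (G y ** (Q ** J y))"
      unfolding matrix_mul_assoc[of "transpose Q"] by (simp only: QG mm.minus_left matrix_mul_assoc[symmetric])
    then show ?thesis
      by (simp only: JG mm.minus_right mm.minus_left 1 minus_minus matrix_mul_assoc[symmetric])
  qed
  finally have Q2: "transpose (J y ** Q ** J y) ** G y = - (G y ** (J y ** Q ** J y))" .
  show "skew_wrt (G y) (extension A y)"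
    unfolding skew_wrt_iff extension_def Q_def[symmetric]
    by (simp only: transpose_linear mm.scaleR_left mm.scaleR_right mm.add_left mm.add_right QG Q2) (simp add: algebra_simps)
  have JJB: "J y ** (J y ** B) = - B" for B :: "real^4^4"
    by (simp add: matrix_mul_assoc JJ y mm.minus_left)
  show "extension A y ** J y + J y ** extension A y = 0"
    unfolding extension_def Q_def[symmetric]
    by (simp only: mm.scaleR_left mm.scaleR_right mm.add_left mm.add_right matrix_mul_assoc[symmetric] JJ[OF y] JJB mm.minus_right)
       (simp add: scaleR_add_right[symmetric])
qed

lemma extension_self_dual: "y \<in> S \<Longrightarrow> extension A y \<in> self_dual (G y) (J y)"
proof -
  assume y: "y \<in> S"
  interpret ac: algebraic_curvature "G y" "J y" "curvature G y" by (rule algebraic_curvature[OF y])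
  obtain I K where "quaternionic (G y) (J y) I K" using ac.ex_quaternionic by blast
  then show ?thesis
    using quaternionic.self_dualI[of "G y" "J y" I K "extension A y" 0] extension_skew[OF y] extension_anticommutes[OF y] skew_wrt_J[OF y]
    by simp
qed

lemma extension_at:
  assumes x: "x \<in> S" and A: "skew_wrt (G x) A" "A ** J x = - (J x ** A)"
  shows "extension A x = A"
proof -
  have "transpose A ** G x = - (G x ** A)"
    using A(1) by (simp add: skew_wrt_iff eq_neg_iff_add_eq_0)
  then have "matrix_inv (G x) ** transpose A ** G x = - A"
    using matrix_inv_inverse[OF inv_G[OF x]]
    by (metis matrix_mul_assoc matrix_mul_lid mm.minus_right)
  moreover have "J x ** A ** J x = A"
    using A(2) by (simp add: matrix_mul_assoc[symmetric] mm.minus_right)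
      (simp add: matrix_mul_assoc JJ x mm.minus_left)
  ultimately have "extension A x = (1/4) *\<^sub>R ((A + A) + (A + A))"
    by (simp only: extension_def diff_minus_eq_add mm.add_left mm.add_right)
  then show ?thesis
    by (simp add: vec_eq_iff)
qed

text \<open>Differentiating \<open>A J + J A = 0\<close> shows that the anticommutator of \<open>\<nabla>A\<close> with \<open>J\<close> is minus that of \<open>A\<close> with
  \<open>\<nabla>J\<close>. The latter two lie in the span of \<open>I\<close> and \<open>K\<close>, so their anticommutator is scalar. This is the part
  of the parallelism of self-duality that the proof needs.\<close>

lemma cov_extension_self_dual:
  assumes x: "x \<in> S"
  shows "cov G u (extension A) x \<in> self_dual (G x) (J x)"
proof -
  interpret H: hermitian_space "G x" "J x" by (rule hermitian[OF x])
  obtain I K where q: "quaternionic (G x) (J x) I K" using H.ex_quaternionic by blast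
  interpret quaternionic "G x" "J x" I K by (rule q)
  have dP: "extension A differentiable (at x)" by (rule smooth_onD(1)[OF smooth_extension x])
  obtain \<beta> \<gamma> where P: "extension A x = \<beta> *\<^sub>R I + \<gamma> *\<^sub>R K"
    using anticommuting[OF extension_skew[OF x]] extension_anticommutes[OF x] by (metis eq_neg_iff_add_eq_0)
  obtain \<beta>' \<gamma>' where N: "cov G u J x = \<beta>' *\<^sub>R I + \<gamma>' *\<^sub>R K"
    using anticommuting[OF cov_J_skew[OF x] cov_J_anticommutes[OF x]] by blast
  have "cov G u (\<lambda>y. extension A y ** J y + J y ** extension A y) x = cov G u (\<lambda>_. 0) x"
    by (rule cov_cong[OF x]) (auto simp: extension_anticommutes intro!: smooth_onD(1)[OF _ x] smooth_rules smooth_J smooth_extension)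
  moreover have "(\<lambda>y. extension A y ** J y) differentiable (at x)" "(\<lambda>y. J y ** extension A y) differentiable (at x)"
    by (intro smooth_onD(1)[OF _ x] smooth_rules smooth_J smooth_extension)+
  ultimately have "cov G u (extension A) x ** J x + J x ** cov G u (extension A) x
      = - (extension A x ** cov G u J x + cov G u J x ** extension A x)"
    by (simp add: cov_add cov_mult dP diff_J[OF x]) (simp add: cov_def mat_algebra eq_neg_iff_add_eq_0 algebra_simps)
  also have "\<dots> = (2 * (\<beta> * \<beta>' + \<gamma> * \<gamma>')) *\<^sub>R mat 1"
    by (simp add: P N mat_algebra products) (simp add: vec_eq_iff field_simps)
  finally show ?thesis
    by (intro self_dualI cov_skew[OF x dP extension_skew] skew_wrt_J[OF x])
qed

lemma cov_J_components:
  assumes x: "x \<in> S" and q: "quaternionic (G x) (J x) I K"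
  shows "\<exists>\<beta> \<gamma> :: real^4 \<Rightarrow> real. linear \<beta> \<and> linear \<gamma> \<and> (\<forall>u. cov G u J x = \<beta> u *\<^sub>R I + \<gamma> u *\<^sub>R K)"
proof (intro exI conjI allI)
  interpret quaternionic "G x" "J x" I K by (rule q)
  let ?\<beta> = "\<lambda>u. - trace (I ** cov G u J x) / 4" and ?\<gamma> = "\<lambda>u. - trace (K ** cov G u J x) / 4"
  note l = linear_cov[OF x diff_J[OF x]]
  show "linear ?\<beta>" "linear ?\<gamma>"
    by (simp_all add: linear_iff linear_add[OF l] linear_scale[OF l] mat_algebra trace_linear field_simps)
  show "cov G u J x = ?\<beta> u *\<^sub>R I + ?\<gamma> u *\<^sub>R K" for u
  proof -
    obtain \<beta> \<gamma> where N: "cov G u J x = \<beta> *\<^sub>R I + \<gamma> *\<^sub>R K"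
      using anticommuting[OF cov_J_skew[OF x] cov_J_anticommutes[OF x]] by blast
    then show ?thesis
      by (simp add: mat_algebra products trace_linear traces)
  qed
qed

text \<open>In the basis \<open>J\<close>, \<open>I\<close>, \<open>K\<close> the derivative of the Weyl operator is \<open>da\<close> times the diagonal matrix \<open>(1, -1/2, -1/2)\<close>,
  plus \<open>3a/2\<close> times the symmetric matrix whose only entries are the components \<open>\<beta>\<close>, \<open>\<gamma>\<close> of \<open>\<nabla>J\<close> in the
  first row and column. These two parts are orthogonal.\<close>

lemma nabla_weyl_basis:
  assumes model: weyl_model and x: "x \<in> S" and q: "quaternionic (G x) (J x) I K"
    and N: "cov G u J x = \<beta> *\<^sub>R I + \<gamma> *\<^sub>R K"
  defines "p \<equiv> 3 * weyl_coeff x / 2"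
  shows "nabla_weyl_op G x u (J x) = pd weyl_coeff u x *\<^sub>R J x + (p * \<beta>) *\<^sub>R I + (p * \<gamma>) *\<^sub>R K"
    and "nabla_weyl_op G x u I = (p * \<beta>) *\<^sub>R J x - (pd weyl_coeff u x / 2) *\<^sub>R I"
    and "nabla_weyl_op G x u K = (p * \<gamma>) *\<^sub>R J x - (pd weyl_coeff u x / 2) *\<^sub>R K"
proof -
  interpret quaternionic "G x" "J x" I K by (rule q)
  have sd: "\<alpha> *\<^sub>R J x + \<beta> *\<^sub>R I + \<gamma> *\<^sub>R K \<in> self_dual (G x) (J x)" for \<alpha> \<beta> \<gamma>
    using self_dual_iff by blast
  have skew: "skew_wrt (G x) I" "skew_wrt (G x) K"
    using sd[of 0 1 0] sd[of 0 0 1] by (simp_all add: self_dual_def skew_wrt_def)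
  have J_sd: "J y \<in> self_dual (G y) (J y)" if "y \<in> S" for y
  proof -
    interpret H: hermitian_space "G y" "J y" by (rule hermitian[OF that])
    obtain I K where "quaternionic (G y) (J y) I K" using H.ex_quaternionic by blast
    then show ?thesis
      using quaternionic.self_dual_iff[of "G y" "J y" I K "J y"] by (metis add.right_neutral scaleR_one scaleR_zero_left)
  qed
  have "cov G u J x \<in> self_dual (G x) (J x)"
    using sd[of 0 \<beta> \<gamma>] N by simp
  from nabla_weyl_self_dual[OF model x smooth_J J_sd this] N
  show "nabla_weyl_op G x u (J x) = pd weyl_coeff u x *\<^sub>R J x + (p * \<beta>) *\<^sub>R I + (p * \<gamma>) *\<^sub>R K"
    by (simp add: p_def mat_algebra products trace_linear traces) (simp add: vec_eq_iff field_simps)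
  have at_x: "extension I x = I" "extension K x = K"
    by (auto intro!: extension_at[OF x] skew simp: products)
  from nabla_weyl_self_dual[OF model x smooth_extension extension_self_dual cov_extension_self_dual[OF x], of u I] N
  show "nabla_weyl_op G x u I = (p * \<beta>) *\<^sub>R J x - (pd weyl_coeff u x / 2) *\<^sub>R I"
    by (simp add: at_x p_def mat_algebra products trace_linear traces)
  from nabla_weyl_self_dual[OF model x smooth_extension extension_self_dual cov_extension_self_dual[OF x], of u K] N
  show "nabla_weyl_op G x u K = (p * \<gamma>) *\<^sub>R J x - (pd weyl_coeff u x / 2) *\<^sub>R K"
    by (simp add: at_x p_def mat_algebra products trace_linear traces)
qed

lemma nabla_weyl_norm:
  assumes model: weyl_model and x: "x \<in> S" and q: "quaternionic (G x) (J x) I K"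
    and N: "\<And>u. cov G u J x = \<beta> u *\<^sub>R I + \<gamma> u *\<^sub>R K"
  shows "nabla_Wplus_norm2 G J x = contract (G x) (\<lambda>u v. 3/2 * (pd weyl_coeff u x * pd weyl_coeff v x)
    + 9/2 * (weyl_coeff x)\<^sup>2 * (\<beta> u * \<beta> v + \<gamma> u * \<gamma> v))"
proof -
  interpret quaternionic "G x" "J x" I K by (rule q)
  define p where "p = 3 * weyl_coeff x / 2"
  have "trace_on (self_dual (G x) (J x)) (\<lambda>A. nabla_weyl_op G x u (nabla_weyl_op G x v A))
    = 3/2 * (pd weyl_coeff u x * pd weyl_coeff v x) + 9/2 * (weyl_coeff x)\<^sup>2 * (\<beta> u * \<beta> v + \<gamma> u * \<gamma> v)" for u v
  proof -
    define d where "d u = pd weyl_coeff u x" for u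
    note l = linear_nabla_weyl_op[OF x]
    note ll = linear_add[OF l] linear_diff[OF l] linear_scale[OF l]
    note b = nabla_weyl_basis[OF model x q N, folded p_def d_def]
    have "trace_on (self_dual (G x) (J x)) (\<lambda>A. nabla_weyl_op G x u (nabla_weyl_op G x v A))
      = (d v * d u + p * \<beta> v * (p * \<beta> u) + p * \<gamma> v * (p * \<gamma> u))
        + (p * \<beta> v * (p * \<beta> u) + d v * d u / 4) + (p * \<gamma> v * (p * \<gamma> u) + d v * d u / 4)"
    proof (rule trace_on_self_dual)
      show "linear (\<lambda>A. nabla_weyl_op G x u (nabla_weyl_op G x v A))"
        using linear_compose[OF l l] by (simp add: o_def)
      show "nabla_weyl_op G x u (nabla_weyl_op G x v (J x)) = (d v * d u + p * \<beta> v * (p * \<beta> u) + p * \<gamma> v * (p * \<gamma> u)) *\<^sub>R J x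
          + (d v * (p * \<beta> u) - p * \<beta> v * d u / 2) *\<^sub>R I + (d v * (p * \<gamma> u) - p * \<gamma> v * d u / 2) *\<^sub>R K"
        by (simp only: b ll) (simp add: vec_eq_iff field_simps)
      show "nabla_weyl_op G x u (nabla_weyl_op G x v I) = (p * \<beta> v * d u - d v / 2 * (p * \<beta> u)) *\<^sub>R J x
          + (p * \<beta> v * (p * \<beta> u) + d v * d u / 4) *\<^sub>R I + (p * \<beta> v * (p * \<gamma> u)) *\<^sub>R K"
        by (simp only: b ll) (simp add: vec_eq_iff field_simps)
      show "nabla_weyl_op G x u (nabla_weyl_op G x v K) = (p * \<gamma> v * d u - d v / 2 * (p * \<gamma> u)) *\<^sub>R J x
          + (p * \<gamma> v * (p * \<beta> u)) *\<^sub>R I + (p * \<gamma> v * (p * \<gamma> u) + d v * d u / 4) *\<^sub>R K"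
        by (simp only: b ll) (simp add: vec_eq_iff field_simps)
    qed
    then show ?thesis
      by (simp add: p_def d_def power2_eq_square field_simps)
  qed
  then show ?thesis by (simp add: nabla_Wplus_norm2_def)
qed

end

lemma contract_mult: "contract m (\<lambda>u v. c * B u v) = c * contract m B" for c :: real
  by (simp add: contract_def sum_distrib_left mult_ac)

context hermitian_space
begin

lemma ex_orthonormal_frame:
  shows "\<exists>F :: 4 \<Rightarrow> real^4. (\<forall>k n. gip m (F k) (F n) = (if k = n then 1 else 0)) \<and>
    (\<forall>l :: real^4 \<Rightarrow> real. linear l \<longrightarrow> (\<forall>k. l (F k) = 0) \<longrightarrow> (\<forall>u. l u = 0))"
proof -
  obtain E C where E: "C ** E = mat 1" "E ** C = mat 1" "transpose E ** m ** E = mat 1" "j ** E = E ** J0"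
    by (rule adapted_frame)
  let ?F = "\<lambda>k. E *v axis k 1"
  have 1: "gip m (?F k) (?F n) = (if k = n then 1 else 0)" for k n
    by (simp add: gip_congruence[symmetric] E(3) gip_axis) (simp add: mat_def)
  have 2: "l u = 0" if l: "linear l" "\<And>k. l (?F k) = 0" for l :: "real^4 \<Rightarrow> real" and u
  proof -
    have "u = E *v (C *v u)" by (simp add: matrix_vector_mul_assoc E)
    also have "C *v u = (\<Sum>k\<in>UNIV. (C *v u) $ k *\<^sub>R axis k 1)"
      by (simp add: vec_eq_iff axis_def if_distrib cong: if_cong)
    finally have "u = (\<Sum>k\<in>UNIV. (C *v u) $ k *\<^sub>R ?F k)"
      by (simp add: mv.sum_right mv.scaleR_right)
    then have "l u = (\<Sum>k\<in>UNIV. (C *v u) $ k *\<^sub>R l (?F k))"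
      by (metis (no_types, lifting) linear_sum[OF l(1)] linear_scale[OF l(1)] sum.cong)
    then show ?thesis by (simp add: l(2))
  qed
  show ?thesis using 1 2 by (intro exI[of _ ?F]) blast
qed

text \<open>The squared norm of a 1-form \<open>l\<close>: it is definite and equals the squared norm of the dual vector.\<close>

lemma contract_square:
  fixes l :: "real^4 \<Rightarrow> real"
  assumes "linear l"
  shows "contract m (\<lambda>u v. l u * l v) \<ge> 0"
    and "contract m (\<lambda>u v. l u * l v) = 0 \<longleftrightarrow> (\<forall>u. l u = 0)"
    and "gip m (contract m (\<lambda>u v. l u *\<^sub>R v)) (contract m (\<lambda>u v. l u *\<^sub>R v)) = contract m (\<lambda>u v. l u * l v)"
proof -
  obtain F :: "4 \<Rightarrow> real^4" where on: "\<And>k n. gip m (F k) (F n) = (if k = n then 1 else 0)"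
    and zero: "\<And>(l :: real^4 \<Rightarrow> real) u. linear l \<Longrightarrow> (\<And>k. l (F k) = 0) \<Longrightarrow> l u = 0"
    using ex_orthonormal_frame by blast
  have c: "contract m (\<lambda>u v. l u * l v) = (\<Sum>k\<in>UNIV. l (F k) * l (F k))"
    by (rule contract_frame[OF on]) (simp_all add: linear_iff linear_add[OF assms] linear_scale[OF assms] algebra_simps)
  show "contract m (\<lambda>u v. l u * l v) \<ge> 0"
    unfolding c by (intro sum_nonneg) simp
  show "contract m (\<lambda>u v. l u * l v) = 0 \<longleftrightarrow> (\<forall>u. l u = 0)"
    unfolding c by (subst sum_nonneg_eq_0_iff) (auto intro: zero[OF assms])
  have "contract m (\<lambda>u v. l u *\<^sub>R v) = (\<Sum>k\<in>UNIV. l (F k) *\<^sub>R F k)"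
    by (rule contract_frame[OF on]) (simp_all add: linear_iff linear_add[OF assms] linear_scale[OF assms] algebra_simps)
  then show "gip m (contract m (\<lambda>u v. l u *\<^sub>R v)) (contract m (\<lambda>u v. l u *\<^sub>R v)) = contract m (\<lambda>u v. l u * l v)"
    by (simp add: c linear_sum[OF linear_gip(1)] linear_sum[OF linear_gip(2)] gip_linear on if_distrib cong: if_cong)
qed

end

context hermitian_patch
begin

lemma Wplus_norm2_iff:
  assumes "x \<in> S"
  shows "Wplus_norm2 G J x = 3/8 * (scal_star G J x - scal G x / 3)\<^sup>2
    \<longleftrightarrow> (\<forall>A\<in>self_dual (G x) (J x). weyl_op G x A = model_op (weyl_coeff x) (J x) A)"
proof -
  interpret ac: algebraic_curvature "G x" "J x" "curvature G x" by (rule algebraic_curvature[OF assms])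
  show ?thesis
    using ac.weyl_norm_iff by (simp only: Wplus_norm2_def weyl_coeff_def curvature_quantities_of)
qed

lemma weyl_model_iff:
  "weyl_model \<longleftrightarrow> (\<forall>x\<in>S. Wplus_norm2 G J x = 3/8 * (scal_star G J x - scal G x / 3)\<^sup>2)"
  unfolding weyl_model_def using Wplus_norm2_iff by blast

text \<open>Since \<open>|W\<^sub>+|\<^sup>2 = (3/2) a\<^sup>2\<close> near \<open>x\<close>, the derivative of \<open>|W\<^sub>+|\<close> is that of \<open>a\<close> up to the factor \<open>\<plusminus> sqrt(3/2)\<close>. Where \<open>a\<close>
  vanishes the norm need not be differentiable.\<close>

lemma grad_norm_weyl:
  assumes model: weyl_model and x: "x \<in> S" and "weyl_coeff x \<noteq> 0"
  shows "grad_norm2 G (\<lambda>y. sqrt (Wplus_norm2 G J y)) x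
    = contract (G x) (\<lambda>u v. 3/2 * (pd weyl_coeff u x * pd weyl_coeff v x))"
proof -
  interpret H: hermitian_space "G x" "J x" by (rule hermitian[OF x])
  define s where "s = sqrt (3/2 * (weyl_coeff x)\<^sup>2)"
  have s: "s > 0" "s * s = 3/2 * (weyl_coeff x)\<^sup>2" using assms(3) by (simp_all add: s_def)
  have N: "Wplus_norm2 G J y = 3/2 * (weyl_coeff y)\<^sup>2" if "y \<in> S" for y
    using model that by (simp add: weyl_model_iff weyl_coeff_def power2_eq_square field_simps)
  let ?l = "\<lambda>u. 3/2 * weyl_coeff x * pd weyl_coeff u x / s"
  have "((\<lambda>y. sqrt (3/2 * (weyl_coeff y)\<^sup>2)) has_derivative ?l) (at x)"
    by (rule derivative_eq_intros refl frechet_derivative_works[THEN iffD1, OF diff_weyl_coeff[OF x]] | use assms(3) s in \<open>simp add: s_def fun_eq_iff field_simps\<close>)+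
  then have "((\<lambda>y. sqrt (Wplus_norm2 G J y)) has_derivative ?l) (at x)"
    by (rule has_derivative_transform_within_open[OF _ open_S x]) (simp add: N)
  then have pd: "pd (\<lambda>y. sqrt (Wplus_norm2 G J y)) u x = ?l u" for u
    by (rule pd_eqI)
  have "linear (frechet_derivative weyl_coeff (at x))"
    using linear_frechet_derivative diff_weyl_coeff[OF x] by blast
  then have l: "linear ?l"
    by (simp add: linear_iff add_divide_distrib distrib_left)
  have e: "?l u * ?l v = 3/2 * (pd weyl_coeff u x * pd weyl_coeff v x)" for u v
  proof -
    have "?l u * ?l v = (9/4 * (weyl_coeff x)\<^sup>2 * (pd weyl_coeff u x * pd weyl_coeff v x)) / (s * s)"
      by (simp add: power2_eq_square field_simps)
    then show ?thesis using assms(3) by (simp add: s(2))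
  qed
  show ?thesis
    using H.contract_square(3)[OF l] by (simp only: grad_norm2_def grad_def pd e)
qed

text \<open>The two sides differ by \<open>(9/2) a\<^sup>2 (|\<beta>|\<^sup>2 + |\<gamma>|\<^sup>2)\<close>, where \<open>\<beta>\<close> and \<open>\<gamma>\<close> are the components of \<open>\<nabla>J\<close>.\<close>

lemma nabla_weyl_norm_iff:
  assumes model: weyl_model and x: "x \<in> S" and a: "weyl_coeff x \<noteq> 0"
  shows "nabla_Wplus_norm2 G J x = grad_norm2 G (\<lambda>y. sqrt (Wplus_norm2 G J y)) x
    \<longleftrightarrow> (\<forall>u. nabla_end G (\<lambda>_. u) J x = 0)"
proof -
  interpret H: hermitian_space "G x" "J x" by (rule hermitian[OF x])
  obtain I K where q: "quaternionic (G x) (J x) I K" using H.ex_quaternionic by blast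
  interpret quaternionic "G x" "J x" I K by (rule q)
  obtain \<beta> \<gamma> :: "real^4 \<Rightarrow> real" where l: "linear \<beta>" "linear \<gamma>"
    and N: "\<And>u. cov G u J x = \<beta> u *\<^sub>R I + \<gamma> u *\<^sub>R K"
    using cov_J_components[OF x q] by blast
  let ?Q = "\<lambda>l. contract (G x) (\<lambda>u v. l u * l v :: real)"
  have "nabla_Wplus_norm2 G J x = grad_norm2 G (\<lambda>y. sqrt (Wplus_norm2 G J y)) x
      + 9/2 * (weyl_coeff x)\<^sup>2 * (?Q \<beta> + ?Q \<gamma>)"
    unfolding nabla_weyl_norm[OF model x q N] grad_norm_weyl[OF model x a]
    by (simp only: contract_add contract_mult)
  then have "nabla_Wplus_norm2 G J x = grad_norm2 G (\<lambda>y. sqrt (Wplus_norm2 G J y)) x \<longleftrightarrow> ?Q \<beta> + ?Q \<gamma> = 0"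
    using a by simp
  also have "\<dots> \<longleftrightarrow> (\<forall>u. \<beta> u = 0 \<and> \<gamma> u = 0)"
    using H.contract_square(1,2)[OF l(1)] H.contract_square(1,2)[OF l(2)] by (auto simp: add_nonneg_eq_0_iff)
  also have "\<dots> \<longleftrightarrow> (\<forall>u. cov G u J x = 0)"
  proof -
    have "\<beta> u *\<^sub>R I + \<gamma> u *\<^sub>R K = 0 \<longleftrightarrow> \<beta> u = 0 \<and> \<gamma> u = 0" for u
      using coefficients_zero[of 0 "\<beta> u" "\<gamma> u"] by auto
    then show ?thesis by (simp add: N)
  qed
  finally show ?thesis by (simp add: nabla_end_cov[OF x diff_J[OF x]])
qed

text \<open>The Ricci identity for a parallel \<open>J\<close>: the second derivative of \<open>J\<close> is symmetric, and \<open>dJ = J conn - conn J\<close>, so the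
  antisymmetrized derivative of the right side is the commutator of \<open>J\<close> with the curvature.\<close>

lemma kaehler_curvature:
  assumes par: "\<And>y u. y \<in> S \<Longrightarrow> cov G u J y = 0" and x: "x \<in> S"
  shows "curvature G x u v (J x *v w) = J x *v curvature G x u v w"
proof -
  have dJ: "pd J u y = J y ** conn G u y - conn G u y ** J y" if "y \<in> S" for u y
    using par[OF that, of u] by (simp add: cov_def eq_diff_eq add_eq_0_iff algebra_simps)
  have dc: "conn G w differentiable (at x)" for w by (rule diff_conn[OF x])
  let ?rhs = "\<lambda>w z. J x ** pd (conn G w) z x + pd J z x ** conn G w x
      - (conn G w x ** pd J z x + pd (conn G w) z x ** J x)"
  have "pd (pd J w) z x = ?rhs w z" for w z
  proof -
    have "pd (pd J w) z x = pd (\<lambda>y. J y ** conn G w y - conn G w y ** J y) z x"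
      by (rule pd_cong[OF open_S x]) (auto simp: dJ intro!: smooth_onD(1)[OF _ x] smooth_onD(3) smooth_J)
    also have "\<dots> = pd (\<lambda>y. J y ** conn G w y) z x - pd (\<lambda>y. conn G w y ** J y) z x"
      by (rule pd_diff) (intro smooth_onD(1)[OF _ x] smooth_rules smooth_J smooth_conn)+
    finally show ?thesis
      by (simp add: pd_matrix_mult diff_J[OF x] dc)
  qed
  moreover have "pd (pd J u) v x = pd (pd J v) u x"
    by (rule mixed_derivatives[OF open_S smooth_J x])
  ultimately have "?rhs u v = ?rhs v u" by metis
  then have "curv_mat G u v x ** J x = J x ** curv_mat G u v x"
    by (simp add: dJ[OF x] curv_mat_def mat_algebra algebra_simps)
  then show ?thesis
    by (simp add: curvature_matrix x matrix_vector_mul_assoc)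
qed

lemma kaehler_weyl_model:
  assumes "\<And>y u. y \<in> S \<Longrightarrow> nabla_end G (\<lambda>_. u) J y = 0"
  shows weyl_model
proof -
  have c: "cov G u J y = 0" if "y \<in> S" for y u
    using assms[OF that] nabla_end_cov[OF that diff_J[OF that]] by simp
  have "Wplus_norm2 G J x = 3/8 * (scal_star G J x - scal G x / 3)\<^sup>2" if x: "x \<in> S" for x
  proof -
    interpret ac: algebraic_curvature "G x" "J x" "curvature G x" by (rule algebraic_curvature[OF x])
    show ?thesis
      using ac.weyl_norm_kaehler kaehler_curvature[OF c x]
      by (simp add: Wplus_norm2_def curvature_quantities_of)
  qed
  then show ?thesis using weyl_model_iff by blast
qed

lemma weyl_coeff_nonzero:
  assumes weyl_model "x \<in> S" "A \<in> self_dual (G x) (J x)" "weyl_op G x A \<noteq> 0"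
  shows "weyl_coeff x \<noteq> 0"
  using assms by (auto simp: weyl_model_def model_op_def)

end


section \<open>Change of charts\<close>

lemma pd_compose:
  assumes "f differentiable (at x)" "h differentiable (at (f x))"
  shows "pd (\<lambda>y. h (f y)) u x = pd h (pd f u x) (f x)"
  by (rule pd_eqI[OF has_derivative_compose]) (use assms frechet_derivative_works in auto)

lemma smooth_on_subset: "smooth_on S f \<Longrightarrow> T \<subseteq> S \<Longrightarrow> smooth_on T f"
proof -
  have "Ck_on n f S \<Longrightarrow> T \<subseteq> S \<Longrightarrow> Ck_on n f T" for n and f :: "'a \<Rightarrow> 'b"
    by (induction n arbitrary: f) (auto intro: continuous_on_subset)
  then show "smooth_on S f \<Longrightarrow> T \<subseteq> S \<Longrightarrow> smooth_on T f"
    unfolding smooth_on_def by blast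
qed

lemma hermitian_patch_subset:
  assumes "hermitian_patch S G J" "open T" "T \<subseteq> S"
  shows "hermitian_patch T G J"
proof -
  interpret hermitian_patch S G J by fact
  have T: "x \<in> S" if "x \<in> T" for x using assms(3) that by blast
  show ?thesis
    by (intro hermitian_patch.intro metric_patch.intro hermitian_patch_axioms.intro assms(2)
        smooth_on_subset[OF smooth_G assms(3)] smooth_on_subset[OF smooth_J assms(3)]
        sym_G pos_G JJ skew_J T)
qed

lemma axis_expansion: "u = (\<Sum>k\<in>UNIV. u $ k *\<^sub>R axis k 1)" for u :: "real^4"
  by (simp add: vec_eq_iff axis_def if_distrib cong: if_cong)

context metric_patch
begin

lemma linear_conn: "x \<in> S \<Longrightarrow> linear (\<lambda>u. conn G u x)"
  by (simp add: linear_iff conn_add conn_scale)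

lemma conn_expand: "x \<in> S \<Longrightarrow> conn G u x = (\<Sum>k\<in>UNIV. u $ k *\<^sub>R conn G (axis k 1) x)"
  using linear_sum[OF linear_conn, of x "\<lambda>k. u $ k *\<^sub>R axis k 1" UNIV]
  by (simp add: axis_expansion[of u, symmetric] conn_scale)

lemma pd_conn_expand:
  assumes x: "x \<in> S"
  shows "pd (conn G u) w x = (\<Sum>k\<in>UNIV. u $ k *\<^sub>R pd (conn G (axis k 1)) w x)"
proof -
  have "pd (conn G u) w x = pd (\<lambda>y. \<Sum>k\<in>UNIV. u $ k *\<^sub>R conn G (axis k 1) y) w x"
    by (rule pd_cong[OF open_S x]) (auto simp: conn_expand[symmetric] diff_conn x)
  also have "\<dots> = (\<Sum>k\<in>UNIV. u $ k *\<^sub>R pd (conn G (axis k 1)) w x)"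
    by (rule pd_eqI, intro has_derivative_sum has_derivative_scaleR_right frechet_derivative_works[THEN iffD1] diff_conn x)
  finally show ?thesis .
qed

end

text \<open>A coordinate change \<open>\<tau>\<close> with Jacobian matrix \<open>D\<close> that is compatible with the metrics and complex structures.\<close>

locale chart_change = P: hermitian_patch U G J + P': hermitian_patch S' G' J'
  for U G J S' G' J' +
  fixes \<tau> :: "real^4 \<Rightarrow> real^4" and D C :: "real^4 \<Rightarrow> real^4^4"
  assumes smooth_\<tau>: "smooth_on U \<tau>" and \<tau>_in: "y \<in> U \<Longrightarrow> \<tau> y \<in> S'"
    and D: "y \<in> U \<Longrightarrow> D y *v u = pd \<tau> u y"
    and DC: "y \<in> U \<Longrightarrow> D y ** C y = mat 1" and CD: "y \<in> U \<Longrightarrow> C y ** D y = mat 1"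
    and iso: "y \<in> U \<Longrightarrow> gip (G' (\<tau> y)) (D y *v u) (D y *v v) = gip (G y) u v"
    and JD: "y \<in> U \<Longrightarrow> J' (\<tau> y) ** D y = D y ** J y"
begin

lemma smooth_D: "smooth_on U D"
proof (rule smooth_on_cong[OF P.open_S])
  show "smooth_on U (\<lambda>y. matrix (\<lambda>u. pd \<tau> u y))"
    by (intro P.smooth_matrix smooth_onD(3) smooth_\<tau>)
  show "matrix (\<lambda>u. pd \<tau> u y) = D y" if "y \<in> U" for y
    using D[OF that] matrix_of_mult[of "D y"] by simp
qed

lemma diff_D: "y \<in> U \<Longrightarrow> D differentiable (at y)"
  by (rule smooth_onD(1)[OF smooth_D])

lemma diff_\<tau>: "y \<in> U \<Longrightarrow> \<tau> differentiable (at y)"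
  by (rule smooth_onD(1)[OF smooth_\<tau>])

lemma pd_D_sym:
  assumes "y \<in> U"
  shows "pd D u y *v v = pd D v y *v u"
proof -
  have "pd D u y *v v = pd (pd \<tau> v) u y" for u v
  proof -
    have "pd (\<lambda>z. D z *v v) u y = pd (pd \<tau> v) u y"
      by (rule pd_cong[OF P.open_S assms]) (auto simp: D intro!: smooth_onD(1)[OF _ assms] P.smooth_rules smooth_D)
    then show ?thesis by (simp add: pd_matrix_vector_mult diff_D assms)
  qed
  then show ?thesis using mixed_derivatives[OF P.open_S smooth_\<tau> assms] by simp
qed

lemma pd_after_\<tau>: "y \<in> U \<Longrightarrow> f differentiable (at (\<tau> y)) \<Longrightarrow> pd (\<lambda>z. f (\<tau> z)) w y = pd f (D y *v w) (\<tau> y)"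
  by (simp add: pd_compose diff_\<tau> D)

lemma diff_after_\<tau>: "y \<in> U \<Longrightarrow> f differentiable (at (\<tau> y)) \<Longrightarrow> (\<lambda>z. f (\<tau> z)) differentiable (at y)"
  using differentiable_chain_at[of \<tau> y f] by (simp add: diff_\<tau> o_def)

text \<open>The transformation law of the Christoffel symbols. Transporting the connection of \<open>G'\<close> back by \<open>\<tau>\<close> gives a
  torsion-free metric connection for \<open>G\<close>, and there is only one. Torsion-freeness needs the symmetry of the second
  derivative of \<open>\<tau>\<close>.\<close>

lemma conn_change:
  assumes y: "y \<in> U"
  shows "D y ** conn G u y = conn G' (D y *v u) (\<tau> y) ** D y + pd D u y"
proof -
  \<comment> \<open>The connection matrix transported back; the derivative of \<open>D\<close> makes it a connection for \<open>G\<close>.\<close>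
  define K where "K w = C y ** (conn G' (D y *v w) (\<tau> y) ** D y + pd D w y)" for w
  have DK: "D y ** K w = conn G' (D y *v w) (\<tau> y) ** D y + pd D w y" for w
    by (simp add: K_def matrix_mul_assoc DC y)
  have sd: "smooth_on U D" "smooth_on U (\<lambda>y. transpose (D y))"
    by (intro P.smooth_rules smooth_D)+
  note dD = sd[THEN smooth_onD(1), OF y]
  have dG': "G' differentiable (at (\<tau> y))"
    by (rule smooth_onD(1)[OF P'.smooth_G \<tau>_in[OF y]])
  note dGt = diff_after_\<tau>[OF y dG']
  have dGD: "(\<lambda>z. G' (\<tau> z) ** D z) differentiable (at y)"
    using mm.FDERIV[OF frechet_derivative_works[THEN iffD1, OF dGt] frechet_derivative_works[THEN iffD1, OF dD(1)]]
    by (rule differentiableI)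
  have eq: "transpose (D z) ** (G' (\<tau> z) ** D z) = G z" if "z \<in> U" for z
    using iso[OF that] by (simp add: gip_eq_iff[of _ "G z"] gip_congruence matrix_mul_assoc)
  have pG: "pd G w y = pd (\<lambda>z. transpose (D z) ** (G' (\<tau> z) ** D z)) w y" for w
    by (rule pd_cong[OF P.open_S y]) (simp_all add: eq smooth_onD(1)[OF P.smooth_G y])
  have m: "pd G' (D y *v w) (\<tau> y) = transpose (conn G' (D y *v w) (\<tau> y)) ** G' (\<tau> y) + G' (\<tau> y) ** conn G' (D y *v w) (\<tau> y)" for w
    by (rule P'.metric_connection[OF \<tau>_in[OF y]])
  have pG2: "pd G w y = transpose (K w) ** G y + G y ** K w" for w
  proof -
    have "pd G w y = transpose (D y) ** (G' (\<tau> y) ** pd D w y + pd G' (D y *v w) (\<tau> y) ** D y)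
        + transpose (pd D w y) ** (G' (\<tau> y) ** D y)"
      by (simp add: pG pd_matrix_mult dD dGt dGD pd_transpose pd_after_\<tau> dG' y)
    also have "\<dots> = transpose (D y ** K w) ** (G' (\<tau> y) ** D y) + transpose (D y) ** (G' (\<tau> y) ** (D y ** K w))"
      unfolding DK by (simp add: m mat_algebra)
    also have "\<dots> = transpose (K w) ** G y + G y ** K w"
      by (simp add: eq[OF y, symmetric] mat_algebra)
    finally show ?thesis .
  qed
  have sym: "K u *v v = K v *v u" for u v
    by (simp add: K_def mat_algebra P'.torsion_free[OF \<tau>_in[OF y], of "D y *v u"] pd_D_sym[OF y, of u])
  have "(\<lambda>u v. K u *v v) = christoffel G y"
  proof (subst christoffel_iff[OF P.inv_G[OF y] P.sym_G[OF y] refl P.linear_dG[OF y]])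
    show "gip (pd G w y) u v = gip (pd G w y) v u" for u v w
    proof -
      have "transpose (pd G w y) = pd G w y"
        by (simp add: pG2 mat_algebra P.transpose_G[OF y])
      then show ?thesis using gip_sym_iff by blast
    qed
    show "(\<forall>u v. K u *v v = K v *v u) \<and>
      (\<forall>w u v. gip (pd G w y) u v = gip (G y) (K w *v u) v + gip (G y) u (K w *v v))"
      using sym by (simp add: pG2 gip_matrix_linear gip_mult)
  qed
  then have "K u = conn G u y" for u
    unfolding conn_def by (metis matrix_of_mult)
  then show ?thesis using DK by simp
qed

lemma pd_conn_after_\<tau>:
  assumes y: "y \<in> U"
  shows "(\<lambda>z. conn G' (D z *v u) (\<tau> z)) differentiable (at y)"
    and "pd (\<lambda>z. conn G' (D z *v u) (\<tau> z)) v y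
      = pd (conn G' (D y *v u)) (D y *v v) (\<tau> y) + conn G' (pd D v y *v u) (\<tau> y)"
proof -
  let ?c = "\<lambda>k z. (D z *v u) $ k" and ?E = "\<lambda>k z. conn G' (axis k 1) (\<tau> z)"
  have c: "(?c k has_derivative (\<lambda>v. (pd D v y *v u) $ k)) (at y)" for k
    using bounded_linear.has_derivative[OF bounded_linear_compose[OF bounded_linear_vec_nth mv.bounded_linear_left]
        frechet_derivative_works[THEN iffD1, OF diff_D[OF y]]] .
  have dE: "conn G' (axis k 1) differentiable (at (\<tau> y))" for k
    by (rule P'.diff_conn[OF \<tau>_in[OF y]])
  have E: "(?E k has_derivative (\<lambda>v. pd (conn G' (axis k 1)) (D y *v v) (\<tau> y))) (at y)" for k
  proof -
    have "frechet_derivative (?E k) (at y) = (\<lambda>v. pd (conn G' (axis k 1)) (D y *v v) (\<tau> y))"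
      by (rule ext) (rule pd_after_\<tau>[OF y dE])
    then show ?thesis
      using frechet_derivative_works[THEN iffD1, OF diff_after_\<tau>[OF y dE[of k]]] by simp
  qed
  have "((\<lambda>z. \<Sum>k\<in>UNIV. ?c k z *\<^sub>R ?E k z) has_derivative (\<lambda>v. \<Sum>k\<in>UNIV.
      ?c k y *\<^sub>R pd (conn G' (axis k 1)) (D y *v v) (\<tau> y) + (pd D v y *v u) $ k *\<^sub>R ?E k y)) (at y)"
    by (intro has_derivative_sum has_derivative_scaleR c E)
  then have der: "((\<lambda>z. conn G' (D z *v u) (\<tau> z)) has_derivative (\<lambda>v. \<Sum>k\<in>UNIV.
      ?c k y *\<^sub>R pd (conn G' (axis k 1)) (D y *v v) (\<tau> y) + (pd D v y *v u) $ k *\<^sub>R ?E k y)) (at y)"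
    by (rule has_derivative_transform_within_open[OF _ P.open_S y]) (simp add: P'.conn_expand[symmetric] \<tau>_in)
  then show "(\<lambda>z. conn G' (D z *v u) (\<tau> z)) differentiable (at y)"
    by (rule differentiableI)
  show "pd (\<lambda>z. conn G' (D z *v u) (\<tau> z)) v y
      = pd (conn G' (D y *v u)) (D y *v v) (\<tau> y) + conn G' (pd D v y *v u) (\<tau> y)"
    by (simp add: pd_eqI[OF der] P'.pd_conn_expand[OF \<tau>_in[OF y], of "D y *v u"]
        P'.conn_expand[OF \<tau>_in[OF y], of "pd D v y *v u"] sum.distrib)
qed

text \<open>In the derivative of the transformation law of the connection every term with derivatives of the
  Jacobian matrix is symmetric in \<open>u\<close> and \<open>v\<close> or cancels against a term of the commutator of the connection matrices.\<close>

lemma curv_mat_change: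
  assumes y: "y \<in> U"
  shows "D y ** curv_mat G u v y = curv_mat G' (D y *v u) (D y *v v) (\<tau> y) ** D y"
proof -
  have dD: "D differentiable (at y)" "(pd D w) differentiable (at y)" for w
    by (intro smooth_onD(1)[OF _ y] smooth_onD(3) smooth_D)+
  have dc: "conn G w differentiable (at y)" for w by (rule P.diff_conn[OF y])
  note dc' = pd_conn_after_\<tau>(1)[OF y] and pc' = pd_conn_after_\<tau>(2)[OF y]
  \<comment> \<open>Derivative of the transformation law of the connection.\<close>
  have step: "D y ** pd (conn G w) z y + pd D z y ** conn G w y
      = conn G' (D y *v w) (\<tau> y) ** pd D z y
        + (pd (conn G' (D y *v w)) (D y *v z) (\<tau> y) + conn G' (pd D z y *v w) (\<tau> y)) ** D y + pd (pd D w) z y" for w z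
  proof -
    have dm: "(\<lambda>x. conn G' (D x *v w) (\<tau> x) ** D x) differentiable (at y)"
      using mm.FDERIV[OF frechet_derivative_works[THEN iffD1, OF dc'] frechet_derivative_works[THEN iffD1, OF dD(1)]]
      by (rule differentiableI)
    have "pd (\<lambda>x. D x ** conn G w x) z y = pd (\<lambda>x. conn G' (D x *v w) (\<tau> x) ** D x + pd D w x) z y"
      by (rule pd_cong[OF P.open_S y])
         (auto simp: conn_change intro!: smooth_onD(1)[OF _ y] P.smooth_rules P.smooth_conn smooth_D)
    then show ?thesis
      by (simp add: pd_matrix_mult pd_add dD dc dc' dm pc')
  qed
  have mixed: "pd (pd D u) v y = pd (pd D v) u y"
    by (rule mixed_derivatives[OF P.open_S smooth_D y])
  have s1: "D y ** pd (conn G w) z y = conn G' (D y *v w) (\<tau> y) ** pd D z y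
        + (pd (conn G' (D y *v w)) (D y *v z) (\<tau> y) + conn G' (pd D z y *v w) (\<tau> y)) ** D y + pd (pd D w) z y
        - pd D z y ** conn G w y" for w z
    using step[of w z] by (simp add: eq_diff_eq)
  have s2: "D y ** (conn G w y ** conn G z y) = conn G' (D y *v w) (\<tau> y) ** (conn G' (D y *v z) (\<tau> y) ** D y + pd D z y)
      + pd D w y ** conn G z y" for w z
  proof -
    have "D y ** (conn G w y ** conn G z y) = conn G' (D y *v w) (\<tau> y) ** (D y ** conn G z y) + pd D w y ** conn G z y"
      by (simp add: matrix_mul_assoc conn_change[OF y, of w] mm.add_left)
    then show ?thesis by (simp only: conn_change[OF y])
  qed
  have "D y ** curv_mat G u v y = D y ** pd (conn G v) u y - D y ** pd (conn G u) v y
      + D y ** (conn G u y ** conn G v y) - D y ** (conn G v y ** conn G u y)"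
    by (simp add: curv_mat_def mat_algebra)
  then show ?thesis
    unfolding s1 s2 by (simp add: curv_mat_def mixed pd_D_sym[OF y, of u v] mat_algebra)
qed

lemma curvature_change:
  assumes y: "y \<in> U"
  shows "curvature_isometry (G y) (J y) (G' (\<tau> y)) (J' (\<tau> y)) (D y) (C y) (curvature G y) (curvature G' (\<tau> y))"
proof (intro curvature_isometry.intro hermitian_isometry.intro hermitian_isometry_axioms.intro
    curvature_isometry_axioms.intro P.hermitian P.trilinear_curvature P'.trilinear_curvature y \<tau>_in DC CD iso JD)
  show "curvature G' (\<tau> y) (D y *v u) (D y *v v) (D y *v w) = D y *v curvature G y u v w" for u v w
    by (simp add: P.curvature_matrix P'.curvature_matrix y \<tau>_in matrix_vector_mul_assoc curv_mat_change)
qed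

text \<open>By naturality the self-dual Weyl operator does not vanish in one chart if it does not vanish in the other.\<close>

lemma weyl_op_nonzero:
  assumes y: "y \<in> U" and A: "A \<in> self_dual (G' (\<tau> y)) (J' (\<tau> y))" "weyl_op G' (\<tau> y) A \<noteq> 0"
  shows "\<exists>B\<in>self_dual (G y) (J y). weyl_op G y B \<noteq> 0"
proof -
  interpret curvature_isometry "G y" "J y" "G' (\<tau> y)" "J' (\<tau> y)" "D y" "C y" "curvature G y" "curvature G' (\<tau> y)"
    by (rule curvature_change[OF y])
  let ?B = "C y ** A ** D y"
  have AB: "A = D y ** ?B ** C y"
    by (simp add: matrix_mul_assoc[symmetric] inverse_mult DC)
  have "?B \<in> self_dual (G y) (J y)"
    using A(1) self_dual_conj[of ?B] AB by simp
  moreover have "weyl_op G y ?B \<noteq> 0"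
  proof
    assume "weyl_op G y ?B = 0"
    then have "weyl_op G' (\<tau> y) A = 0"
      using weyl_op_conj[of ?B] AB by (simp add: curvature_quantities_of(4) mm.zero_left mm.zero_right)
    then show False using A(2) by simp
  qed
  ultimately show ?thesis by blast
qed

end

section \<open>Charts of an almost Hermitian manifold\<close>

lemma chart_patch:
  assumes "almost_hermitian_4_manifold \<A> g J" "c \<in> \<A>"
  shows "hermitian_patch (snd c ` fst c) (g c) (J c)"
proof -
  have at: "is_chart c" and R: "riemannian_metric \<A> g" and E: "endomorphism_field \<A> J"
    and H: "\<forall>x\<in>snd c ` fst c. J c x ** J c x = - mat 1 \<and> (\<forall>u v. gip (g c x) (J c x *v u) v = - gip (g c x) u (J c x *v v))"
    using assms unfolding almost_hermitian_4_manifold_def smooth_atlas_def by blast+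
  have G: "smooth_on (snd c ` fst c) (g c)"
    "\<forall>x\<in>snd c ` fst c. (\<forall>u v. gip (g c x) u v = gip (g c x) v u) \<and> (\<forall>u. u \<noteq> 0 \<longrightarrow> gip (g c x) u u > 0)"
    using R assms(2) unfolding riemannian_metric_def by blast+
  have J: "smooth_on (snd c ` fst c) (J c)"
    using E assms(2) unfolding endomorphism_field_def by blast
  have "open (snd c ` fst c)" using at by (simp add: is_chart_def)
  then show ?thesis
    by (intro hermitian_patch.intro metric_patch.intro hermitian_patch_axioms.intro G(1) J) (use G(2) H in blast)+
qed

lemma chart_open_image:
  assumes "is_chart c" "open V" "V \<subseteq> fst c"
  shows "open (snd c ` V)"
proof -
  obtain \<psi> where h: "homeomorphism (fst c) (snd c ` fst c) (snd c) \<psi>"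
    and o: "open (snd c ` fst c)" "open (fst c)"
    using assms(1) unfolding is_chart_def by blast
  have "openin (top_of_set (fst c)) V"
    using o(2) assms(2,3) by (simp add: openin_open_eq)
  then have "openin (top_of_set (snd c ` fst c)) (snd c ` V)"
    by (rule homeomorphism_imp_open_map[OF h])
  then show ?thesis
    using o(1) by (rule openin_open_trans)
qed

lemma chart_inj: "is_chart c \<Longrightarrow> inj_on (snd c) (fst c)"
proof -
  assume "is_chart c"
  then obtain \<psi> where "homeomorphism (fst c) (snd c ` fst c) (snd c) \<psi>"
    unfolding is_chart_def by blast
  then show ?thesis
    by (intro inj_on_inverseI[of _ \<psi>]) (simp add: homeomorphism_def)
qed

lemma transition_at: "is_chart c \<Longrightarrow> q \<in> fst c \<Longrightarrow> transition c c' (snd c q) = snd c' q"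
  by (simp add: transition_def inv_into_f_f chart_inj)

text \<open>Membership in \<^const>\<open>M_plus\<close> refers to some chart around the point; this makes it available in every chart.\<close>

lemma weyl_op_nonzero_chart:
  assumes M: "almost_hermitian_4_manifold \<A> g J" and c: "c \<in> \<A>" "c' \<in> \<A>" and p: "p \<in> fst c" "p \<in> fst c'"
    and A: "A \<in> self_dual (g c' (snd c' p)) (J c' (snd c' p))" "weyl_op (g c') (snd c' p) A \<noteq> 0"
  shows "\<exists>B\<in>self_dual (g c (snd c p)) (J c (snd c p)). weyl_op (g c) (snd c p) B \<noteq> 0"
proof -
  let ?V = "fst c \<inter> fst c'" and ?\<tau> = "transition c c'" and ?\<sigma> = "transition c' c"
  let ?U = "snd c ` ?V"
  have ch: "is_chart c" "is_chart c'" and sm: "smooth_on ?U ?\<tau>" "smooth_on (snd c' ` (fst c' \<inter> fst c)) ?\<sigma>"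
    using M c unfolding almost_hermitian_4_manifold_def smooth_atlas_def by blast+
  have oU: "open ?U"
    using ch by (intro chart_open_image) (auto simp: is_chart_def)
  define D where "D y = matrix (\<lambda>u. pd ?\<tau> u y)" for y
  define C where "C y = matrix (\<lambda>u. pd ?\<sigma> u (?\<tau> y))" for y
  have D: "D y *v u = pd ?\<tau> u y" if "y \<in> ?U" for y u
    unfolding D_def using linear_frechet_derivative[OF smooth_onD(1)[OF sm(1) that]] by (rule matrix_mult_basis)
  have \<tau>y: "?\<tau> y \<in> snd c' ` ?V" "?\<sigma> (?\<tau> y) = y" if "y \<in> ?U" for y
    using that ch by (auto simp: transition_at)
  have CD: "C y ** D y = mat 1" if y: "y \<in> ?U" for y
  proof -
    have d: "?\<tau> differentiable (at y)" "?\<sigma> differentiable (at (?\<tau> y))"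
      using smooth_onD(1)[OF sm(1) y] smooth_onD(1)[OF sm(2)] \<tau>y(1)[OF y] by (simp_all add: Int_commute)
    have C: "C y *v u = pd ?\<sigma> u (?\<tau> y)" for u
      unfolding C_def using linear_frechet_derivative[OF d(2)] by (rule matrix_mult_basis)
    have "C y *v (D y *v u) = u" for u
    proof -
      have "u = pd (\<lambda>y. y) u y" by simp
      also have "\<dots> = pd (\<lambda>y. ?\<sigma> (?\<tau> y)) u y"
        by (rule pd_cong[OF oU y]) (simp_all add: \<tau>y(2))
      also have "\<dots> = C y *v (D y *v u)"
        by (simp add: pd_compose d C D y)
      finally show ?thesis by simp
    qed
    then show ?thesis
      by (simp add: matrix_eq matrix_vector_mul_assoc[symmetric])
  qed
  then have DC: "D y ** C y = mat 1" if "y \<in> ?U" for y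
    using that matrix_left_right_inverse by blast
  have iso: "gip (g c' (?\<tau> y)) (D y *v u) (D y *v v) = gip (g c y) u v"
    and JD: "J c' (?\<tau> y) *v (D y *v u) = D y *v (J c y *v u)" if y: "y \<in> ?U" for y u v
    using M c y unfolding almost_hermitian_4_manifold_def riemannian_metric_def endomorphism_field_def Let_def
    by (simp_all only: D[OF y])
  have "hermitian_patch ?U (g c) (J c)"
    using hermitian_patch_subset[OF chart_patch[OF M c(1)] oU] by blast
  moreover have "?\<tau> y \<in> snd c' ` fst c'" if "y \<in> ?U" for y
    using \<tau>y(1)[OF that] by blast
  ultimately interpret chart_change ?U "g c" "J c" "snd c' ` fst c'" "g c'" "J c'" ?\<tau> D C
    using chart_patch[OF M c(2)] sm(1) D CD DC iso JD
    by (intro chart_change.intro chart_change_axioms.intro)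
       (auto simp: matrix_eq matrix_vector_mul_assoc[symmetric])
  have "snd c p \<in> ?U" "?\<tau> (snd c p) = snd c' p"
    using p ch by (auto simp: transition_at)
  then show ?thesis
    using weyl_op_nonzero[of "snd c p" A] A by simp
qed

section \<open>The characterization of Kaehler manifolds\<close>

theorem theorem3p1:
  fixes \<A> :: "'m::{t2_space,second_countable_topology} chart set"
    and g J :: "'m chart \<Rightarrow> real^4 \<Rightarrow> real^4^4"
  assumes "almost_hermitian_4_manifold \<A> g J"
    and "closure (M_plus \<A> g J) = UNIV"
  shows "kaehler \<A> g J \<longleftrightarrow>
    (\<forall>c\<in>\<A>. \<forall>p\<in>fst c.
       Wplus_norm2 (g c) (J c) (snd c p) =
         3/8 * (scal_star (g c) (J c) (snd c p) - scal (g c) (snd c p) / 3)\<^sup>2) \<and>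
    (\<forall>c\<in>\<A>. \<forall>p\<in>fst c \<inter> M_plus \<A> g J.
       nabla_Wplus_norm2 (g c) (J c) (snd c p) =
         grad_norm2 (g c) (\<lambda>y. sqrt (Wplus_norm2 (g c) (J c) y)) (snd c p))"
proof -
  let ?S = "\<lambda>c :: 'm chart. snd c ` fst c"
  let ?model = "\<lambda>c. hermitian_patch.weyl_model (?S c) (g c) (J c)"
  let ?norms = "\<lambda>c p. nabla_Wplus_norm2 (g c) (J c) (snd c p) =
         grad_norm2 (g c) (\<lambda>y. sqrt (Wplus_norm2 (g c) (J c) y)) (snd c p)"
  note patch = chart_patch[OF assms(1)]
  have model: "?model c \<longleftrightarrow> (\<forall>p\<in>fst c. Wplus_norm2 (g c) (J c) (snd c p) =
         3/8 * (scal_star (g c) (J c) (snd c p) - scal (g c) (snd c p) / 3)\<^sup>2)" if "c \<in> \<A>" for c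
    using hermitian_patch.weyl_model_iff[OF patch[OF that]] by simp
  have norms: "?norms c p \<longleftrightarrow> (\<forall>u. nabla_end (g c) (\<lambda>_. u) (J c) (snd c p) = 0)"
    if c: "c \<in> \<A>" and p: "p \<in> fst c \<inter> M_plus \<A> g J" and m: "?model c" for c p
  proof -
    interpret hermitian_patch "?S c" "g c" "J c" by (rule patch[OF c])
    obtain B where "B \<in> self_dual (g c (snd c p)) (J c (snd c p))" "weyl_op (g c) (snd c p) B \<noteq> 0"
      using p weyl_op_nonzero_chart[OF assms(1) c] unfolding M_plus_def by blast
    then have "weyl_coeff (snd c p) \<noteq> 0"
      using weyl_coeff_nonzero[OF m] p by blast
    then show ?thesis
      using nabla_weyl_norm_iff[OF m] p by blast
  qed
  show ?thesis
  proof
    assume K: "kaehler \<A> g J"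
    have m: "?model c" if c: "c \<in> \<A>" for c
      by (rule hermitian_patch.kaehler_weyl_model[OF patch[OF c]]) (use K c in \<open>auto simp: kaehler_def\<close>)
    moreover have "?norms c p" if "c \<in> \<A>" "p \<in> fst c \<inter> M_plus \<A> g J" for c p
      using norms[OF that m[OF that(1)]] K that unfolding kaehler_def by blast
    ultimately show "(\<forall>c\<in>\<A>. \<forall>p\<in>fst c. Wplus_norm2 (g c) (J c) (snd c p) =
         3/8 * (scal_star (g c) (J c) (snd c p) - scal (g c) (snd c p) / 3)\<^sup>2) \<and>
      (\<forall>c\<in>\<A>. \<forall>p\<in>fst c \<inter> M_plus \<A> g J. ?norms c p)"
      using model by blast
  next
    assume *: "(\<forall>c\<in>\<A>. \<forall>p\<in>fst c. Wplus_norm2 (g c) (J c) (snd c p) =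
         3/8 * (scal_star (g c) (J c) (snd c p) - scal (g c) (snd c p) / 3)\<^sup>2) \<and>
      (\<forall>c\<in>\<A>. \<forall>p\<in>fst c \<inter> M_plus \<A> g J. ?norms c p)"
    show "kaehler \<A> g J"
      unfolding kaehler_def
    proof (intro ballI allI)
      fix c p u assume c: "c \<in> \<A>" and p: "p \<in> fst c"
      interpret hermitian_patch "?S c" "g c" "J c" by (rule patch[OF c])
      have m: weyl_model using * c model by blast
      let ?N = "\<lambda>q. cov (g c) u (J c) (snd c q)"
      have N: "nabla_end (g c) (\<lambda>_. u) (J c) (snd c q) = ?N q" if "q \<in> fst c" for q
        using that by (intro nabla_end_cov diff_J) auto
      obtain \<psi> where "homeomorphism (fst c) (?S c) (snd c) \<psi>" and "open (fst c)"
        using assms(1) c unfolding almost_hermitian_4_manifold_def smooth_atlas_def is_chart_def by blast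
      moreover have "smooth_on (?S c) (cov (g c) u (J c))"
        unfolding cov_def by (intro smooth_rules smooth_J smooth_conn)
      ultimately have "continuous_on (fst c) ?N"
        using continuous_on_compose[of "fst c" "snd c" "cov (g c) u (J c)"] smooth_onD(4)
        by (auto simp: homeomorphism_def o_def)
      then have "open (fst c \<inter> ?N -` (- {0}))"
        using \<open>open (fst c)\<close> by (intro continuous_open_preimage) auto
      moreover have "fst c \<inter> ?N -` (- {0}) \<inter> M_plus \<A> g J = {}"
      proof -
        have "?N q = 0" if "q \<in> fst c" "q \<in> M_plus \<A> g J" for q
        proof -
          have "q \<in> fst c \<inter> M_plus \<A> g J" using that by blast
          then have "\<forall>u. nabla_end (g c) (\<lambda>_. u) (J c) (snd c q) = 0"
            using * c norms[OF c _ m] by blast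
          then show ?thesis using N[OF that(1)] by simp
        qed
        then show ?thesis by blast
      qed
      \<comment> \<open>An open set that misses a dense set is empty.\<close>
      ultimately have "fst c \<inter> ?N -` (- {0}) = {}"
        using open_Int_closure_eq_empty[of "fst c \<inter> ?N -` (- {0})" "M_plus \<A> g J"] assms(2) by simp
      then show "nabla_end (g c) (\<lambda>_. u) (J c) (snd c p) = 0"
        using N[OF p] p by auto
    qed
  qed
qed

end
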